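(* Let $(\mathcal{M}=\mathcal{M}_0\times\mathbb{R}^2,\langle\cdot,\cdot\rangle_L)$ be a Gödel type spacetime with Riemannian part $(\mathcal{M}_0,\langle\cdot,\cdot\rangle_R)$ and coefficients $A,B,C$, that is, $\langle\cdot,\cdot\rangle_L=\langle\cdot,\cdot\rangle_R+A(x)\,dy^2+2B(x)\,dy\,dt-C(x)\,dt^2$ with $B^2(x)+A(x)C(x)>0$ for all $x\in\mathcal{M}_0$. Let $d$ be the distance on $\mathcal{M}_0$ induced by $\langle\cdot,\cdot\rangle_R$. Assume that: (1) $(\mathcal{M}_0,\langle\cdot,\cdot\rangle_R)$ is a complete Riemannian manifold; (2) there exist $\lambda\ge 0$, $k\in\mathbb{R}$ and a point $x_0\in\mathcal{M}_0$ such that the (positive) map $\mu:\mathcal{M}_0\to\mathbb{R}$ given by $$\mu(x)=C(x)-A(x)+\sqrt{(A(x)+C(x))^2+4B(x)^2}$$ satisfies $$\frac{1}{\mu(x)}\le\lambda\, d^2(x,x_0)+k\quad\text{for all }x\in\mathcal{M}_0.$$ Then $(\mathcal{M},\langle\cdot,\cdot\rangle_L)$ is geodesically complete.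
   Context: A Lorentzian manifold $(\mathcal{M},\langle\cdot,\cdot\rangle_L)$ is a Gödel type spacetime if there is a smooth finite-dimensional (connected) Riemannian manifold $(\mathcal{M}_0,\langle\cdot,\cdot\rangle_R)$ such that $\mathcal{M}=\mathcal{M}_0\times\mathbb{R}^2$ and $$\langle\cdot,\cdot\rangle_L=\langle\cdot,\cdot\rangle_R+A(x)\,dy^2+2B(x)\,dy\,dt-C(x)\,dt^2,$$ where $x\in\mathcal{M}_0$, $(y,t)$ are the natural coordinates of $\mathbb{R}^2$, and $A,B,C$ are $C^1$ real-valued functions on $\mathcal{M}_0$ with $H(x)=B^2(x)+A(x)C(x)>0$ for all $x\in\mathcal{M}_0$ (this makes the metric Lorentzian). A semi-Riemannian manifold is geodesically complete if every inextendible geodesic (of any causal character) is defined on all of $\mathbb{R}$. *)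

theory Defs
  imports "HOL-Analysis.Analysis"
begin

section \<open>Functions of class C^k on open subsets of Euclidean spaces\<close>

primrec Ck_on :: "nat \<Rightarrow> ('e::real_normed_vector \<Rightarrow> 'f::real_normed_vector) \<Rightarrow> 'e set \<Rightarrow> bool" where
  "Ck_on 0 f S \<longleftrightarrow> continuous_on S f"
| "Ck_on (Suc n) f S \<longleftrightarrow> (\<forall>x\<in>S. f differentiable (at x)) \<and>
     (\<forall>v. Ck_on n (\<lambda>x. frechet_derivative f (at x) v) S)"

definition smooth_on :: "('e::real_normed_vector \<Rightarrow> 'f::real_normed_vector) \<Rightarrow> 'e set \<Rightarrow> bool" where
  "smooth_on f S \<longleftrightarrow> (\<forall>n. Ck_on n f S)"


section \<open>Smooth manifolds\<close>

text \<open>A manifold is given by an indexed atlas with values in a Euclidean space \<open>'e\<close>. Its underlying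
  set is the union of the chart domains, an open subset of the ambient type \<open>'a\<close> with the
  subspace topology. The values of a chart map outside its domain are irrelevant.\<close>

record ('i, 'a, 'e) atlas =
  idx :: "'i set"
  chart_dom :: "'i \<Rightarrow> 'a set"
  chart_map :: "'i \<Rightarrow> 'a \<Rightarrow> 'e"

definition points :: "('i, 'a, 'e) atlas \<Rightarrow> 'a set" where
  "points M = (\<Union>i\<in>idx M. chart_dom M i)"

definition chart_inv :: "('i, 'a, 'e) atlas \<Rightarrow> 'i \<Rightarrow> 'e \<Rightarrow> 'a" where
  "chart_inv M i = inv_into (chart_dom M i) (chart_map M i)"

definition transition :: "('i, 'a, 'e) atlas \<Rightarrow> 'i \<Rightarrow> 'i \<Rightarrow> 'e \<Rightarrow> 'e" where
  "transition M i j = chart_map M j \<circ> chart_inv M i"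

text \<open>Hausdorffness and second countability come from the sort of \<open>'a\<close>.\<close>

definition smooth_manifold ::
  "('i, 'a::{t2_space, second_countable_topology}, 'e::euclidean_space) atlas \<Rightarrow> bool" where
  "smooth_manifold M \<longleftrightarrow>
     (\<forall>i\<in>idx M. open (chart_dom M i) \<and> open (chart_map M i ` chart_dom M i) \<and>
        homeomorphism (chart_dom M i) (chart_map M i ` chart_dom M i) (chart_map M i) (chart_inv M i)) \<and>
     (\<forall>i\<in>idx M. \<forall>j\<in>idx M.
        smooth_on (transition M i j) (chart_map M i ` (chart_dom M i \<inter> chart_dom M j)))"

definition Ck_function :: "nat \<Rightarrow> ('i, 'a, 'e::euclidean_space) atlas \<Rightarrow> ('a \<Rightarrow> real) \<Rightarrow> bool" where
  "Ck_function k M f \<longleftrightarrow>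
     (\<forall>i\<in>idx M. Ck_on k (f \<circ> chart_inv M i) (chart_map M i ` chart_dom M i))"


section \<open>Metric tensors\<close>

text \<open>A covariant 2-tensor field \<open>g\<close> is given by its local expressions: \<open>g i p u v\<close> is its value at
  \<open>p\<close> on the tangent vectors whose components in the chart \<open>i\<close> are \<open>u\<close> and \<open>v\<close>.\<close>

type_synonym ('i, 'a, 'e) tensor2 = "'i \<Rightarrow> 'a \<Rightarrow> 'e \<Rightarrow> 'e \<Rightarrow> real"

definition riemannian_metric ::
  "('i, 'a, 'e::euclidean_space) atlas \<Rightarrow> ('i, 'a, 'e) tensor2 \<Rightarrow> bool" where
  "riemannian_metric M g \<longleftrightarrow>
     (\<forall>i\<in>idx M. \<forall>p\<in>chart_dom M i.
        bilinear (g i p) \<and> (\<forall>u v. g i p u v = g i p v u) \<and> (\<forall>u. u \<noteq> 0 \<longrightarrow> g i p u u > 0)) \<and>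
     (\<forall>i\<in>idx M. \<forall>u v.
        smooth_on (\<lambda>z. g i (chart_inv M i z) u v) (chart_map M i ` chart_dom M i)) \<and>
     (\<forall>i\<in>idx M. \<forall>j\<in>idx M. \<forall>p\<in>chart_dom M i \<inter> chart_dom M j. \<forall>u v.
        let D = frechet_derivative (transition M i j) (at (chart_map M i p))
        in g i p u v = g j p (D u) (D v))"

definition riemannian_manifold ::
  "('i, 'a::{t2_space, second_countable_topology}, 'e::euclidean_space) atlas
     \<Rightarrow> ('i, 'a, 'e) tensor2 \<Rightarrow> bool" where
  "riemannian_manifold M g \<longleftrightarrow> smooth_manifold M \<and> riemannian_metric M g"


section \<open>Riemannian distance\<close>

definition C1_arc ::
  "('i, 'a, 'e::euclidean_space) atlas \<Rightarrow> real \<Rightarrow> real \<Rightarrow> (real \<Rightarrow> 'a) \<Rightarrow> bool" where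
  "C1_arc M a b \<gamma> \<longleftrightarrow> (\<forall>i\<in>idx M. \<exists>v.
     continuous_on {s \<in> {a..b}. \<gamma> s \<in> chart_dom M i} v \<and>
     (\<forall>s\<in>{a..b}. \<gamma> s \<in> chart_dom M i \<longrightarrow>
        ((chart_map M i \<circ> \<gamma>) has_vector_derivative v s) (at s within {a..b})))"

text \<open>The finite set \<open>S\<close> holds the break points; at each of them the one-sided derivatives
  exist and are the limits of the derivative from that side.\<close>

definition piecewise_C1_curve ::
  "('i, 'a::topological_space, 'e::euclidean_space) atlas \<Rightarrow> (real \<Rightarrow> 'a) \<Rightarrow> bool" where
  "piecewise_C1_curve M \<gamma> \<longleftrightarrow>
     continuous_on {0..1} \<gamma> \<and> \<gamma> ` {0..1} \<subseteq> points M \<and>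
     (\<exists>S. finite S \<and>
        (\<forall>a b. 0 \<le> a \<and> a < b \<and> b \<le> 1 \<and> {a<..<b} \<inter> S = {} \<longrightarrow> C1_arc M a b \<gamma>))"

text \<open>By the transformation law of \<open>g\<close>, the speed does not depend on the chosen chart.\<close>

definition speed ::
  "('i, 'a, 'e::euclidean_space) atlas \<Rightarrow> ('i, 'a, 'e) tensor2 \<Rightarrow> (real \<Rightarrow> 'a) \<Rightarrow> real \<Rightarrow> real" where
  "speed M g \<gamma> s =
     (let i = (SOME i. i \<in> idx M \<and> \<gamma> s \<in> chart_dom M i);
          v = vector_derivative (chart_map M i \<circ> \<gamma>) (at s)
      in sqrt (g i (\<gamma> s) v v))"

definition curve_length ::
  "('i, 'a, 'e::euclidean_space) atlas \<Rightarrow> ('i, 'a, 'e) tensor2 \<Rightarrow> (real \<Rightarrow> 'a) \<Rightarrow> real" where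
  "curve_length M g \<gamma> = integral {0..1} (speed M g \<gamma>)"

text \<open>The value 0 for points outside the manifold only serves to make the function total and
  nonnegative, as the locale \<open>Metric_space\<close> demands. On a connected manifold the infimum is
  over a nonempty set.\<close>

definition riemannian_dist ::
  "('i, 'a::topological_space, 'e::euclidean_space) atlas \<Rightarrow> ('i, 'a, 'e) tensor2
     \<Rightarrow> 'a \<Rightarrow> 'a \<Rightarrow> real" where
  "riemannian_dist M g p q =
     (if p \<in> points M \<and> q \<in> points M
      then Inf {curve_length M g \<gamma> |\<gamma>. piecewise_C1_curve M \<gamma> \<and> \<gamma> 0 = p \<and> \<gamma> 1 = q}
      else 0)"

definition complete_riemannian ::
  "('i, 'a::topological_space, 'e::euclidean_space) atlas \<Rightarrow> ('i, 'a, 'e) tensor2 \<Rightarrow> bool" where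
  "complete_riemannian M g \<longleftrightarrow> Metric_space.mcomplete (points M) (riemannian_dist M g)"


section \<open>Geodesics of a semi-Riemannian metric\<close>

text \<open>The directional derivative along \<open>v\<close>, in the chart \<open>i\<close>, of the component of \<open>g\<close> on the
  constant coordinate fields \<open>u\<close> and \<open>w\<close>.\<close>

definition metric_deriv ::
  "('i, 'a, 'e::euclidean_space) atlas \<Rightarrow> ('i, 'a, 'e) tensor2
     \<Rightarrow> 'i \<Rightarrow> 'a \<Rightarrow> 'e \<Rightarrow> 'e \<Rightarrow> 'e \<Rightarrow> real" where
  "metric_deriv M g i p v u w =
     frechet_derivative (\<lambda>z. g i (chart_inv M i z) u w) (at (chart_map M i p)) v"

text \<open>The Levi-Civita connection in the chart \<open>i\<close>: the covariant derivative along \<open>u\<close> of the constant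
  coordinate field \<open>v\<close> is given by the Koszul formula (the Lie bracket terms vanish). In components
  this is the usual formula for the Christoffel symbols.\<close>

definition christoffel ::
  "('i, 'a, 'e::euclidean_space) atlas \<Rightarrow> ('i, 'a, 'e) tensor2
     \<Rightarrow> 'i \<Rightarrow> 'a \<Rightarrow> 'e \<Rightarrow> 'e \<Rightarrow> 'e" where
  "christoffel M g i p u v = (THE \<Gamma>. \<forall>w.
     2 * g i p \<Gamma> w = metric_deriv M g i p u v w + metric_deriv M g i p v u w
                     - metric_deriv M g i p w u v)"

definition geodesic_on ::
  "('i, 'a::topological_space, 'e::euclidean_space) atlas \<Rightarrow> ('i, 'a, 'e) tensor2
     \<Rightarrow> real set \<Rightarrow> (real \<Rightarrow> 'a) \<Rightarrow> bool" where
  "geodesic_on M g J c \<longleftrightarrow>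
     open J \<and> is_interval J \<and> J \<noteq> {} \<and> continuous_on J c \<and> c ` J \<subseteq> points M \<and>
     (\<forall>i\<in>idx M. \<exists>v. \<forall>s\<in>J. c s \<in> chart_dom M i \<longrightarrow>
        ((chart_map M i \<circ> c) has_vector_derivative v s) (at s) \<and>
        (v has_vector_derivative - christoffel M g i (c s) (v s) (v s)) (at s))"

definition inextendible_geodesic ::
  "('i, 'a::topological_space, 'e::euclidean_space) atlas \<Rightarrow> ('i, 'a, 'e) tensor2
     \<Rightarrow> real set \<Rightarrow> (real \<Rightarrow> 'a) \<Rightarrow> bool" where
  "inextendible_geodesic M g J c \<longleftrightarrow>
     geodesic_on M g J c \<and>
     \<not> (\<exists>J' c'. J \<subset> J' \<and> geodesic_on M g J' c' \<and> (\<forall>s\<in>J. c' s = c s))"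

definition geodesically_complete ::
  "('i, 'a::topological_space, 'e::euclidean_space) atlas \<Rightarrow> ('i, 'a, 'e) tensor2 \<Rightarrow> bool" where
  "geodesically_complete M g \<longleftrightarrow> (\<forall>J c. inextendible_geodesic M g J c \<longrightarrow> J = UNIV)"


section \<open>Goedel type spacetimes\<close>

definition times_R2 :: "('i, 'a, 'e) atlas \<Rightarrow> ('i, 'a \<times> real \<times> real, 'e \<times> real \<times> real) atlas" where
  "times_R2 M =
     \<lparr> idx = idx M,
       chart_dom = (\<lambda>i. chart_dom M i \<times> UNIV),
       chart_map = (\<lambda>i (x, y, t). (chart_map M i x, y, t)) \<rparr>"

text \<open>The polarised form of \<open>g + A dy^2 + 2 B dy dt - C dt^2\<close>.\<close>

definition goedel_metric ::
  "('i, 'a, 'e) tensor2 \<Rightarrow> ('a \<Rightarrow> real) \<Rightarrow> ('a \<Rightarrow> real) \<Rightarrow> ('a \<Rightarrow> real)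
     \<Rightarrow> ('i, 'a \<times> real \<times> real, 'e \<times> real \<times> real) tensor2" where
  "goedel_metric g A B C =
     (\<lambda>i (x, y, t) (u, \<eta>, \<tau>) (u', \<eta>', \<tau>').
        g i x u u' + A x * \<eta> * \<eta>' + B x * (\<eta> * \<tau>' + \<tau> * \<eta>') - C x * \<tau> * \<tau>')"

text \<open>The data of a Goedel type spacetime; the spacetime itself is \<open>times_R2 M\<close> with
  \<open>goedel_metric g A B C\<close>.\<close>

definition goedel_data ::
  "('i, 'a::{t2_space, second_countable_topology}, 'e::euclidean_space) atlas
     \<Rightarrow> ('i, 'a, 'e) tensor2 \<Rightarrow> ('a \<Rightarrow> real) \<Rightarrow> ('a \<Rightarrow> real) \<Rightarrow> ('a \<Rightarrow> real) \<Rightarrow> bool" where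
  "goedel_data M g A B C \<longleftrightarrow>
     riemannian_manifold M g \<and> connected (points M) \<and>
     Ck_function 1 M A \<and> Ck_function 1 M B \<and> Ck_function 1 M C \<and>
     (\<forall>x\<in>points M. (B x)\<^sup>2 + A x * C x > 0)"

definition goedel_mu :: "('a \<Rightarrow> real) \<Rightarrow> ('a \<Rightarrow> real) \<Rightarrow> ('a \<Rightarrow> real) \<Rightarrow> 'a \<Rightarrow> real" where
  "goedel_mu A B C x = C x - A x + sqrt ((A x + C x)\<^sup>2 + 4 * (B x)\<^sup>2)"

end

theory Submission
  imports Defs
begin

text \<open>The coordinate fields of \<open>y\<close> and \<open>t\<close> are Killing, so along a geodesic with \<open>M0\<close>-part \<open>x\<close> the
  energy \<open>E\<close> and the momenta \<open>P = A y' + B t'\<close>, \<open>Q = B y' - C t'\<close> are constant. Solving for \<open>y'\<close>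
  and \<open>t'\<close> gives \<open>g(x', x') = E - q(P, Q)\<close>, where the quadratic form \<open>q\<close> is the inverse of the fibre
  metric and has least eigenvalue \<open>- 2 / \<mu>\<close>. By the hypothesis on \<open>1 / \<mu>\<close> the speed of \<open>x\<close> is at
  most \<open>K (1 + d(x, x0))\<close>, so on a bounded parameter interval \<open>x\<close> stays bounded, is Lipschitz, and by
  completeness converges at the end of the interval. Then \<open>y'\<close>, \<open>t'\<close> and the chart velocity of
  \<open>x\<close> are bounded as well, and the geodesic can be continued. As the coefficients are only \<open>C\<^sup>1\<close>, the
  continuation comes from Peano's theorem; uniqueness is not needed. The lower end is reduced to the
  upper one by reversing time.\<close>


section \<open>Calculus\<close>

text \<open>The metric is indefinite, so a conserved energy alone bounds no velocity. What helps is
  that, once \<open>P\<close> and \<open>Q\<close> are fixed, both the squared speed of the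
  Riemannian part and the fibre velocity are functions of the position \<open>x\<close> alone.
  Quadratic growth of \<open>1 / \<mu>\<close> makes this squared speed grow at most quadratically
  in the distance, so the speed grows at most linearly, which excludes escape in finite time. The
  fibre velocity is a quotient by \<open>H\<close>, on which there is no uniform bound; it is
  controlled only once \<open>x\<close> has a limit, where \<open>H\<close> is positive and the
  coefficients are continuous. Completeness gives convergence in the distance, whereas geodesics are
  continuous for the topology of the ambient type. Comparing the two is the purpose of the length
  estimates in charts. The continuation lives in one chart around the limit, but a geodesic must
  satisfy its equation in every chart it meets, so the equation has to be shown invariant for
  metrics of class \<open>C\<^sup>1\<close>. Inextendibility means that no proper extension exists,
  so a single continuation contradicts it.\<close>

text \<open>Product rule for a varying linear map applied to a varying vector. Differentiability in
  \<open>y\<close> is assumed for each fixed argument \<open>u\<close> separately; expanding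
  \<open>f y\<close> in the finite basis reduces the claim to a finite sum of ordinary
  products.\<close>

lemma has_derivative_linear_family:
  fixes L :: "'p::real_normed_vector \<Rightarrow> 'e::euclidean_space \<Rightarrow> 'f::real_normed_vector"
  assumes S: "open S" "x \<in> S"
    and lin: "\<And>y. y \<in> S \<Longrightarrow> linear (L y)"
    and D: "\<And>u. ((\<lambda>y. L y u) has_derivative DL u) (at x)"
    and f: "(f has_derivative f') (at x)"
  shows "((\<lambda>y. L y (f y)) has_derivative (\<lambda>h. DL (f x) h + L x (f' h))) (at x)"
proof -
  have expand: "L y u = (\<Sum>b\<in>Basis. (u \<bullet> b) *\<^sub>R L y b)" if "y \<in> S" for y u
  proof -
    have "L y u = L y (\<Sum>b\<in>Basis. (u \<bullet> b) *\<^sub>R b)" by (simp add: euclidean_representation)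
    also have "\<dots> = (\<Sum>b\<in>Basis. (u \<bullet> b) *\<^sub>R L y b)"
      using lin[OF that] by (simp add: linear_sum linear_scale)
    finally show ?thesis .
  qed
  \<comment> \<open>Nothing is assumed about how \<open>DL u\<close> depends on \<open>u\<close>;
    uniqueness of derivatives forces \<open>DL (f x)\<close> to be this combination of the
    \<open>DL b\<close>.\<close>
  have "((\<lambda>y. \<Sum>b\<in>Basis. (f x \<bullet> b) *\<^sub>R L y b) has_derivative
      (\<lambda>h. \<Sum>b\<in>Basis. (f x \<bullet> b) *\<^sub>R DL b h)) (at x)"
    by (auto intro!: derivative_eq_intros D)
  then have "((\<lambda>y. L y (f x)) has_derivative (\<lambda>h. \<Sum>b\<in>Basis. (f x \<bullet> b) *\<^sub>R DL b h)) (at x)"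
    by (rule has_derivative_transform_within_open[OF _ S]) (simp add: expand[of _ "f x"])
  then have DL: "DL (f x) = (\<lambda>h. \<Sum>b\<in>Basis. (f x \<bullet> b) *\<^sub>R DL b h)"
    using D has_derivative_unique by blast
  have "((\<lambda>y. \<Sum>b\<in>Basis. (f y \<bullet> b) *\<^sub>R L y b) has_derivative
      (\<lambda>h. \<Sum>b\<in>Basis. (f x \<bullet> b) *\<^sub>R DL b h + (f' h \<bullet> b) *\<^sub>R L x b)) (at x)"
    by (auto intro!: derivative_eq_intros D f)
  also have "(\<lambda>h. \<Sum>b\<in>Basis. (f x \<bullet> b) *\<^sub>R DL b h + (f' h \<bullet> b) *\<^sub>R L x b) =
      (\<lambda>h. DL (f x) h + L x (f' h))"
    by (rule ext) (simp add: DL sum.distrib expand[OF S(2), of "f' _"])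
  finally show ?thesis
    by (rule has_derivative_transform_within_open[OF _ S]) (simp add: expand[of _ "f _"])
qed

lemma has_derivative_bilinear_family:
  fixes G :: "'p::real_normed_vector \<Rightarrow> 'e::euclidean_space \<Rightarrow> 'e \<Rightarrow> real"
  assumes S: "open S" "x \<in> S"
    and bil: "\<And>y. y \<in> S \<Longrightarrow> bilinear (G y)"
    and D: "\<And>u w. ((\<lambda>y. G y u w) has_derivative DG u w) (at x)"
    and f: "(f has_derivative f') (at x)" and k: "(k has_derivative k') (at x)"
  shows "((\<lambda>y. G y (f y) (k y)) has_derivative
           (\<lambda>h. DG (f x) (k x) h + G x (f' h) (k x) + G x (f x) (k' h))) (at x)"
proof -
  have "((\<lambda>y. G y (f y) w) has_derivative (\<lambda>h. DG (f x) w h + G x (f' h) w)) (at x)" for w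
    by (rule has_derivative_linear_family[OF S _ D f]) (use bil in \<open>auto simp: bilinear_def\<close>)
  then show ?thesis
    using has_derivative_linear_family[OF S, of "\<lambda>y. G y (f y)" "\<lambda>w h. DG (f x) w h + G x (f' h) w", OF _ _ k] bil
    by (simp add: bilinear_def)
qed

lemma has_vector_derivative_bilinear_family:
  fixes G :: "'p::real_normed_vector \<Rightarrow> 'e::euclidean_space \<Rightarrow> 'e \<Rightarrow> real"
  assumes S: "open S" "z s \<in> S"
    and bil: "\<And>y. y \<in> S \<Longrightarrow> bilinear (G y)"
    and D: "\<And>u w. ((\<lambda>y. G y u w) has_derivative DG u w) (at (z s))"
    and z: "(z has_vector_derivative z') (at s)"
    and f: "(f has_vector_derivative f') (at s)" and k: "(k has_vector_derivative k') (at s)"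
  shows "((\<lambda>r. G (z r) (f r) (k r)) has_vector_derivative
           (DG (f s) (k s) z' + G (z s) f' (k s) + G (z s) (f s) k')) (at s)"
proof -
  have zc: "isCont z s" using z has_vector_derivative_continuous by blast
  obtain T where T: "open T" "s \<in> T" "\<And>r. r \<in> T \<Longrightarrow> z r \<in> S"
    using zc S by (metis continuous_at_open)
  have bz: "bilinear (G (z s))" using bil S by auto
  have "((\<lambda>r. G (z r) u w) has_derivative (\<lambda>h. DG u w (h *\<^sub>R z'))) (at s)" for u w
    using has_derivative_compose[OF z[unfolded has_vector_derivative_def] D] .
  then have "((\<lambda>r. G (z r) (f r) (k r)) has_derivative (\<lambda>h. DG (f s) (k s) (h *\<^sub>R z') +
     G (z s) (h *\<^sub>R f') (k s) + G (z s) (f s) (h *\<^sub>R k'))) (at s)"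
    using has_derivative_bilinear_family[OF T(1,2), of "\<lambda>r. G (z r)" "\<lambda>u w h. DG u w (h *\<^sub>R z')", OF _ _ f[unfolded has_vector_derivative_def] k[unfolded has_vector_derivative_def]]
      T bil by simp
  moreover have "linear (DG (f s) (k s))" using D has_derivative_linear by blast
  ultimately show ?thesis
    unfolding has_vector_derivative_def
    by (simp add: linear_scale bilinear_lmul[OF bz] bilinear_rmul[OF bz] distrib_left)
qed

section \<open>Symmetry of second derivatives\<close>

text \<open>The mean value theorem is applied twice: along \<open>u\<close> to the increment of
  \<open>f\<close> in direction \<open>w\<close>, then along \<open>w\<close> to the resulting
  increment of \<open>D y u\<close>. The second difference itself is symmetric in \<open>u\<close>
  and \<open>w\<close>, which the symmetry proof exploits by evaluating it in both orders.\<close>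

lemma second_difference_mean_value:
  fixes f :: "'e::real_normed_vector \<Rightarrow> real"
  assumes t: "0 < t"
    and S: "\<And>a b. 0 \<le> a \<Longrightarrow> a \<le> t \<Longrightarrow> 0 \<le> b \<Longrightarrow> b \<le> t \<Longrightarrow> z + a *\<^sub>R u + b *\<^sub>R w \<in> S"
    and f: "\<And>y. y \<in> S \<Longrightarrow> (f has_derivative D y) (at y)"
    and Du: "\<And>y. y \<in> S \<Longrightarrow> ((\<lambda>y. D y u) has_derivative D2 y) (at y)"
  shows "\<exists>a b. 0 < a \<and> a < t \<and> 0 < b \<and> b < t \<and>
    f (z + t *\<^sub>R u + t *\<^sub>R w) - f (z + t *\<^sub>R u) - f (z + t *\<^sub>R w) + f z =
      t * (t * D2 (z + a *\<^sub>R u + b *\<^sub>R w) w)"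
proof -
  have d1: "((\<lambda>s. f (z + s *\<^sub>R u + b *\<^sub>R w)) has_real_derivative D (z + s *\<^sub>R u + b *\<^sub>R w) u) (at s)"
    if "0 \<le> s" "s \<le> t" "0 \<le> b" "b \<le> t" for s b
  proof -
    have "((\<lambda>s. z + s *\<^sub>R u + b *\<^sub>R w) has_derivative (\<lambda>h. h *\<^sub>R u)) (at s)"
      by (auto intro!: derivative_eq_intros)
    from has_derivative_compose[OF this f[OF S[OF that]]]
    have "((\<lambda>s. f (z + s *\<^sub>R u + b *\<^sub>R w)) has_derivative (\<lambda>h. D (z + s *\<^sub>R u + b *\<^sub>R w) (h *\<^sub>R u))) (at s)" .
    moreover have "linear (D (z + s *\<^sub>R u + b *\<^sub>R w))" using f[OF S[OF that]] has_derivative_linear by blast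
    ultimately show ?thesis by (simp add: linear_scale has_real_derivative_iff_has_vector_derivative has_vector_derivative_def)
  qed
  have d2: "((\<lambda>b. D (z + a *\<^sub>R u + b *\<^sub>R w) u) has_real_derivative D2 (z + a *\<^sub>R u + b *\<^sub>R w) w) (at b)"
    if "0 \<le> a" "a \<le> t" "0 \<le> b" "b \<le> t" for a b
  proof -
    have "((\<lambda>b. z + a *\<^sub>R u + b *\<^sub>R w) has_derivative (\<lambda>h. h *\<^sub>R w)) (at b)"
      by (auto intro!: derivative_eq_intros)
    from has_derivative_compose[OF this Du[OF S[OF that]]]
    have "((\<lambda>b. D (z + a *\<^sub>R u + b *\<^sub>R w) u) has_derivative (\<lambda>h. D2 (z + a *\<^sub>R u + b *\<^sub>R w) (h *\<^sub>R w))) (at b)" .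
    moreover have "linear (D2 (z + a *\<^sub>R u + b *\<^sub>R w))" using Du[OF S[OF that]] has_derivative_linear by blast
    ultimately show ?thesis by (simp add: linear_scale has_real_derivative_iff_has_vector_derivative has_vector_derivative_def)
  qed
  \<comment> \<open>The summand \<open>0 *\<^sub>R w\<close> is kept so that \<open>d1\<close>
    differentiates both terms, with \<open>b = t\<close> and \<open>b = 0\<close>.\<close>
  let ?th = "\<lambda>s. f (z + s *\<^sub>R u + t *\<^sub>R w) - f (z + s *\<^sub>R u + 0 *\<^sub>R w)"
  have "\<exists>a. 0 < a \<and> a < t \<and> ?th t - ?th 0 =
      (t - 0) * (D (z + a *\<^sub>R u + t *\<^sub>R w) u - D (z + a *\<^sub>R u + 0 *\<^sub>R w) u)"
    using t by (intro MVT2 DERIV_diff d1) auto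
  then obtain a where a: "0 < a" "a < t" and e1: "?th t - ?th 0 =
      t * (D (z + a *\<^sub>R u + t *\<^sub>R w) u - D (z + a *\<^sub>R u + 0 *\<^sub>R w) u)" by auto
  have "\<exists>b. 0 < b \<and> b < t \<and> D (z + a *\<^sub>R u + t *\<^sub>R w) u - D (z + a *\<^sub>R u + 0 *\<^sub>R w) u
      = (t - 0) * D2 (z + a *\<^sub>R u + b *\<^sub>R w) w"
    using t a by (intro MVT2 d2) auto
  then obtain b where "0 < b" "b < t" and e2: "D (z + a *\<^sub>R u + t *\<^sub>R w) u - D (z + a *\<^sub>R u + 0 *\<^sub>R w) u
      = t * D2 (z + a *\<^sub>R u + b *\<^sub>R w) w" by auto
  with a e1 show ?thesis by (intro exI[of _ a] exI[of _ b]) (simp add: algebra_simps)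
qed

text \<open>Evaluating the second difference over a small parallelogram in both orders and
  cancelling \<open>t * t\<close> equates a value of \<open>D2\<close> at \<open>(u, w)\<close> with
  a value at \<open>(w, u)\<close>, at two points near \<open>z\<close>. Continuity at
  \<open>z\<close> makes the two values at \<open>z\<close> differ by less than any
  \<open>e\<close>.\<close>

lemma second_derivative_symmetric_real:
  fixes f :: "'e::real_normed_vector \<Rightarrow> real"
  assumes S: "open S" "z \<in> S"
    and f: "\<And>y. y \<in> S \<Longrightarrow> (f has_derivative D y) (at y)"
    and D2: "\<And>y u. y \<in> S \<Longrightarrow> ((\<lambda>y. D y u) has_derivative D2 y u) (at y)"
    and cont: "\<And>u w. continuous_on S (\<lambda>y. D2 y u w)"
  shows "D2 z u w = D2 z w u"
proof -
  have "\<bar>D2 z u w - D2 z w u\<bar> \<le> 0 + e" if e: "0 < e" for e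
  proof -
  have "isCont (\<lambda>y. D2 y u w) z" "isCont (\<lambda>y. D2 y w u) z"
    using cont S continuous_on_eq_continuous_at by blast+
  then obtain d1 d2 where d1: "d1 > 0" "\<And>y. dist y z < d1 \<Longrightarrow> dist (D2 y u w) (D2 z u w) < e/2"
    and d2: "d2 > 0" "\<And>y. dist y z < d2 \<Longrightarrow> dist (D2 y w u) (D2 z w u) < e/2"
    unfolding continuous_at_eps_delta by (metis e half_gt_zero)
  obtain d3 where d3: "d3 > 0" "ball z d3 \<subseteq> S" using S open_contains_ball by blast
  define d where "d = min d1 (min d2 d3)"
  have d: "d > 0" using d1 d2 d3 by (simp add: d_def)
  define c where "c = norm u + norm w + 1"
  \<comment> \<open>The parallelogram with sides \<open>t *\<^sub>R u\<close> and
    \<open>t *\<^sub>R w\<close> stays within \<open>d / 2\<close> of \<open>z\<close>; the summand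
    1 in \<open>c\<close> keeps the quotient meaningful when both vectors vanish.\<close>
  define t where "t = d / (2 * c)"
  have np: "norm u + norm w + 1 > 0" by (simp add: add_nonneg_pos)
  have t: "t > 0" using d np by (simp add: t_def c_def[symmetric])
  have near: "dist (z + a *\<^sub>R u + b *\<^sub>R w) z < d" if "0 \<le> a" "a \<le> t" "0 \<le> b" "b \<le> t" for a b
  proof -
    have "dist (z + a *\<^sub>R u + b *\<^sub>R w) z \<le> a * norm u + b * norm w"
      using norm_triangle_ineq[of "a *\<^sub>R u" "b *\<^sub>R w"] that by (simp add: dist_norm add.assoc)
    also have "\<dots> \<le> t * norm u + t * norm w"
      using that by (intro add_mono mult_right_mono) auto
    also have "\<dots> \<le> t * (norm u + norm w + 1)" using t by (simp add: algebra_simps)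
    also have "\<dots> = d / 2" using np by (simp add: t_def c_def[symmetric])
    also have "\<dots> < d" using d by simp
    finally show ?thesis .
  qed
  have inS: "z + a *\<^sub>R u + b *\<^sub>R w \<in> S" if "0 \<le> a" "a \<le> t" "0 \<le> b" "b \<le> t" for a b
    using near[OF that] d3 by (auto simp: d_def dist_commute)
  obtain a b where ab: "0 < a" "a < t" "0 < b" "b < t"
    and e1: "f (z + t *\<^sub>R u + t *\<^sub>R w) - f (z + t *\<^sub>R u) - f (z + t *\<^sub>R w) + f z =
      t * (t * D2 (z + a *\<^sub>R u + b *\<^sub>R w) u w)"
    using second_difference_mean_value[OF t inS f D2] by blast
  have inS': "z + b *\<^sub>R w + a *\<^sub>R u \<in> S" if "0 \<le> b" "b \<le> t" "0 \<le> a" "a \<le> t" for a b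
    using inS[of a b] that by (simp add: algebra_simps)
  obtain b' a' where ab': "0 < a'" "a' < t" "0 < b'" "b' < t"
    and e2: "f (z + t *\<^sub>R w + t *\<^sub>R u) - f (z + t *\<^sub>R w) - f (z + t *\<^sub>R u) + f z =
      t * (t * D2 (z + b' *\<^sub>R w + a' *\<^sub>R u) w u)"
    using second_difference_mean_value[OF t inS' f D2] by blast
  have eq: "z + b' *\<^sub>R w + a' *\<^sub>R u = z + a' *\<^sub>R u + b' *\<^sub>R w" "z + t *\<^sub>R w + t *\<^sub>R u = z + t *\<^sub>R u + t *\<^sub>R w"
    by (simp_all add: algebra_simps)
  have "t * (t * D2 (z + a *\<^sub>R u + b *\<^sub>R w) u w) = t * (t * D2 (z + a' *\<^sub>R u + b' *\<^sub>R w) w u)"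
    using e1 e2 unfolding eq by linarith
  then have "D2 (z + a *\<^sub>R u + b *\<^sub>R w) u w = D2 (z + a' *\<^sub>R u + b' *\<^sub>R w) w u" using t by simp
  moreover have "dist (D2 (z + a *\<^sub>R u + b *\<^sub>R w) u w) (D2 z u w) < e/2"
    using near[of a b] ab d1 by (auto simp: d_def)
  moreover have "dist (D2 (z + a' *\<^sub>R u + b' *\<^sub>R w) w u) (D2 z w u) < e/2"
    using near[of a' b'] ab' d2 by (auto simp: d_def)
  ultimately show ?thesis unfolding dist_real_def by linarith
  qed
  then have "\<bar>D2 z u w - D2 z w u\<bar> \<le> 0" by (rule field_le_epsilon)
  then show ?thesis by simp
qed

lemma second_derivative_symmetric:
  fixes f :: "'e::real_normed_vector \<Rightarrow> 'f::euclidean_space"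
  assumes S: "open S" "z \<in> S"
    and f: "\<And>y. y \<in> S \<Longrightarrow> (f has_derivative D y) (at y)"
    and D2: "\<And>y u. y \<in> S \<Longrightarrow> ((\<lambda>y. D y u) has_derivative D2 y u) (at y)"
    and cont: "\<And>u w. continuous_on S (\<lambda>y. D2 y u w)"
  shows "D2 z u w = D2 z w u"
proof (rule euclidean_eqI)
  fix b :: 'f assume "b \<in> Basis"
  show "D2 z u w \<bullet> b = D2 z w u \<bullet> b"
    by (rule second_derivative_symmetric_real[OF S, where f = "\<lambda>y. f y \<bullet> b" and D = "\<lambda>y h. D y h \<bullet> b" and ?D2.0 = "\<lambda>y u w. D2 y u w \<bullet> b"])
      (auto intro!: has_derivative_inner_left f D2 continuous_intros cont)
qed

section \<open>Linear systems with parameters and limits at an endpoint\<close>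

text \<open>Solutions of an injective linear system depend continuously on the parameter.
  \<open>L a\<close> is bounded below by some \<open>m\<close>, hence \<open>L x\<close> by
  \<open>m / 2\<close> for \<open>x\<close> near \<open>a\<close>, and the distance of
  \<open>sol x\<close> from \<open>sol a\<close> is at most \<open>2 / m\<close> times that of
  \<open>L x (sol x)\<close> from \<open>L x (sol a)\<close>. It is applied to the Christoffel
  symbols, which are given only implicitly by the Koszul formula.\<close>

lemma continuous_linear_solve:
  fixes L :: "'p::topological_space \<Rightarrow> 'e::euclidean_space \<Rightarrow> 'f::euclidean_space"
  assumes lin: "\<And>x. x \<in> S \<Longrightarrow> linear (L x)"
    and inj: "\<And>x. x \<in> S \<Longrightarrow> inj (L x)"
    and contL: "\<And>u. continuous_on S (\<lambda>x. L x u)"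
    and contR: "continuous_on S (\<lambda>x. L x (sol x))"
  shows "continuous_on S sol"
  unfolding continuous_on_def
proof
  fix a assume a: "a \<in> S"
  obtain m where m: "m > 0" "\<And>u. m * norm u \<le> norm (L a u)"
    using linear_inj_bounded_below_pos[OF lin[OF a] inj[OF a]] by (metis mult.commute)
  \<comment> \<open>This bounds the operator norm of \<open>L x - L a\<close> and tends to 0, being
    a finite sum of terms that do.\<close>
  define e where "e x = (\<Sum>b\<in>Basis. norm (L x b - L a b))" for x
  have e: "norm (L x u - L a u) \<le> e x * norm u" if "x \<in> S" for x u
  proof -
    have *: "L x u = (\<Sum>b\<in>Basis. (u \<bullet> b) *\<^sub>R L x b)" if "x \<in> S" for x
      using linear_sum[OF lin[OF that], of "\<lambda>b. (u \<bullet> b) *\<^sub>R b" Basis]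
      by (simp add: euclidean_representation linear_scale[OF lin[OF that]])
    have "norm (L x u - L a u) = norm (\<Sum>b\<in>Basis. (u \<bullet> b) *\<^sub>R (L x b - L a b))"
      by (simp add: *[OF that] *[OF a] sum_subtractf scaleR_diff_right)
    also have "\<dots> \<le> (\<Sum>b\<in>Basis. \<bar>u \<bullet> b\<bar> * norm (L x b - L a b))"
      by (rule order_trans[OF norm_sum]) simp
    also have "\<dots> \<le> (\<Sum>b\<in>Basis. norm u * norm (L x b - L a b))"
      by (intro sum_mono mult_right_mono Basis_le_norm) auto
    finally show ?thesis by (simp add: e_def sum_distrib_left mult.commute)
  qed
  have "(e \<longlongrightarrow> (\<Sum>b\<in>Basis. norm (L a b - L a b))) (at a within S)"
    unfolding e_def using contL a by (intro tendsto_intros) (auto simp: continuous_on_def)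
  then have "eventually (\<lambda>x. e x < m / 2) (at a within S)"
    using m by (intro order_tendstoD(2)) auto
  moreover have "eventually (\<lambda>x. x \<in> S) (at a within S)"
    by (simp add: eventually_at_filter)
  ultimately have ev: "eventually (\<lambda>x. norm (sol x - sol a) \<le> (2 / m) * norm (L x (sol x) - L x (sol a))) (at a within S)"
  proof eventually_elim
    case (elim x)
    let ?u = "sol x - sol a"
    have "m * norm ?u \<le> norm (L a ?u)" by (rule m)
    also have "\<dots> \<le> norm (L x ?u) + norm (L x ?u - L a ?u)"
      by (metis add.commute diff_add_cancel norm_minus_commute norm_triangle_ineq)
    also have "norm (L x ?u - L a ?u) \<le> e x * norm ?u" using elim e by blast
    also have "e x * norm ?u \<le> (m/2) * norm ?u" using elim by (intro mult_right_mono) auto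
    finally have "(m/2) * norm ?u \<le> norm (L x ?u)" by simp
    then show ?case using m by (simp add: linear_diff[OF lin[OF elim(2)]] field_simps)
  qed
  have "((\<lambda>x. (2 / m) * norm (L x (sol x) - L x (sol a))) \<longlongrightarrow> (2 / m) * norm (L a (sol a) - L a (sol a))) (at a within S)"
    using contL contR a by (intro tendsto_intros) (auto simp: continuous_on_def)
  then have "((\<lambda>x. sol x - sol a) \<longlongrightarrow> 0) (at a within S)"
    by (intro Lim_null_comparison[OF ev]) simp
  then show "(sol \<longlongrightarrow> sol a) (at a within S)" by (simp add: LIM_zero_iff)
qed

text \<open>A bounded derivative makes \<open>f\<close> Lipschitz, hence uniformly continuous, hence
  extendable to the closure.\<close>

lemma bounded_derivative_imp_limit_at_left:
  fixes f :: "real \<Rightarrow> 'e::banach"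
  assumes ab: "a < b"
    and f: "\<And>s. s \<in> {a<..<b} \<Longrightarrow> (f has_vector_derivative f' s) (at s)"
    and K: "\<And>s. s \<in> {a<..<b} \<Longrightarrow> norm (f' s) \<le> K"
  shows "\<exists>l. (f \<longlongrightarrow> l) (at_left b)"
proof -
  have lip: "norm (f s - f t) \<le> K * norm (s - t)" if "s \<in> {a<..<b}" "t \<in> {a<..<b}" for s t
  proof (rule differentiable_bound[of "{a<..<b}" f "\<lambda>s h. h *\<^sub>R f' s"])
    show "(f has_derivative (\<lambda>h. h *\<^sub>R f' x)) (at x within {a<..<b})" if "x \<in> {a<..<b}" for x
      using f[OF that] has_derivative_at_withinI unfolding has_vector_derivative_def by blast
    show "onorm (\<lambda>h. h *\<^sub>R f' x) \<le> K" if "x \<in> {a<..<b}" for x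
      using K[OF that] by (intro onorm_le) (simp add: mult.commute[of K] mult_left_mono)
  qed (use that in auto)
  have "(a + b) / 2 \<in> {a<..<b}" using ab by simp
  then have K0: "K \<ge> 0" using K norm_ge_zero order_trans by blast
  have "K-lipschitz_on {a<..<b} f"
    using lip K0 by (intro lipschitz_onI) (auto simp: dist_norm)
  then have "uniformly_continuous_on {a<..<b} f" by (rule lipschitz_on_uniformly_continuous)
  moreover have "b \<in> closure {a<..<b}" using ab by simp
  ultimately obtain l where "(f \<longlongrightarrow> l) (at b within {a<..<b})"
    using uniformly_continuous_on_extension_at_closure by blast
  moreover have "at b within {a<..<b} = at_left b" using ab
    by (intro at_within_nhd[of b "{a<..}"]) auto
  ultimately show ?thesis by auto
qed


section \<open>Peano's existence theorem\<close>

text \<open>Euler's step functions all lie in a product of copies of a closed ball, which is compact by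
  Tychonoff. Any cluster point is a solution, since each of the estimates expressing this involves
  the values at two times only and hence is a closed condition in the product topology.\<close>

lemma peano_bounded:
  fixes F :: "'x::euclidean_space \<Rightarrow> 'x"
  assumes cF: "continuous_on UNIV F" and K: "\<And>x. norm (F x) \<le> K"
  shows "\<exists>\<xi>. \<xi> 0 = a \<and> (\<forall>s\<in>{0..1}. (\<xi> has_vector_derivative F (\<xi> s)) (at s within {0..1::real}))"
proof -
  define N where "N n = real (Suc n)" for n
  have N: "N n > 0" for n by (simp add: N_def)
  define X where "X n = rec_nat a (\<lambda>k x. x + (1 / N n) *\<^sub>R F x)" for n
  have X0: "X n 0 = a" and XS: "X n (Suc k) = X n k + (1 / N n) *\<^sub>R F (X n k)" for n k
    by (simp_all add: X_def)
  have K0: "K \<ge> 0" using K norm_ge_zero order_trans by blast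
  \<comment> \<open>Clipping the time to the unit interval makes the step functions total with
    values in one ball, so that they lie in a product indexed by all reals.\<close>
  define ix where "ix n s = nat \<lfloor>max 0 (min 1 s) * N n\<rfloor>" for n and s :: real
  have ix: "real (ix n s) \<le> s * N n" "s * N n < real (ix n s) + 1" if "0 \<le> s" "s \<le> 1" for n s
  proof -
    have "s * N n \<ge> 0" using that N[of n] by simp
    then show "real (ix n s) \<le> s * N n" "s * N n < real (ix n s) + 1"
      using that unfolding ix_def by (auto simp: min_def max_def)
  qed
  have ixN: "real (ix n s) \<le> N n" for n s
  proof -
    let ?s = "max 0 (min 1 s)"
    have "real (ix n s) = real (ix n ?s)" by (simp add: ix_def)
    also have "\<dots> \<le> ?s * N n" by (rule ix) auto
    also have "\<dots> \<le> 1 * N n" using N[of n] by (intro mult_right_mono) auto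
    finally show ?thesis by simp
  qed
  have step: "norm (X n (k + p) - X n k) \<le> K * (real p / N n)" for n k p
  proof (induction p)
    case (Suc p)
    have "norm (X n (k + Suc p) - X n k) \<le> norm (X n (k + p) - X n k) + norm ((1 / N n) *\<^sub>R F (X n (k + p)))"
      using norm_triangle_ineq[of "X n (k + p) - X n k" "(1 / N n) *\<^sub>R F (X n (k + p))"]
      by (simp add: XS algebra_simps)
    also have "\<dots> \<le> K * (real p / N n) + K * (1 / N n)"
      using Suc K[of "X n (k+p)"] N[of n] by (intro add_mono) (auto simp: divide_simps)
    finally show ?case by (simp add: add_divide_distrib distrib_left)
  qed simp
  \<comment> \<open>Euler polygons move with speed at most \<open>K\<close>, so up to time 1 their
    vertices stay in this ball.\<close>
  define C where "C = cball a K"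
  have XC: "X n k \<in> C" if "real k \<le> N n" for n k
  proof -
    have "norm (X n k - a) \<le> K * (real k / N n)" using step[of n 0 k] by (simp add: X0)
    also have "\<dots> \<le> K * 1" using that N[of n] K0 by (intro mult_left_mono) auto
    finally show ?thesis by (simp add: C_def dist_norm norm_minus_commute)
  qed
  have "uniformly_continuous_on C F"
    using cF continuous_on_subset by (intro compact_uniformly_continuous) (auto simp: C_def)
  then have uc: "\<exists>d>0. \<forall>x\<in>C. \<forall>y\<in>C. dist y x < d \<longrightarrow> dist (F y) (F x) < e" if "e > 0" for e
    using that unfolding uniformly_continuous_on_def by blast
  define x where "x n s = X n (ix n s)" for n s
  define U where "U = (PiE UNIV (\<lambda>_::real. C))"
  have xU: "x n \<in> U" for n using XC ixN by (auto simp: U_def x_def)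
  have "compactin (product_topology (\<lambda>_. euclidean) UNIV) U"
    unfolding U_def compactin_PiE by (auto simp: C_def)
  then have "compact U" by (simp add: euclidean_product_topology)
  moreover have "filtermap x sequentially \<noteq> bot" "eventually (\<lambda>f. f \<in> U) (filtermap x sequentially)"
    by (simp_all add: filtermap_bot_iff eventually_filtermap xU)
  ultimately obtain \<xi> where \<xi>: "\<xi> \<in> U" "inf (nhds \<xi>) (filtermap x sequentially) \<noteq> bot"
    unfolding compact_filter by blast
  \<comment> \<open>The product has uncountably many factors, so no subsequence of \<open>x\<close>
    need converge. Closed conditions that hold eventually still pass to the cluster point.\<close>
  have clus: "\<xi> \<in> Q" if "closed Q" "eventually (\<lambda>n. x n \<in> Q) sequentially" for Q
  proof (rule ccontr)
    assume "\<xi> \<notin> Q"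
    then have "eventually (\<lambda>f. f \<in> - Q) (nhds \<xi>)"
      using that(1) by (intro eventually_nhds_in_open) (auto simp: open_Compl)
    moreover have "eventually (\<lambda>f. f \<in> Q) (filtermap x sequentially)"
      using that(2) by (simp add: eventually_filtermap)
    ultimately have "eventually (\<lambda>f. False) (inf (nhds \<xi>) (filtermap x sequentially))"
      unfolding eventually_inf by blast
    then show False using \<xi>(2) by (simp add: trivial_limit_def)
  qed
  have invN: "(\<lambda>n. c / N n) \<longlonglongrightarrow> 0" for c
  proof -
    have "(\<lambda>n. c * inverse (real (Suc n))) \<longlonglongrightarrow> c * 0"
      by (intro tendsto_mult tendsto_const LIMSEQ_inverse_real_of_nat)
    then show ?thesis by (simp add: N_def divide_inverse)
  qed
  have "\<xi> 0 = a"
  proof -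
    have "\<xi> \<in> {f. f 0 = a}"
    proof (rule clus)
      show "closed {f::real \<Rightarrow> 'x. f 0 = a}"
        by (intro closed_Collect_eq continuous_intros continuous_on_product_coordinates)
      show "eventually (\<lambda>n. x n \<in> {f. f 0 = a}) sequentially"
        by (simp add: x_def ix_def X0)
    qed
    then show ?thesis by simp
  qed
  \<comment> \<open>Between the grid indices of \<open>s\<close> and \<open>s'\<close> the vector
    field varies by at most \<open>e\<close>, which gives the first term. The second is the cost of
    rounding \<open>s' - s\<close> to the grid value \<open>p / N n\<close>, and it vanishes as
    \<open>n\<close> grows.\<close>
  have key: "norm (x n s' - x n s - (s' - s) *\<^sub>R F (x n s)) \<le> e * (s' - s) + (e + K) / N n"
    if d: "\<forall>x\<in>C. \<forall>y\<in>C. dist y x < d \<longrightarrow> dist (F y) (F x) < e"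
      and s: "0 \<le> s" "s \<le> s'" "s' \<le> 1" "K * (s' - s) < d / 2" and n: "K / N n < d / 2" and e: "e > 0"
    for d e s s' n
  proof -
    let ?k = "ix n s"
    have kj: "?k \<le> ix n s'" using s N[of n]
      by (auto simp: ix_def intro!: nat_mono floor_mono mult_right_mono)
    obtain p where p: "ix n s' = ?k + p" using kj by (metis le_Suc_ex)
    have pN: "\<bar>real p / N n - (s' - s)\<bar> \<le> 1 / N n"
    proof -
      have "\<bar>real p - (s' - s) * N n\<bar> \<le> 1"
        using ix[of s n] ix[of s' n] s p by (simp add: algebra_simps)
      then have "\<bar>real p - (s' - s) * N n\<bar> / N n \<le> 1 / N n" using N[of n] by (simp add: divide_right_mono)
      also have "\<bar>real p - (s' - s) * N n\<bar> / N n = \<bar>(real p - (s' - s) * N n) / N n\<bar>" using N[of n] by simp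
      also have "(real p - (s' - s) * N n) / N n = real p / N n - (s' - s)" using N[of n] by (simp add: field_simps)
      finally show ?thesis .
    qed
    have small: "norm (F (X n (?k + i)) - F (X n ?k)) \<le> e" if "i \<le> p" for i
    proof -
      have "dist (X n (?k + i)) (X n ?k) \<le> K * (real i / N n)" using step by (simp add: dist_norm)
      also have "\<dots> \<le> K * (s' - s + 1 / N n)"
      proof (intro mult_left_mono K0)
        have "real i / N n \<le> real p / N n" using that N[of n] by (simp add: divide_right_mono)
        then show "real i / N n \<le> s' - s + 1 / N n" using pN by linarith
      qed
      also have "\<dots> = K * (s' - s) + K / N n" by (simp add: distrib_left)
      also have "\<dots> < d" using s(4) n by linarith
      finally have "dist (X n (?k + i)) (X n ?k) < d" .
      moreover have "X n ?k \<in> C" "X n (?k + i) \<in> C"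
        using ixN[of n s] ixN[of n s'] p that by (auto intro!: XC)
      ultimately have "dist (F (X n (?k + i))) (F (X n ?k)) < e" using d by blast
      then show ?thesis by (simp add: dist_norm)
    qed
    \<comment> \<open>Compared with steps that all use the slope at index \<open>?k\<close>, each
      Euler step adds an error of at most \<open>e / N n\<close>.\<close>
    have "norm (X n (?k + i) - X n ?k - (real i / N n) *\<^sub>R F (X n ?k)) \<le> e * (real i / N n)" if "i \<le> p" for i
      using that
    proof (induction i)
      case (Suc i)
      have "X n (?k + Suc i) - X n ?k - (real (Suc i) / N n) *\<^sub>R F (X n ?k) =
         (X n (?k + i) - X n ?k - (real i / N n) *\<^sub>R F (X n ?k)) + (1 / N n) *\<^sub>R (F (X n (?k + i)) - F (X n ?k))"
        by (simp add: XS algebra_simps add_divide_distrib)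
      also have "norm \<dots> \<le> e * (real i / N n) + (1 / N n) * e"
        using Suc small[of i] N[of n]
        by (intro order_trans[OF norm_triangle_ineq] add_mono) (auto intro!: mult_left_mono divide_right_mono)
      finally show ?case by (simp add: add_divide_distrib distrib_left mult.commute)
    qed simp
    from this[of p] have A: "norm (x n s' - x n s - (real p / N n) *\<^sub>R F (x n s)) \<le> e * (real p / N n)"
      by (simp add: x_def p)
    have "x n s' - x n s - (s' - s) *\<^sub>R F (x n s) =
       (x n s' - x n s - (real p / N n) *\<^sub>R F (x n s)) + (real p / N n - (s' - s)) *\<^sub>R F (x n s)"
      by (simp add: algebra_simps)
    also have "norm \<dots> \<le> e * (real p / N n) + (1 / N n) * K"
    proof (intro order_trans[OF norm_triangle_ineq] add_mono A)
      have "\<bar>real p / N n - (s' - s)\<bar> * norm (F (x n s)) \<le> (1 / N n) * K"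
        using pN K[of "x n s"] N[of n] by (intro mult_mono) auto
      then show "norm ((real p / N n - (s' - s)) *\<^sub>R F (x n s)) \<le> (1 / N n) * K" by simp
    qed
    also have "e * (real p / N n) \<le> e * (s' - s + 1 / N n)"
      using pN e by (intro mult_left_mono) auto
    finally show ?thesis by (simp add: algebra_simps add_divide_distrib)
  qed
  have ev: "eventually (\<lambda>n. c / N n < r) sequentially" if "r > 0" for c r
    using order_tendstoD(2)[OF invN that] .
  have cev: "continuous_on UNIV (\<lambda>f::real \<Rightarrow> 'x. f s)" for s by simp
  have cFe: "continuous_on UNIV (\<lambda>f::real \<Rightarrow> 'x. F (f s))" for s
    using continuous_on_compose2[OF cF cev] by simp
  have right: "norm (\<xi> s' - \<xi> s - (s' - s) *\<^sub>R F (\<xi> s)) \<le> e * (s' - s)"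
    if d: "d > 0" "\<forall>x\<in>C. \<forall>y\<in>C. dist y x < d \<longrightarrow> dist (F y) (F x) < e"
      and s: "0 \<le> s" "s \<le> s'" "s' \<le> 1" "K * (s' - s) < d / 2" and e: "e > 0" for d e s s'
  proof (rule field_le_epsilon)
    fix r :: real assume r: "r > 0"
    let ?Q = "{f::real \<Rightarrow> 'x. norm (f s' - f s - (s' - s) *\<^sub>R F (f s)) \<le> e * (s' - s) + r}"
    have "\<xi> \<in> ?Q"
    proof (rule clus)
      show "closed ?Q" by (intro closed_Collect_le continuous_intros cev cFe)
      have "eventually (\<lambda>n. K / N n < d / 2 \<and> (e + K) / N n < r) sequentially"
        using d r by (intro eventually_conj ev) auto
      then show "eventually (\<lambda>n. x n \<in> ?Q) sequentially"
      proof eventually_elim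
        case (elim n)
        then show ?case using key[OF d(2) s _ e, of n] by simp
      qed
    qed
    then show "norm (\<xi> s' - \<xi> s - (s' - s) *\<^sub>R F (\<xi> s)) \<le> e * (s' - s) + r" by simp
  qed
  have lip: "norm (\<xi> s' - \<xi> s) \<le> K * (s' - s)" if s: "0 \<le> s" "s \<le> s'" "s' \<le> 1" for s s'
  proof (rule field_le_epsilon)
    fix r :: real assume r: "r > 0"
    let ?Q = "{f::real \<Rightarrow> 'x. norm (f s' - f s) \<le> K * (s' - s) + r}"
    have "\<xi> \<in> ?Q"
    proof (rule clus)
      show "closed ?Q" by (intro closed_Collect_le continuous_intros cev)
      have "eventually (\<lambda>n. K / N n < r) sequentially" using r by (intro ev)
      then show "eventually (\<lambda>n. x n \<in> ?Q) sequentially"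
      proof eventually_elim
        case (elim n)
        have kj: "ix n s \<le> ix n s'" using s N[of n]
          by (auto simp: ix_def intro!: nat_mono floor_mono mult_right_mono)
        then have "norm (x n s' - x n s) \<le> K * (real (ix n s' - ix n s) / N n)"
          using step[of n "ix n s" "ix n s' - ix n s"] by (simp add: x_def)
        also have "\<dots> \<le> K * (((s' - s) * N n + 1) / N n)"
          using ix[of s n] ix[of s' n] s kj N[of n] K0
          by (intro mult_left_mono divide_right_mono) (auto simp: algebra_simps of_nat_diff)
        also have "\<dots> = K * (s' - s) + K / N n" using N[of n] by (simp add: field_simps)
        finally show ?case using elim by simp
      qed
    qed
    then show "norm (\<xi> s' - \<xi> s) \<le> K * (s' - s) + r" by simp
  qed
  have "(\<xi> has_vector_derivative F (\<xi> s)) (at s within {0..1})" if s: "s \<in> {0..1}" for s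
    unfolding has_vector_derivative_def has_derivative_within_alt
  proof (intro conjI allI impI)
    show "bounded_linear (\<lambda>h. h *\<^sub>R F (\<xi> s))" by (rule bounded_linear_scaleR_left)
    fix e :: real assume "e > 0"
    then have e2: "e / 2 > 0" by simp
    obtain d where d: "d > 0" "\<forall>x\<in>C. \<forall>y\<in>C. dist y x < d \<longrightarrow> dist (F y) (F x) < e/2"
      using uc[OF e2] by blast
    \<comment> \<open>Within time \<open>r\<close> the solution moves by less than
      \<open>d / 2\<close>; the summand 1 covers \<open>K = 0\<close>.\<close>
    define r where "r = d / (2 * (K + 1))"
    have r: "r > 0" using d K0 by (simp add: r_def)
    have Kr: "K * t < d / 2" if "0 \<le> t" "t < r" for t
    proof -
      have "K * t \<le> K * r" using that K0 by (intro mult_left_mono) auto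
      also have "\<dots> < (K + 1) * r" using r by simp
      also have "\<dots> = d / 2" using K0 by (simp add: r_def field_simps)
      finally show ?thesis .
    qed
    have \<xi>C: "\<xi> t \<in> C" for t using \<xi>(1) by (auto simp: U_def)
    have "norm (\<xi> t - \<xi> s - (t - s) *\<^sub>R F (\<xi> s)) \<le> e * norm (t - s)"
      if t: "t \<in> {0..1}" and ts: "norm (t - s) < r" for t
    proof (cases "s \<le> t")
      case True
      have "norm (\<xi> t - \<xi> s - (t - s) *\<^sub>R F (\<xi> s)) \<le> e / 2 * (t - s)"
        using s t ts True Kr[of "t - s"] by (intro right[OF d] e2) auto
      also have "\<dots> \<le> e * norm (t - s)" using True \<open>e > 0\<close> by (simp add: mult_right_mono)
      finally show ?thesis .
    next
      case False
      \<comment> \<open>The estimate \<open>right\<close> uses the slope at the earlier time, which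
        is \<open>t\<close> here. Exchanging it for the slope at \<open>s\<close> costs the other
        half of \<open>e\<close>, by the Lipschitz bound and uniform continuity.\<close>
      have "norm (\<xi> s - \<xi> t) \<le> K * (s - t)" using lip s t False by auto
      also have "\<dots> < d" using Kr[of "s - t"] ts False d by auto
      finally have "dist (\<xi> t) (\<xi> s) < d" by (simp add: dist_norm norm_minus_commute)
      then have "dist (F (\<xi> t)) (F (\<xi> s)) < e / 2" using d(2) \<xi>C by blast
      then have Fts: "norm (F (\<xi> t) - F (\<xi> s)) \<le> e / 2" by (simp add: dist_norm)
      have "norm (\<xi> s - \<xi> t - (s - t) *\<^sub>R F (\<xi> t)) \<le> e / 2 * (s - t)"
        using s t ts False Kr[of "s - t"] by (intro right[OF d] e2) auto
      moreover have "norm (\<xi> t - \<xi> s - (t - s) *\<^sub>R F (\<xi> s)) \<le>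
          norm (\<xi> s - \<xi> t - (s - t) *\<^sub>R F (\<xi> t)) + norm ((s - t) *\<^sub>R (F (\<xi> t) - F (\<xi> s)))"
      proof -
        have *: "\<xi> t - \<xi> s - (t - s) *\<^sub>R F (\<xi> s) =
          - (\<xi> s - \<xi> t - (s - t) *\<^sub>R F (\<xi> t)) - (s - t) *\<^sub>R (F (\<xi> t) - F (\<xi> s))"
          by (simp add: algebra_simps)
        show ?thesis unfolding * by (rule order_trans[OF norm_triangle_ineq4]) (simp add: norm_minus_commute)
      qed
      moreover have "norm ((s - t) *\<^sub>R (F (\<xi> t) - F (\<xi> s))) \<le> (s - t) * (e / 2)"
        using False Fts mult_left_mono[of _ "e/2" "s-t"] by simp
      ultimately have "norm (\<xi> t - \<xi> s - (t - s) *\<^sub>R F (\<xi> s)) \<le> e / 2 * (s - t) + (s - t) * (e / 2)"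
        by linarith
      also have "\<dots> = e * norm (t - s)" using False by (simp add: algebra_simps)
      finally show ?thesis .
    qed
    then show "\<exists>d>0. \<forall>y\<in>{0..1}. norm (y - s) < d \<longrightarrow>
        norm (\<xi> y - \<xi> s - (y - s) *\<^sub>R F (\<xi> s)) \<le> e * norm (y - s)"
      using r by blast
  qed
  with \<open>\<xi> 0 = a\<close> show ?thesis by (intro exI[of _ \<xi>]) simp
qed

text \<open>The vector field is composed with the nearest point projection onto a closed ball around
  \<open>a\<close> inside \<open>D\<close>, which makes it bounded and continuous on the whole
  space. For a short time a solution stays in the ball, where the projection is the
  identity.\<close>

theorem peano_existence:
  fixes F :: "'x::euclidean_space \<Rightarrow> 'x"
  assumes D: "open D" "a \<in> D" and cF: "continuous_on D F"
  obtains e \<xi> where "e > 0" "\<xi> 0 = a"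
    "\<And>s. s \<in> {0..e::real} \<Longrightarrow> \<xi> s \<in> D"
    "\<And>s. s \<in> {0..e} \<Longrightarrow> (\<xi> has_vector_derivative F (\<xi> s)) (at s within {0..e})"
proof -
  obtain r where r: "r > 0" "cball a r \<subseteq> D" using D open_contains_cball by blast
  let ?p = "closest_point (cball a r)"
  have ne: "cball a r \<noteq> {}" using r by auto
  have pin: "?p x \<in> cball a r" for x using ne by (intro closest_point_in_set) auto
  have "continuous_on UNIV (\<lambda>x. F (?p x))"
    using pin r ne by (intro continuous_on_compose2[OF cF continuous_on_closest_point]) auto
  moreover obtain K where "\<And>x. norm (F (?p x)) \<le> K"
  proof -
    have "compact (F ` cball a r)" using continuous_on_subset[OF cF r(2)] by (intro compact_continuous_image) auto
    then obtain K where "\<forall>y\<in>F ` cball a r. norm y \<le> K" using compact_imp_bounded bounded_iff by metis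
    then show ?thesis using pin that by blast
  qed
  ultimately obtain \<xi> where \<xi>: "\<xi> 0 = a"
    "\<And>s. s \<in> {0..1} \<Longrightarrow> (\<xi> has_vector_derivative F (?p (\<xi> s))) (at s within {0..1::real})"
    using peano_bounded[of "\<lambda>x. F (?p x)" K a] by blast
  have "continuous (at 0 within {0..1}) \<xi>"
    using \<xi>(2)[of 0] has_vector_derivative_continuous by auto
  then obtain d where d: "d > 0" "\<And>s. s \<in> {0..1} \<Longrightarrow> dist s 0 < d \<Longrightarrow> dist (\<xi> s) a < r"
    unfolding continuous_within_eps_delta using r(1) \<xi>(1) by auto
  define e where "e = min 1 (d/2)"
  have e: "e > 0" "e \<le> 1" "e < d" using d by (auto simp: e_def)
  have inr: "\<xi> s \<in> cball a r" if "s \<in> {0..e}" for s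
    using d(2)[of s] that e by (auto simp: dist_commute)
  have der: "(\<xi> has_vector_derivative F (\<xi> s)) (at s within {0..e})" if "s \<in> {0..e}" for s
    using has_vector_derivative_within_subset[OF \<xi>(2)[of s], of "{0..e}"] that e inr[OF that]
    by (simp add: closest_point_self subset_iff)
  show ?thesis by (rule that[OF e(1) \<xi>(1) _ der]) (use inr r in auto)
qed


section \<open>Homeomorphisms onto chart images\<close>

lemma isCont_open_nbhd:
  assumes "isCont f s" "open S" "f s \<in> S"
  obtains T where "open T" "s \<in> T" "\<And>r. r \<in> T \<Longrightarrow> f r \<in> S"
  using assms(1)[unfolded continuous_at_open, rule_format, of S] assms(2,3) by blast

lemma homeomorphism_image_Int_eq:
  assumes "homeomorphism S T f h"
  shows "f ` (S \<inter> U) = T \<inter> h -` U"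
proof -
  have "h (f x) = x" if "x \<in> S" for x using homeomorphism_apply1[OF assms that] .
  moreover have "f (h y) = y" "h y \<in> S" if "y \<in> T" for y
    using homeomorphism_apply2[OF assms that] homeomorphism_image2[OF assms] that by auto
  moreover have "f x \<in> T" if "x \<in> S" for x using homeomorphism_image1[OF assms] that by auto
  ultimately show ?thesis by (auto intro: rev_image_eqI) (metis IntI imageI)
qed

lemma open_homeomorphism_image_Int:
  assumes "homeomorphism S T f h" "open T" "open U"
  shows "open (f ` (S \<inter> U))"
  unfolding homeomorphism_image_Int_eq[OF assms(1)]
  by (rule continuous_open_preimage[OF homeomorphism_cont2[OF assms(1)] assms(2,3)])

lemma double_eq_iff_eq_half: "2 * a = b \<longleftrightarrow> a = b / (2::real)" by auto

lemma linear_basis_expansion: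
  fixes f :: "'e::euclidean_space \<Rightarrow> real"
  assumes "linear f"
  shows "f x = (\<Sum>b\<in>Basis. (x \<bullet> b) * f b)"
proof -
  have "f x = f (\<Sum>b\<in>Basis. (x \<bullet> b) *\<^sub>R b)" by (simp add: euclidean_representation)
  also have "\<dots> = (\<Sum>b\<in>Basis. (x \<bullet> b) * f b)"
    using assms by (simp add: linear_sum linear_scale)
  finally show ?thesis .
qed

section \<open>Semi-Riemannian metrics and their geodesics\<close>

text \<open>Only as much regularity as the Goedel metric has: the components of the metric are of class
  \<open>C\<^sup>1\<close>, so the Christoffel symbols are merely continuous.\<close>

locale semi_riemannian_atlas =
  fixes M :: "('i, 'a::t2_space, 'e::euclidean_space) atlas"
    and g :: "('i, 'a, 'e) tensor2"
  assumes open_chart_dom: "i \<in> idx M \<Longrightarrow> open (chart_dom M i)"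
    and open_chart_image: "i \<in> idx M \<Longrightarrow> open (chart_map M i ` chart_dom M i)"
    and homeomorphism_chart: "i \<in> idx M \<Longrightarrow>
      homeomorphism (chart_dom M i) (chart_map M i ` chart_dom M i) (chart_map M i) (chart_inv M i)"
    and transition_differentiable: "i \<in> idx M \<Longrightarrow> j \<in> idx M \<Longrightarrow>
      z \<in> chart_map M i ` (chart_dom M i \<inter> chart_dom M j) \<Longrightarrow> transition M i j differentiable (at z)"
    and transition_second_derivative: "i \<in> idx M \<Longrightarrow> j \<in> idx M \<Longrightarrow>
      z \<in> chart_map M i ` (chart_dom M i \<inter> chart_dom M j) \<Longrightarrow>
      \<exists>Q. (\<forall>u. ((\<lambda>y. frechet_derivative (transition M i j) (at y) u) has_derivative (\<lambda>h. Q h u)) (at z)) \<and>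
          (\<forall>u h. Q u h = Q h u)"
    and metric_bilinear: "i \<in> idx M \<Longrightarrow> p \<in> chart_dom M i \<Longrightarrow> bilinear (g i p)"
    and metric_sym: "i \<in> idx M \<Longrightarrow> p \<in> chart_dom M i \<Longrightarrow> g i p u v = g i p v u"
    and metric_nondegenerate: "i \<in> idx M \<Longrightarrow> p \<in> chart_dom M i \<Longrightarrow> (\<And>v. g i p u v = 0) \<Longrightarrow> u = 0"
    and metric_differentiable: "i \<in> idx M \<Longrightarrow> z \<in> chart_map M i ` chart_dom M i \<Longrightarrow>
      (\<lambda>z. g i (chart_inv M i z) u v) differentiable (at z)"
    and metric_C1: "i \<in> idx M \<Longrightarrow> continuous_on (chart_map M i ` chart_dom M i)
      (\<lambda>z. frechet_derivative (\<lambda>z. g i (chart_inv M i z) u v) (at z) h)"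
    and metric_transition: "i \<in> idx M \<Longrightarrow> j \<in> idx M \<Longrightarrow> p \<in> chart_dom M i \<Longrightarrow> p \<in> chart_dom M j \<Longrightarrow>
      g i p u v = g j p (frechet_derivative (transition M i j) (at (chart_map M i p)) u)
                        (frechet_derivative (transition M i j) (at (chart_map M i p)) v)"
begin

abbreviation "chart_image i \<equiv> chart_map M i ` chart_dom M i"
abbreviation "Dtrans i j z \<equiv> frechet_derivative (transition M i j) (at z)"
abbreviation "loc_metric i z \<equiv> g i (chart_inv M i z)"
abbreviation "loc_deriv i z h u v \<equiv> frechet_derivative (\<lambda>z. loc_metric i z u v) (at z) h"

lemma chart_inv_chart: "i \<in> idx M \<Longrightarrow> p \<in> chart_dom M i \<Longrightarrow> chart_inv M i (chart_map M i p) = p"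
  using homeomorphism_chart homeomorphism_apply1 by blast

lemma chart_chart_inv:
  assumes "i \<in> idx M" "z \<in> chart_image i"
  shows "chart_map M i (chart_inv M i z) = z" "chart_inv M i z \<in> chart_dom M i"
  using homeomorphism_chart[OF assms(1)] assms(2) chart_inv_chart[OF assms(1)] by auto

lemma isCont_chart: "i \<in> idx M \<Longrightarrow> p \<in> chart_dom M i \<Longrightarrow> isCont (chart_map M i) p"
  using homeomorphism_cont1[OF homeomorphism_chart] open_chart_dom continuous_on_eq_continuous_at by blast

lemma isCont_chart_inv: "i \<in> idx M \<Longrightarrow> z \<in> chart_image i \<Longrightarrow> isCont (chart_inv M i) z"
  using homeomorphism_cont2[OF homeomorphism_chart] open_chart_image continuous_on_eq_continuous_at by blast

lemma open_overlap:
  assumes "i \<in> idx M" "open S"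
  shows "open (chart_map M i ` (chart_dom M i \<inter> S))"
  using open_homeomorphism_image_Int[OF homeomorphism_chart open_chart_image] assms by blast

lemma transition_chart: "i \<in> idx M \<Longrightarrow> p \<in> chart_dom M i \<Longrightarrow> transition M i j (chart_map M i p) = chart_map M j p"
  by (simp add: transition_def chart_inv_chart)

lemma has_derivative_transition:
  assumes "i \<in> idx M" "j \<in> idx M" "z \<in> chart_map M i ` (chart_dom M i \<inter> chart_dom M j)"
  shows "(transition M i j has_derivative Dtrans i j z) (at z)"
  using transition_differentiable[OF assms] frechet_derivative_works by blast

lemma linear_Dtrans:
  assumes "i \<in> idx M" "j \<in> idx M" "z \<in> chart_map M i ` (chart_dom M i \<inter> chart_dom M j)"
  shows "linear (Dtrans i j z)"
  using has_derivative_transition[OF assms] has_derivative_linear by blast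

text \<open>The chain rule for two transition maps whose composite is the identity near the
  point.\<close>

lemma Dtrans_inverse:
  assumes ij: "i \<in> idx M" "j \<in> idx M" and p: "p \<in> chart_dom M i" "p \<in> chart_dom M j"
  shows "Dtrans i j (chart_map M i p) (Dtrans j i (chart_map M j p) w) = w"
proof -
  let ?S = "chart_map M j ` (chart_dom M j \<inter> chart_dom M i)"
  have z: "chart_map M j p \<in> ?S" "chart_map M i p \<in> chart_map M i ` (chart_dom M i \<inter> chart_dom M j)" using p by auto
  have t: "transition M j i (chart_map M j p) = chart_map M i p" using transition_chart ij p by simp
  have "((\<lambda>z. transition M i j (transition M j i z)) has_derivative
      (\<lambda>h. Dtrans i j (chart_map M i p) (Dtrans j i (chart_map M j p) h))) (at (chart_map M j p))"
    using has_derivative_compose[OF has_derivative_transition[OF ij(2,1) z(1)], unfolded t,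
        OF has_derivative_transition[OF ij z(2)]] .
  then have "((\<lambda>z. z) has_derivative
      (\<lambda>h. Dtrans i j (chart_map M i p) (Dtrans j i (chart_map M j p) h))) (at (chart_map M j p))"
    by (rule has_derivative_transform_within_open[OF _ open_overlap[OF ij(2) open_chart_dom[OF ij(1)]] z(1)])
      (use ij in \<open>auto simp: transition_chart\<close>)
  from has_derivative_unique[OF this has_derivative_ident] show ?thesis by metis
qed

lemma has_derivative_metric:
  assumes "i \<in> idx M" "z \<in> chart_image i"
  shows "((\<lambda>z. loc_metric i z u v) has_derivative (\<lambda>h. loc_deriv i z h u v)) (at z)"
  using metric_differentiable[OF assms] frechet_derivative_works by blast

lemma metric_deriv_eq:
  "metric_deriv M g i p v u w = loc_deriv i (chart_map M i p) v u w"
  by (simp add: metric_deriv_def)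

lemma loc_metric_bilinear:
  assumes "i \<in> idx M" "z \<in> chart_image i"
  shows "bilinear (loc_metric i z)"
  using metric_bilinear chart_chart_inv assms by blast

lemma loc_metric_sym:
  assumes "i \<in> idx M" "z \<in> chart_image i"
  shows "loc_metric i z u v = loc_metric i z v u"
  using metric_sym chart_chart_inv assms by blast

lemma loc_deriv_linear1:
  assumes "i \<in> idx M" "z \<in> chart_image i"
  shows "linear (\<lambda>h. loc_deriv i z h u v)"
  using has_derivative_linear[OF has_derivative_metric[OF assms]] .

lemma loc_deriv_sym:
  assumes "i \<in> idx M" "z \<in> chart_image i"
  shows "loc_deriv i z h u v = loc_deriv i z h v u"
proof -
  have "((\<lambda>z. loc_metric i z v u) has_derivative (\<lambda>h. loc_deriv i z h u v)) (at z)"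
    by (rule has_derivative_transform_within_open[OF has_derivative_metric[OF assms] open_chart_image[OF assms(1)] assms(2)])
      (simp add: loc_metric_sym assms(1))
  from has_derivative_unique[OF this has_derivative_metric[OF assms]] show ?thesis by metis
qed

lemma loc_deriv_linear2:
  assumes i: "i \<in> idx M" "z \<in> chart_image i"
  shows "linear (\<lambda>u. loc_deriv i z h u v)"
proof
  note tr = has_derivative_transform_within_open[OF _ open_chart_image[OF i(1)] i(2)]
  fix u u' r
  have "((\<lambda>z. loc_metric i z (u + u') v) has_derivative (\<lambda>h. loc_deriv i z h u v + loc_deriv i z h u' v)) (at z)"
    by (rule tr[OF has_derivative_add[OF has_derivative_metric[OF i] has_derivative_metric[OF i]]])
      (simp add: bilinear_ladd[OF loc_metric_bilinear[OF i(1)]])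
  from has_derivative_unique[OF this has_derivative_metric[OF i]]
  show "loc_deriv i z h (u + u') v = loc_deriv i z h u v + loc_deriv i z h u' v" by metis
  have "((\<lambda>z. loc_metric i z (r *\<^sub>R u) v) has_derivative (\<lambda>h. r *\<^sub>R loc_deriv i z h u v)) (at z)"
    by (rule tr[OF has_derivative_scaleR_right[OF has_derivative_metric[OF i]]])
      (simp add: bilinear_lmul[OF loc_metric_bilinear[OF i(1)]])
  from has_derivative_unique[OF this has_derivative_metric[OF i]]
  show "loc_deriv i z h (r *\<^sub>R u) v = r *\<^sub>R loc_deriv i z h u v" by metis
qed

lemma loc_deriv_linear3:
  assumes "i \<in> idx M" "z \<in> chart_image i"
  shows "linear (\<lambda>v. loc_deriv i z h u v)"
proof -
  have "(\<lambda>v. loc_deriv i z h u v) = (\<lambda>v. loc_deriv i z h v u)"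
    by (rule ext) (rule loc_deriv_sym[OF assms])
  then show ?thesis using loc_deriv_linear2[OF assms] by simp
qed

section \<open>Christoffel symbols\<close>

text \<open>The lowering of indices, with the covector \<open>g i p u\<close> turned into a vector
  by the Euclidean inner product. Nondegeneracy of the metric becomes injectivity of an endomorphism
  of the model space.\<close>

abbreviation "flat i p u \<equiv> (\<Sum>b\<in>Basis. g i p u b *\<^sub>R b)"

lemma inner_flat: "b \<in> Basis \<Longrightarrow> flat i p u \<bullet> b = g i p u b"
  by (simp add: inner_sum_left inner_Basis if_distrib sum.delta cong: if_cong)

lemma linear_flat:
  assumes "i \<in> idx M" "p \<in> chart_dom M i"
  shows "linear (flat i p)"
  by (rule linearI) (simp_all add: bilinear_ladd[OF metric_bilinear[OF assms]] bilinear_lmul[OF metric_bilinear[OF assms]]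
      scaleR_left_distrib sum.distrib scaleR_right.sum)

lemma linear_metric_right:
  assumes "i \<in> idx M" "p \<in> chart_dom M i"
  shows "linear (g i p u)"
  using metric_bilinear[OF assms] by (simp add: bilinear_def)

lemma inj_flat:
  assumes i: "i \<in> idx M" "p \<in> chart_dom M i"
  shows "inj (flat i p)"
  unfolding linear_injective_0[OF linear_flat[OF i]]
proof (intro allI impI)
  fix u assume "flat i p u = 0"
  then have 0: "g i p u b = 0" if "b \<in> Basis" for b using inner_flat[OF that, of i p u] by simp
  have "g i p u = (\<lambda>v. 0)"
    using linear_eq_stdbasis[OF linear_metric_right[OF i] linear_zero] 0 by blast
  then show "u = 0" using metric_nondegenerate[OF i, of u] by simp
qed

text \<open>This justifies the definite description in \<open>christoffel\<close>. Half the Koszul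
  expression is a linear functional of \<open>w\<close>, and the injective endomorphism
  \<open>flat i p\<close> is surjective by finite dimension, so the metric represents that
  functional by exactly one vector.\<close>

lemma christoffel_ex1:
  assumes i: "i \<in> idx M" "p \<in> chart_dom M i"
  shows "\<exists>!\<Gamma>. \<forall>w. 2 * g i p \<Gamma> w =
    metric_deriv M g i p u v w + metric_deriv M g i p v u w - metric_deriv M g i p w u v"
proof -
  let ?z = "chart_map M i p"
  have z: "?z \<in> chart_image i" using i by simp
  define K where "K w = (metric_deriv M g i p u v w + metric_deriv M g i p v u w - metric_deriv M g i p w u v) / 2" for w
  have "linear K"
    unfolding K_def metric_deriv_eq
    by (rule linearI) (simp_all add: linear_add[OF loc_deriv_linear1[OF i(1) z]] linear_scale[OF loc_deriv_linear1[OF i(1) z]]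
        linear_add[OF loc_deriv_linear3[OF i(1) z]] linear_scale[OF loc_deriv_linear3[OF i(1) z]] field_simps)
  obtain \<Gamma> where "flat i p \<Gamma> = (\<Sum>b\<in>Basis. K b *\<^sub>R b)"
    using surjD[OF linear_injective_imp_surjective[OF linear_flat[OF i] inj_flat[OF i]]] by metis
  then have "g i p \<Gamma> b = K b" if "b \<in> Basis" for b
    using inner_flat[OF that, of i p \<Gamma>] that
    by (simp add: inner_sum_left inner_Basis if_distrib sum.delta cong: if_cong)
  then have \<Gamma>: "g i p \<Gamma> = K"
    using linear_eq_stdbasis[OF linear_metric_right[OF i] \<open>linear K\<close>] by blast
  have K: "2 * g i p \<Gamma>' w = metric_deriv M g i p u v w + metric_deriv M g i p v u w - metric_deriv M g i p w u v
      \<longleftrightarrow> g i p \<Gamma>' w = K w" for \<Gamma>' w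
    unfolding K_def by (rule double_eq_iff_eq_half)
  show ?thesis
    unfolding K
  proof (rule ex1I[of _ \<Gamma>])
    show "\<forall>w. g i p \<Gamma> w = K w" unfolding \<Gamma> by simp
    fix \<Gamma>' assume *: "\<forall>w. g i p \<Gamma>' w = K w"
    have "g i p (\<Gamma>' - \<Gamma>) w = 0" for w
      unfolding bilinear_lsub[OF metric_bilinear[OF i]] \<Gamma> using * by simp
    then have "\<Gamma>' - \<Gamma> = 0" by (rule metric_nondegenerate[OF i])
    then show "\<Gamma>' = \<Gamma>" by simp
  qed
qed

lemma christoffel_koszul:
  assumes i: "i \<in> idx M" "p \<in> chart_dom M i"
  shows "2 * g i p (christoffel M g i p u v) w =
    metric_deriv M g i p u v w + metric_deriv M g i p v u w - metric_deriv M g i p w u v"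
  unfolding christoffel_def by (rule spec[OF theI'[OF christoffel_ex1[OF i]]])

text \<open>On the diagonal the first two Koszul terms coincide; this is the form that the geodesic
  equation involves.\<close>

lemma christoffel_quadratic:
  assumes i: "i \<in> idx M" "z \<in> chart_image i"
  shows "loc_metric i z (christoffel M g i (chart_inv M i z) v v) w = loc_deriv i z v v w - loc_deriv i z w v v / 2"
  using christoffel_koszul[OF i(1) chart_chart_inv(2)[OF i], of v v w] by (simp add: metric_deriv_eq chart_chart_inv[OF i])

lemma christoffel_eqI:
  assumes i: "i \<in> idx M" "p \<in> chart_dom M i"
    and "\<And>w. 2 * g i p \<Gamma> w = metric_deriv M g i p u v w + metric_deriv M g i p v u w - metric_deriv M g i p w u v"
  shows "christoffel M g i p u v = \<Gamma>"
  unfolding christoffel_def by (rule the1_equality[OF christoffel_ex1[OF i]]) (rule allI, rule assms(3))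

lemma christoffel_minus:
  assumes i: "i \<in> idx M" "p \<in> chart_dom M i"
  shows "christoffel M g i p (- v) (- v) = christoffel M g i p v v"
proof (rule christoffel_eqI[OF i])
  fix w
  have z: "chart_map M i p \<in> chart_image i" using i by simp
  show "2 * g i p (christoffel M g i p v v) w =
    metric_deriv M g i p (- v) (- v) w + metric_deriv M g i p (- v) (- v) w - metric_deriv M g i p w (- v) (- v)"
    unfolding christoffel_koszul[OF i] metric_deriv_eq
    by (simp add: linear_neg[OF loc_deriv_linear1[OF i(1) z]] linear_neg[OF loc_deriv_linear2[OF i(1) z]]
      linear_neg[OF loc_deriv_linear3[OF i(1) z]])
qed

lemma continuous_on_loc_metric:
  assumes "i \<in> idx M"
  shows "continuous_on (chart_image i) (\<lambda>z. loc_metric i z u v)"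
  by (intro continuous_at_imp_continuous_on ballI differentiable_imp_continuous_within metric_differentiable[OF assms])

text \<open>The geodesic equation is a first order system for pairs of position and velocity, and
  its right side must be continuous jointly in both. The Christoffel vector solves a linear system
  with matrix \<open>flat\<close> and with the Koszul expression on the right, so continuity of
  these two suffices.\<close>

lemma continuous_on_christoffel:
  assumes i: "i \<in> idx M"
  shows "continuous_on (chart_image i \<times> UNIV) (\<lambda>(z, v). christoffel M g i (chart_inv M i z) v v)"
proof -
  let ?S = "chart_image i \<times> (UNIV :: 'e set)"
  have cfst: "continuous_on ?S (\<lambda>x. f (fst x))" if "continuous_on (chart_image i) f" for f :: "'e \<Rightarrow> real"
    using that by (rule continuous_on_compose2[OF _ continuous_on_fst[OF continuous_on_id]]) auto
  have expand1: "loc_deriv i z h u v = (\<Sum>c\<in>Basis. (h \<bullet> c) * loc_deriv i z c u v)" if "z \<in> chart_image i" for z h u v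
    by (rule linear_basis_expansion[OF loc_deriv_linear1[OF i that]])
  have expand2: "loc_deriv i z h u v = (\<Sum>c\<in>Basis. (u \<bullet> c) * loc_deriv i z h c v)" if "z \<in> chart_image i" for z h u v
    by (rule linear_basis_expansion[OF loc_deriv_linear2[OF i that]])
  have expand3: "loc_deriv i z h u v = (\<Sum>c\<in>Basis. (v \<bullet> c) * loc_deriv i z h u c)" if "z \<in> chart_image i" for z h u v
    by (rule linear_basis_expansion[OF loc_deriv_linear3[OF i that]])
  \<comment> \<open>With the velocity slots expanded in the basis, the expression is a polynomial in
    the components of \<open>snd x\<close> whose coefficients are continuous by
    \<open>metric_C1\<close>.\<close>
  have c1: "continuous_on ?S (\<lambda>x. \<Sum>c\<in>Basis. (snd x \<bullet> c) * (\<Sum>d\<in>Basis. (snd x \<bullet> d) * loc_deriv i (fst x) c d b))" for b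
    by (intro continuous_intros cfst metric_C1 i)
  have c1: "continuous_on ?S (\<lambda>x. loc_deriv i (fst x) (snd x) (snd x) b)" for b
  proof (rule continuous_on_eq[OF c1])
    fix x assume "x \<in> ?S"
    then have z: "fst x \<in> chart_image i" by auto
    show "(\<Sum>c\<in>Basis. (snd x \<bullet> c) * (\<Sum>d\<in>Basis. (snd x \<bullet> d) * loc_deriv i (fst x) c d b)) =
        loc_deriv i (fst x) (snd x) (snd x) b"
      by (simp only: expand1[OF z, where h = "snd x" and u = "snd x"]) (simp only: expand2[OF z, where u = "snd x" and v = b])
  qed
  have c2: "continuous_on ?S (\<lambda>x. \<Sum>c\<in>Basis. (snd x \<bullet> c) * (\<Sum>d\<in>Basis. (snd x \<bullet> d) * loc_deriv i (fst x) b c d))" for b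
    by (intro continuous_intros cfst metric_C1 i)
  have c2: "continuous_on ?S (\<lambda>x. loc_deriv i (fst x) b (snd x) (snd x))" for b
  proof (rule continuous_on_eq[OF c2])
    fix x assume "x \<in> ?S"
    then have z: "fst x \<in> chart_image i" by auto
    show "(\<Sum>c\<in>Basis. (snd x \<bullet> c) * (\<Sum>d\<in>Basis. (snd x \<bullet> d) * loc_deriv i (fst x) b c d)) =
        loc_deriv i (fst x) b (snd x) (snd x)"
      by (simp only: expand2[OF z, where u = "snd x" and v = "snd x"]) (simp only: expand3[OF z, where v = "snd x" and h = b])
  qed
  have "continuous_on ?S (\<lambda>x. christoffel M g i (chart_inv M i (fst x)) (snd x) (snd x))"
  proof (rule continuous_linear_solve[where L = "\<lambda>x. flat i (chart_inv M i (fst x))"])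
    show "linear (flat i (chart_inv M i (fst x)))" "inj (flat i (chart_inv M i (fst x)))" if "x \<in> ?S" for x
      using that linear_flat inj_flat i chart_chart_inv by auto
    show "continuous_on ?S (\<lambda>x. flat i (chart_inv M i (fst x)) u)" for u
      by (intro continuous_intros cfst continuous_on_loc_metric i)
    have "continuous_on ?S (\<lambda>x. \<Sum>b\<in>Basis.
        (loc_deriv i (fst x) (snd x) (snd x) b - loc_deriv i (fst x) b (snd x) (snd x) / 2) *\<^sub>R b)"
      by (intro continuous_intros c1 c2) simp
    then show "continuous_on ?S (\<lambda>x. flat i (chart_inv M i (fst x)) (christoffel M g i (chart_inv M i (fst x)) (snd x) (snd x)))"
      by (rule continuous_on_eq)
        (auto simp only: christoffel_quadratic[OF i] mem_Times_iff)
  qed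
  then show ?thesis by (simp add: case_prod_unfold)
qed

text \<open>For a geodesic the velocity in a chart is unique, so the existential velocity of
  \<open>geodesic_on\<close> can be replaced by this one, which makes the geodesic equation a local condition.\<close>

definition vel :: "'i \<Rightarrow> (real \<Rightarrow> 'a) \<Rightarrow> real \<Rightarrow> 'e" where
  "vel i c s = vector_derivative (chart_map M i \<circ> c) (at s)"

text \<open>The first conjunct holds in a neighbourhood, since \<open>vector_derivative\<close> is a
  meaningful velocity only where the curve is differentiable and it is differentiated once more at
  \<open>s\<close>.\<close>

definition geodesic_at :: "'i \<Rightarrow> (real \<Rightarrow> 'a) \<Rightarrow> real \<Rightarrow> bool" where
  "geodesic_at i c s \<longleftrightarrow>
     (\<forall>\<^sub>F r in nhds s. ((chart_map M i \<circ> c) has_vector_derivative vel i c r) (at r)) \<and>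
     (vel i c has_vector_derivative - christoffel M g i (c s) (vel i c s) (vel i c s)) (at s)"

lemma vel_eqI: "((chart_map M i \<circ> c) has_vector_derivative v) (at s) \<Longrightarrow> vel i c s = v"
  by (simp add: vel_def vector_derivative_at)

lemma geodesic_atI:
  assumes T: "open T" "s \<in> T"
    and v: "\<And>r. r \<in> T \<Longrightarrow> ((chart_map M i \<circ> c) has_vector_derivative v r) (at r)"
    and v': "(v has_vector_derivative - christoffel M g i (c s) (v s) (v s)) (at s)"
  shows "geodesic_at i c s"
proof -
  have vel: "vel i c r = v r" if "r \<in> T" for r using v[OF that] by (rule vel_eqI)
  show ?thesis unfolding geodesic_at_def
  proof
    show "\<forall>\<^sub>F r in nhds s. ((chart_map M i \<circ> c) has_vector_derivative vel i c r) (at r)"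
      unfolding eventually_nhds using T v vel by auto
    show "(vel i c has_vector_derivative - christoffel M g i (c s) (vel i c s) (vel i c s)) (at s)"
      unfolding vel[OF T(2)] by (rule has_vector_derivative_transform_within_open[OF v' T]) (simp add: vel)
  qed
qed

lemma geodesic_atE:
  assumes "geodesic_at i c s"
  obtains T where "open T" "s \<in> T"
    "\<And>r. r \<in> T \<Longrightarrow> ((chart_map M i \<circ> c) has_vector_derivative vel i c r) (at r)"
    "(vel i c has_vector_derivative - christoffel M g i (c s) (vel i c s) (vel i c s)) (at s)"
  using assms unfolding geodesic_at_def eventually_nhds by blast

lemma geodesic_at_cong:
  assumes S: "open S" "s \<in> S" and eq: "\<And>r. r \<in> S \<Longrightarrow> c r = c' r" and "geodesic_at i c s"
  shows "geodesic_at i c' s"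
proof -
  obtain T where T: "open T" "s \<in> T"
    "\<And>r. r \<in> T \<Longrightarrow> ((chart_map M i \<circ> c) has_vector_derivative vel i c r) (at r)"
    "(vel i c has_vector_derivative - christoffel M g i (c s) (vel i c s) (vel i c s)) (at s)"
    using assms(4) by (rule geodesic_atE) blast
  show ?thesis
  proof (rule geodesic_atI[of "S \<inter> T"])
    show "((chart_map M i \<circ> c') has_vector_derivative vel i c r) (at r)" if "r \<in> S \<inter> T" for r
      by (rule has_vector_derivative_transform_within_open[OF T(3) S(1)]) (use that eq in auto)
    show "(vel i c has_vector_derivative - christoffel M g i (c' s) (vel i c s) (vel i c s)) (at s)"
      using T(4) eq[OF S(2)] by simp
  qed (use S T in auto)
qed

lemma open_dom_preimage:
  assumes "open J" "continuous_on J c" "i \<in> idx M"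
  shows "open (J \<inter> c -` chart_dom M i)"
  using continuous_open_preimage[OF assms(2,1) open_chart_dom[OF assms(3)]] .

lemma geodesic_on_iff:
  "geodesic_on M g J c \<longleftrightarrow>
     open J \<and> is_interval J \<and> J \<noteq> {} \<and> continuous_on J c \<and> c ` J \<subseteq> points M \<and>
     (\<forall>i\<in>idx M. \<forall>s\<in>J. c s \<in> chart_dom M i \<longrightarrow> geodesic_at i c s)"
  unfolding geodesic_on_def
proof (intro conj_cong refl ball_cong)
  fix i assume J: "open J" "continuous_on J c" and i: "i \<in> idx M"
  show "(\<exists>v. \<forall>s\<in>J. c s \<in> chart_dom M i \<longrightarrow>
        ((chart_map M i \<circ> c) has_vector_derivative v s) (at s) \<and>
        (v has_vector_derivative - christoffel M g i (c s) (v s) (v s)) (at s)) \<longleftrightarrow>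
      (\<forall>s\<in>J. c s \<in> chart_dom M i \<longrightarrow> geodesic_at i c s)" (is "?l \<longleftrightarrow> ?r")
  proof
    assume ?l
    then obtain v where v: "\<forall>s\<in>J. c s \<in> chart_dom M i \<longrightarrow>
        ((chart_map M i \<circ> c) has_vector_derivative v s) (at s) \<and>
        (v has_vector_derivative - christoffel M g i (c s) (v s) (v s)) (at s)" ..
    show ?r
    proof (intro ballI impI)
      fix s assume s: "s \<in> J" "c s \<in> chart_dom M i"
      show "geodesic_at i c s"
        by (rule geodesic_atI[OF open_dom_preimage[OF J i], where v = v]) (use s v in auto)
    qed
  next
    assume r: ?r
    show ?l
    proof (intro exI[of _ "vel i c"] ballI impI)
      fix s assume "s \<in> J" "c s \<in> chart_dom M i"
      then have "geodesic_at i c s" using r by simp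
      then show "((chart_map M i \<circ> c) has_vector_derivative vel i c s) (at s) \<and>
          (vel i c has_vector_derivative - christoffel M g i (c s) (vel i c s) (vel i c s)) (at s)"
        unfolding geodesic_at_def by (auto dest: eventually_nhds_x_imp_x)
    qed
  qed
qed

lemma vel_transition:
  assumes ij: "i \<in> idx M" "j \<in> idx M" and c: "isCont c s" "c s \<in> chart_dom M i" "c s \<in> chart_dom M j"
    and v: "((chart_map M i \<circ> c) has_vector_derivative v) (at s)"
  shows "((chart_map M j \<circ> c) has_vector_derivative Dtrans i j (chart_map M i (c s)) v) (at s)"
proof -
  obtain T where T: "open T" "s \<in> T" "\<And>r. r \<in> T \<Longrightarrow> c r \<in> chart_dom M i"
    by (rule isCont_open_nbhd[OF c(1) open_chart_dom[OF ij(1)] c(2)]) blast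
  have z: "chart_map M i (c s) \<in> chart_map M i ` (chart_dom M i \<inter> chart_dom M j)" using c by simp
  have "((\<lambda>r. transition M i j ((chart_map M i \<circ> c) r)) has_derivative
      (\<lambda>h. Dtrans i j (chart_map M i (c s)) (h *\<^sub>R v))) (at s)"
    by (rule has_derivative_compose[OF v[unfolded has_vector_derivative_def]])
      (use has_derivative_transition[OF ij z] in simp)
  then have "((chart_map M j \<circ> c) has_derivative
      (\<lambda>h. Dtrans i j (chart_map M i (c s)) (h *\<^sub>R v))) (at s)"
    by (rule has_derivative_transform_within_open[OF _ T(1,2)]) (use T ij in \<open>auto simp: transition_chart\<close>)
  then show ?thesis by (simp add: has_vector_derivative_def linear_scale[OF linear_Dtrans[OF ij z]])
qed

text \<open>Differentiating the transformation law of the metric and using the symmetry of the second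
  derivative of the transition map turns the Koszul formula in one chart into that in the other.\<close>

lemma geodesic_at_transition:
  assumes ij: "i \<in> idx M" "j \<in> idx M" and c: "isCont c s" "c s \<in> chart_dom M i" "c s \<in> chart_dom M j"
    and cont: "\<forall>\<^sub>F r in nhds s. isCont c r"
    and geo: "geodesic_at i c s"
  shows "geodesic_at j c s"
proof -
  let ?\<phi> = "transition M i j"
  let ?S = "chart_map M i ` (chart_dom M i \<inter> chart_dom M j)"
  let ?z = "chart_map M i \<circ> c"
  obtain T where T: "open T" "s \<in> T"
    "\<And>r. r \<in> T \<Longrightarrow> (?z has_vector_derivative vel i c r) (at r)"
    and acc: "(vel i c has_vector_derivative - christoffel M g i (c s) (vel i c s) (vel i c s)) (at s)"
    using geo by (rule geodesic_atE) blast
  obtain T1 where T1: "open T1" "s \<in> T1" "\<And>r. r \<in> T1 \<Longrightarrow> isCont c r"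
    using cont unfolding eventually_nhds by blast
  have od: "open (chart_dom M i \<inter> chart_dom M j)" using ij open_chart_dom by blast
  obtain T2 where T2: "open T2" "s \<in> T2" "\<And>r. r \<in> T2 \<Longrightarrow> c r \<in> chart_dom M i \<inter> chart_dom M j"
    by (rule isCont_open_nbhd[OF c(1) od]) (use c in blast)+
  have opS: "open ?S" using open_overlap ij open_chart_dom by blast
  have zS: "?z s \<in> ?S" using c by simp
  have zi: "?z s \<in> chart_image i" using c by auto
  define v where "v = vel i c s"
  define V where "V = Dtrans i j (?z s) v"
  define \<Gamma> where "\<Gamma> = christoffel M g i (c s) v v"
  obtain Q where Q: "\<And>u. ((\<lambda>y. Dtrans i j y u) has_derivative (\<lambda>h. Q h u)) (at (?z s))"
    and Qsym: "\<And>u h. Q u h = Q h u"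
    using transition_second_derivative[OF ij zS] by blast
  have zd: "(?z has_vector_derivative v) (at s)" using T v_def by blast
  have zp: "c s \<in> chart_dom M j" "?\<phi> (?z s) = chart_map M j (c s)" "chart_map M j (c s) \<in> chart_image j"
    using c ij transition_chart by auto
  have Vd: "((\<lambda>r. Dtrans i j (?z r) (vel i c r)) has_vector_derivative
      (Q v v + Dtrans i j (?z s) (- \<Gamma>))) (at s)"
  proof -
    have Qz: "((\<lambda>r. Dtrans i j (?z r) u) has_derivative (\<lambda>h. Q (h *\<^sub>R v) u)) (at s)" for u
      using has_derivative_compose[OF zd[unfolded has_vector_derivative_def] Q] .
    have lin: "linear (Dtrans i j (?z r))" if "r \<in> T2" for r
      using T2(3)[OF that] by (intro linear_Dtrans ij) auto
    have "((\<lambda>r. Dtrans i j (?z r) (vel i c r)) has_derivative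
       (\<lambda>h. Q (h *\<^sub>R v) (vel i c s) + Dtrans i j (?z s) (h *\<^sub>R - \<Gamma>))) (at s)"
      using has_derivative_linear_family[OF T2(1,2) lin Qz acc[unfolded has_vector_derivative_def]] by (simp add: \<Gamma>_def v_def)
    moreover have "Q (h *\<^sub>R v) v + Dtrans i j (?z s) (h *\<^sub>R - \<Gamma>) = h *\<^sub>R (Q v v + Dtrans i j (?z s) (- \<Gamma>))" for h
      by (simp only: linear_scale[OF has_derivative_linear[OF Q]] linear_scale[OF lin[OF T2(2)]] scaleR_add_right)
    ultimately show ?thesis unfolding has_vector_derivative_def v_def[symmetric] by simp
  qed
  \<comment> \<open>The transformation law of the Christoffel symbols. Its inhomogeneous term
    \<open>- Q v v\<close> matches the second order term that the product rule produced in
    \<open>Vd\<close>.\<close>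
  have key: "christoffel M g j (c s) V V = Dtrans i j (?z s) \<Gamma> - Q v v"
  proof (rule christoffel_eqI[OF ij(2) zp(1)])
    fix w
    \<comment> \<open>An arbitrary test vector in the chart \<open>j\<close> is the image of a
      vector in the chart \<open>i\<close>, where the Koszul formula is available.\<close>
    define W where "W = Dtrans j i (chart_map M j (c s)) w"
    have w: "w = Dtrans i j (?z s) W" using Dtrans_inverse[OF ij c(2,3)] by (simp add: W_def)
    have dm: "loc_deriv i (?z s) h a b = loc_deriv j (chart_map M j (c s)) (Dtrans i j (?z s) h) (Dtrans i j (?z s) a) (Dtrans i j (?z s) b)
        + g j (c s) (Q h a) (Dtrans i j (?z s) b) + g j (c s) (Dtrans i j (?z s) a) (Q h b)" for h a b
    proof -
      have D1: "((\<lambda>z. loc_metric j (?\<phi> z) u w) has_derivative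
          (\<lambda>h. loc_deriv j (chart_map M j (c s)) (Dtrans i j (?z s) h) u w)) (at (?z s))" for u w
        by (rule has_derivative_compose[OF has_derivative_transition[OF ij zS]])
          (simp only: zp(2), rule has_derivative_metric[OF ij(2) zp(3)])
      have bil: "bilinear (loc_metric j (?\<phi> z))" if "z \<in> ?S" for z
        using that transition_chart[OF ij(1)] ij(2) by (auto intro!: loc_metric_bilinear)
      have "((\<lambda>z. loc_metric j (?\<phi> z) (Dtrans i j z a) (Dtrans i j z b)) has_derivative
        (\<lambda>h. loc_deriv j (chart_map M j (c s)) (Dtrans i j (?z s) h) (Dtrans i j (?z s) a) (Dtrans i j (?z s) b)
         + loc_metric j (?\<phi> (?z s)) (Q h a) (Dtrans i j (?z s) b) + loc_metric j (?\<phi> (?z s)) (Dtrans i j (?z s) a) (Q h b))) (at (?z s))"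
        by (rule has_derivative_bilinear_family[OF opS zS bil D1 Q Q])
      then have "((\<lambda>z. loc_metric i z a b) has_derivative
        (\<lambda>h. loc_deriv j (chart_map M j (c s)) (Dtrans i j (?z s) h) (Dtrans i j (?z s) a) (Dtrans i j (?z s) b)
         + loc_metric j (?\<phi> (?z s)) (Q h a) (Dtrans i j (?z s) b) + loc_metric j (?\<phi> (?z s)) (Dtrans i j (?z s) a) (Q h b))) (at (?z s))"
      proof (rule has_derivative_transform_within_open[OF _ opS zS])
        fix z assume "z \<in> ?S"
        then obtain p where p: "p \<in> chart_dom M i" "p \<in> chart_dom M j" "z = chart_map M i p" by auto
        then show "loc_metric j (?\<phi> z) (Dtrans i j z a) (Dtrans i j z b) = loc_metric i z a b"
          using metric_transition[OF ij p(1,2), of a b] ij by (simp add: transition_chart chart_inv_chart)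
      qed
      from has_derivative_unique[OF has_derivative_metric[OF ij(1) zi] this]
      show ?thesis unfolding zp(2) chart_inv_chart[OF ij(2) zp(1)] by (rule fun_cong)
    qed
    have bj: "bilinear (g j (c s))" using metric_bilinear ij zp by blast
    have "g j (c s) (Dtrans i j (?z s) \<Gamma>) w = g i (c s) \<Gamma> W"
      unfolding w using metric_transition[OF ij c(2,3)] by simp
    also have "2 * \<dots> = 2 * loc_deriv i (?z s) v v W - loc_deriv i (?z s) W v v"
      using christoffel_koszul[OF ij(1) c(2), of v v W] by (simp add: \<Gamma>_def metric_deriv_eq)
    \<comment> \<open>By symmetry of \<open>Q\<close> and of the metric, the terms pairing
      \<open>V\<close> with \<open>Q v W\<close> and those pairing \<open>V\<close> with
      \<open>Q W v\<close> cancel; only the term with \<open>Q v v\<close> survives.\<close>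
    also have "\<dots> = 2 * loc_deriv j (chart_map M j (c s)) V V w - loc_deriv j (chart_map M j (c s)) w V V
      + 2 * g j (c s) (Q v v) w"
      unfolding dm V_def[symmetric] w[symmetric] Qsym[of W v]
      using metric_sym[OF ij(2) zp(1), of "Q v W" V] by simp
    finally show "2 * g j (c s) (Dtrans i j (?z s) \<Gamma> - Q v v) w = metric_deriv M g j (c s) V V w
       + metric_deriv M g j (c s) V V w - metric_deriv M g j (c s) w V V"
      by (simp add: metric_deriv_eq bilinear_lsub[OF bj])
  qed
  show ?thesis
  proof (rule geodesic_atI[of "T \<inter> T1 \<inter> T2" _ _ _ "\<lambda>r. Dtrans i j (?z r) (vel i c r)"])
    show "((chart_map M j \<circ> c) has_vector_derivative Dtrans i j (?z r) (vel i c r)) (at r)"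
      if "r \<in> T \<inter> T1 \<inter> T2" for r
      using vel_transition[OF ij T1(3) _ _ T(3)] that T2(3)[of r] by simp
    have "Q v v + Dtrans i j (?z s) (- \<Gamma>) = - christoffel M g j (c s) V V"
      unfolding key by (simp only: linear_neg[OF linear_Dtrans[OF ij zS]]) simp
    then show "((\<lambda>r. Dtrans i j (?z r) (vel i c r)) has_vector_derivative
       - christoffel M g j (c s) (Dtrans i j (?z s) (vel i c s)) (Dtrans i j (?z s) (vel i c s))) (at s)"
      using Vd by (simp add: V_def v_def)
  qed (use T T1 T2 in auto)
qed

end


section \<open>Continuation of solutions past an endpoint\<close>

text \<open>A Peano solution started at the limit \<open>p\<close> is attached at time
  \<open>b\<close>. Both pieces solve the equation away from \<open>b\<close> and fit together
  continuously, so the glued curve satisfies the integral equation across \<open>b\<close>; since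
  \<open>F\<close> is continuous along it, the integral is differentiable there too.\<close>

lemma ode_extension:
  fixes F :: "'x::euclidean_space \<Rightarrow> 'x"
  assumes D: "open D" and cF: "continuous_on D F" and ab: "a < b"
    and Z: "\<And>s. s \<in> {a<..<b} \<Longrightarrow> Z s \<in> D"
      "\<And>s. s \<in> {a<..<b} \<Longrightarrow> (Z has_vector_derivative F (Z s)) (at s)"
    and lim: "(Z \<longlongrightarrow> p) (at_left b)" and p: "p \<in> D"
  obtains e Y where "e > 0" "\<And>s. s \<in> {a<..<b} \<Longrightarrow> Y s = Z s"
    "\<And>s. s \<in> {a<..<b+e} \<Longrightarrow> Y s \<in> D"
    "\<And>s. s \<in> {a<..<b+e} \<Longrightarrow> (Y has_vector_derivative F (Y s)) (at s)"
proof -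
  obtain e \<xi> where e: "e > 0" and \<xi>: "\<xi> 0 = p" "\<And>s. s \<in> {0..e} \<Longrightarrow> \<xi> s \<in> D"
    "\<And>s. s \<in> {0..e} \<Longrightarrow> (\<xi> has_vector_derivative F (\<xi> s)) (at s within {0..e})"
    using peano_existence[OF D p cF] by blast
  define Y where "Y s = (if s < b then Z s else \<xi> (s - b))" for s
  have YZ: "Y s = Z s" if "s \<in> {a<..<b}" for s using that by (simp add: Y_def)
  have YD: "Y s \<in> D" if "s \<in> {a<..b+e}" for s
    using that Z(1) \<xi>(2) by (auto simp: Y_def)
  have d1: "(Y has_vector_derivative F (Y s)) (at s)" if "s \<in> {a<..<b}" for s
    using has_vector_derivative_transform_within_open[OF Z(2)[OF that], of "{a<..<b}" Y] YZ that by simp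
  have d2: "(Y has_vector_derivative F (Y s)) (at s)" if "s \<in> {b<..<b+e}" for s
  proof -
    have "(\<xi> has_vector_derivative F (\<xi> (s - b))) (at (s - b) within {0<..<e})"
      using that by (intro has_vector_derivative_within_subset[OF \<xi>(3)]) auto
    then have "(\<xi> has_vector_derivative F (\<xi> (s - b))) (at (s - b))"
      using that by (subst (asm) at_within_open) auto
    then have "((\<xi> \<circ> (\<lambda>s. s - b)) has_vector_derivative (1 *\<^sub>R F (\<xi> (s - b)))) (at s)"
      by (intro vector_diff_chain_at) (auto intro!: derivative_eq_intros)
    then have "((\<lambda>s. \<xi> (s - b)) has_vector_derivative F (Y s)) (at s)"
      using that by (simp add: o_def Y_def)
    then show ?thesis
      by (rule has_vector_derivative_transform_within_open[of _ _ _ "{b<..<b+e}"]) (use that in \<open>auto simp: Y_def\<close>)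
  qed
  have "(Y has_vector_derivative F (Y s)) (at s)" if s: "s \<in> {a<..<b+e}" for s
  proof -
    obtain c where c: "a < c" "c < s" "c < b" using s ab dense[of a "min s b"] by auto
    have cl: "continuous_on {c..b} Y"
    proof (rule continuous_on_IccI)
      have "isCont Y r" if "r \<in> {a<..<b}" for r using d1[OF that] has_vector_derivative_continuous by blast
      then have Yr: "(Y \<longlongrightarrow> Y r) (at r)" if "r \<in> {a<..<b}" for r using that isCont_def by blast
      show "(Y \<longlongrightarrow> Y c) (at_right c)" using Yr[of c] c filterlim_at_split by auto
      show "(Y \<longlongrightarrow> Y r) (at r)" if "c < r" "r < b" for r using Yr[of r] that c by auto
      have "Y b = p" by (simp add: Y_def \<xi>)
      moreover have "(Y \<longlongrightarrow> p) (at_left b)"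
        by (rule Lim_transform_eventually[OF lim])
          (use ab in \<open>auto simp: eventually_at_filter Y_def\<close>)
      ultimately show "(Y \<longlongrightarrow> Y b) (at_left b)" by simp
    qed (use c in auto)
    have "continuous_on {0..e} \<xi>"
      unfolding continuous_on_eq_continuous_within by (intro ballI has_vector_derivative_continuous[OF \<xi>(3)])
    then have "continuous_on {b..b+e} (\<lambda>s. \<xi> (s - b))"
      by (rule continuous_on_compose2) (auto intro!: continuous_intros)
    then have "continuous_on {b..b+e} Y"
      by (rule continuous_on_eq) (auto simp: Y_def)
    with cl have "continuous_on ({c..b} \<union> {b..b+e}) Y" by (intro continuous_on_closed_Un) auto
    moreover have "{c..b} \<union> {b..b+e} = {c..b+e}" using c e by auto
    ultimately have cY: "continuous_on {c..b+e} Y" by simp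
    have cFY: "continuous_on {c..b+e} (\<lambda>r. F (Y r))"
      by (rule continuous_on_compose2[OF cF cY]) (use YD c in auto)
    \<comment> \<open>The fundamental theorem tolerates a finite exceptional set, and the junction
      \<open>b\<close> is the only point where differentiability is still open.\<close>
    have int: "((\<lambda>r. F (Y r)) has_integral (Y u - Y c)) {c..u}" if "u \<in> {c..b+e}" for u
    proof (rule fundamental_theorem_of_calculus_interior_strong[of "{b}"])
      show "(Y has_vector_derivative F (Y x)) (at x)" if "x \<in> {c<..<u} - {b}" for x
        using that d1[of x] d2[of x] \<open>u \<in> {c..b+e}\<close> c by (cases "x < b") auto
      show "continuous_on {c..u} Y" using cY by (rule continuous_on_subset) (use that in auto)
    qed (use that in auto)
    have "((\<lambda>u. integral {c..u} (\<lambda>r. F (Y r))) has_vector_derivative F (Y s)) (at s within {c..b+e})"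
      using cFY s c by (intro integral_has_vector_derivative) auto
    then have "((\<lambda>u. integral {c..u} (\<lambda>r. F (Y r))) has_vector_derivative F (Y s)) (at s within {c<..<b+e})"
      by (rule has_vector_derivative_within_subset) auto
    then have "((\<lambda>u. integral {c..u} (\<lambda>r. F (Y r))) has_vector_derivative F (Y s)) (at s)"
      using s c by (subst (asm) at_within_open) auto
    then have "((\<lambda>u. Y c + integral {c..u} (\<lambda>r. F (Y r))) has_vector_derivative F (Y s)) (at s)"
      by (auto intro!: derivative_eq_intros)
    then show ?thesis
      by (rule has_vector_derivative_transform_within_open[of _ _ _ "{c<..<b+e}"])
        (use s c int[THEN integral_unique] in auto)
  qed
  then show ?thesis using that[OF e YZ] YD by auto
qed

section \<open>Time reversal, first integrals and continuation of geodesics\<close>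

context semi_riemannian_atlas
begin

text \<open>Reversing time changes the sign of the velocity but not of the acceleration, and the
  Christoffel term is quadratic in the velocity.\<close>

lemma geodesic_at_reverse:
  assumes i: "i \<in> idx M" "c s \<in> chart_dom M i" and geo: "geodesic_at i c s"
  shows "geodesic_at i (\<lambda>r. c (- r)) (- s)"
proof -
  obtain T where T: "open T" "s \<in> T"
    "\<And>r. r \<in> T \<Longrightarrow> ((chart_map M i \<circ> c) has_vector_derivative vel i c r) (at r)"
    and acc: "(vel i c has_vector_derivative - christoffel M g i (c s) (vel i c s) (vel i c s)) (at s)"
    using geo by (rule geodesic_atE) blast
  have um: "(uminus has_vector_derivative - 1) (at r)" for r :: real
    by (auto intro!: derivative_eq_intros)
  show ?thesis
  proof (rule geodesic_atI[where T = "uminus ` T" and v = "\<lambda>r. - vel i c (- r)"])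
    show "open (uminus ` T)" using T(1) by (rule open_negations)
    show "- s \<in> uminus ` T" using T(2) by simp
    show "((chart_map M i \<circ> (\<lambda>r. c (- r))) has_vector_derivative - vel i c (- r)) (at r)" if "r \<in> uminus ` T" for r
    proof -
      have "- r \<in> T" using that by auto
      from vector_diff_chain_at[OF um T(3)[OF this]] show ?thesis by (simp add: o_def)
    qed
    have "((vel i c \<circ> uminus) has_vector_derivative (- 1) *\<^sub>R (- christoffel M g i (c s) (vel i c s) (vel i c s))) (at (- s))"
      by (rule vector_diff_chain_at[OF um]) (simp add: acc)
    then have "((\<lambda>r. - (vel i c \<circ> uminus) r) has_vector_derivative
        - ((- 1) *\<^sub>R (- christoffel M g i (c s) (vel i c s) (vel i c s)))) (at (- s))"
      by (rule has_vector_derivative_minus)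
    then show "((\<lambda>r. - vel i c (- r)) has_vector_derivative
        - christoffel M g i (c (- (- s))) (- vel i c (- (- s))) (- vel i c (- (- s)))) (at (- s))"
      by (simp add: o_def christoffel_minus[OF i])
  qed
qed

lemma geodesic_on_reverse:
  assumes geo: "geodesic_on M g J c"
  shows "geodesic_on M g (uminus ` J) (\<lambda>r. c (- r))"
  unfolding geodesic_on_iff
proof (intro conjI ballI impI)
  note geo = geo[unfolded geodesic_on_iff]
  show "open (uminus ` J)" using geo by (intro open_negations) simp
  have J: "is_interval J" "J \<noteq> {}" "continuous_on J c" "c ` J \<subseteq> points M" using geo by simp_all
  show "is_interval (uminus ` J)" using J(1) by simp
  show "uminus ` J \<noteq> {}" using J by simp
  show "continuous_on (uminus ` J) (\<lambda>r. c (- r))"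
    by (rule continuous_on_compose2[OF J(3)]) (auto intro!: continuous_intros)
  show "(\<lambda>r. c (- r)) ` uminus ` J \<subseteq> points M" using J(4) by auto
  fix i s assume i: "i \<in> idx M" and s: "s \<in> uminus ` J" "c (- s) \<in> chart_dom M i"
  then have "- s \<in> J" by auto
  then have "geodesic_at i c (- s)" using geo i s(2) by simp
  from geodesic_at_reverse[OF i s(2) this] show "geodesic_at i (\<lambda>r. c (- r)) s" by simp
qed

lemma isCont_geodesic:
  assumes "geodesic_on M g J c" "s \<in> J"
  shows "isCont c s"
  using assms continuous_on_eq_continuous_at unfolding geodesic_on_iff by blast

lemma geodesic_vel:
  assumes "geodesic_on M g J c" "s \<in> J" "i \<in> idx M" "c s \<in> chart_dom M i"
  shows "((chart_map M i \<circ> c) has_vector_derivative vel i c s) (at s)"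
    "(vel i c has_vector_derivative - christoffel M g i (c s) (vel i c s) (vel i c s)) (at s)"
proof -
  have "geodesic_at i c s" using assms unfolding geodesic_on_iff by simp
  then show "((chart_map M i \<circ> c) has_vector_derivative vel i c s) (at s)"
    "(vel i c has_vector_derivative - christoffel M g i (c s) (vel i c s) (vel i c s)) (at s)"
    unfolding geodesic_at_def by (auto dest: eventually_nhds_x_imp_x)
qed

lemma geodesic_vel_transition:
  assumes geo: "geodesic_on M g J c" "s \<in> J" and i: "i \<in> idx M" "c s \<in> chart_dom M i"
    and j: "j \<in> idx M" "c s \<in> chart_dom M j"
  shows "vel j c s = Dtrans i j (chart_map M i (c s)) (vel i c s)"
  by (rule vel_eqI[OF vel_transition[OF i(1) j(1) isCont_geodesic[OF geo] i(2) j(2) geodesic_vel(1)[OF geo i]]])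

text \<open>The common source of all first integrals. In the product rule the acceleration is
  replaced by the Koszul formula, whose first term cancels the derivative of the metric along the
  velocity; half the derivative of the metric in the direction \<open>w\<close> remains. Taking
  \<open>w\<close> to be the velocity gives the energy, a constant \<open>w\<close> the momentum of
  a coordinate field.\<close>

lemma momentum_derivative:
  assumes geo: "geodesic_on M g J c" "s \<in> J" and i: "i \<in> idx M" "c s \<in> chart_dom M i"
    and w: "(w has_vector_derivative w') (at s)"
  shows "((\<lambda>r. g i (c r) (vel i c r) (w r)) has_vector_derivative
    loc_deriv i (chart_map M i (c s)) (w s) (vel i c s) (vel i c s) / 2 + g i (c s) (vel i c s) w') (at s)"
proof -
  let ?z = "chart_map M i \<circ> c"
  let ?v = "vel i c s"
  have zi: "?z s \<in> chart_image i" using i by simp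
  note zz = chart_inv_chart[OF i]
  note vel = geodesic_vel[OF geo i]
  have bil: "bilinear (g i (c s))" using metric_bilinear[OF i] .
  have "((\<lambda>r. loc_metric i (?z r) (vel i c r) (w r)) has_vector_derivative
      loc_deriv i (?z s) ?v ?v (w s) + loc_metric i (?z s) (- christoffel M g i (c s) ?v ?v) (w s)
      + loc_metric i (?z s) ?v w') (at s)"
    by (rule has_vector_derivative_bilinear_family[OF open_chart_image[OF i(1)] zi loc_metric_bilinear[OF i(1)]
        has_derivative_metric[OF i(1) zi] vel w])
  also have "loc_metric i (?z s) (- christoffel M g i (c s) ?v ?v) (w s) =
      loc_deriv i (?z s) (w s) ?v ?v / 2 - loc_deriv i (?z s) ?v ?v (w s)"
    using christoffel_quadratic[OF i(1) zi, of ?v "w s"] by (simp add: zz bilinear_lneg[OF bil])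
  finally have d: "((\<lambda>r. loc_metric i (?z r) (vel i c r) (w r)) has_vector_derivative
      loc_deriv i (?z s) (w s) ?v ?v / 2 + g i (c s) ?v w') (at s)"
    by (simp add: zz)
  have "((\<lambda>r. g i (c r) (vel i c r) (w r)) has_vector_derivative
      loc_deriv i (?z s) (w s) ?v ?v / 2 + g i (c s) ?v w') (at s)"
  proof (rule has_vector_derivative_transform_within_open[OF d])
    show "open (J \<inter> c -` chart_dom M i)" "s \<in> J \<inter> c -` chart_dom M i"
      using geo i by (auto intro!: open_dom_preimage simp: geodesic_on_iff)
    show "loc_metric i (?z r) (vel i c r) (w r) = g i (c r) (vel i c r) (w r)" if "r \<in> J \<inter> c -` chart_dom M i" for r
      using that i(1) by (simp add: chart_inv_chart)
  qed
  then show ?thesis by simp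
qed

text \<open>Here \<open>F i s\<close> is a quantity computed in the chart \<open>i\<close>. Choosing
  a chart at every time makes it a single function on \<open>J\<close>; near each time one fixed
  chart computes it, so its derivative vanishes throughout an interval.\<close>

lemma constant_along_geodesic:
  fixes F :: "'i \<Rightarrow> real \<Rightarrow> real"
  assumes geo: "geodesic_on M g J c"
    and indep: "\<And>i j s. \<lbrakk>s \<in> J; i \<in> idx M; j \<in> idx M; c s \<in> chart_dom M i; c s \<in> chart_dom M j\<rbrakk> \<Longrightarrow> F i s = F j s"
    and deriv: "\<And>i s. \<lbrakk>s \<in> J; i \<in> idx M; c s \<in> chart_dom M i\<rbrakk> \<Longrightarrow> (F i has_vector_derivative 0) (at s)"
  shows "\<exists>E. \<forall>s\<in>J. \<forall>i\<in>idx M. c s \<in> chart_dom M i \<longrightarrow> F i s = E"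
proof -
  note J = geo[unfolded geodesic_on_iff]
  define ch where "ch s = (SOME i. i \<in> idx M \<and> c s \<in> chart_dom M i)" for s
  have ch: "ch s \<in> idx M \<and> c s \<in> chart_dom M (ch s)" if "s \<in> J" for s
    unfolding ch_def by (rule someI_ex) (use J that in \<open>auto simp: points_def\<close>)
  have eq: "F (ch s) s = F i s" if "s \<in> J" "i \<in> idx M" "c s \<in> chart_dom M i" for i s
    using indep ch that by blast
  have "((\<lambda>s. F (ch s) s) has_vector_derivative 0) (at s within J)" if s: "s \<in> J" for s
  proof (rule has_vector_derivative_at_within, rule has_vector_derivative_transform_within_open[OF deriv])
    show "open (J \<inter> c -` chart_dom M (ch s))" using J ch[OF s] by (intro open_dom_preimage) auto
    show "F (ch s) r = F (ch r) r" if "r \<in> J \<inter> c -` chart_dom M (ch s)" for r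
      using that eq[of r "ch s"] ch[OF s] by simp
  qed (use s ch[OF s] in auto)
  moreover have "convex J" using J is_interval_convex by blast
  ultimately obtain E where "\<And>s. s \<in> J \<Longrightarrow> F (ch s) s = E"
    using has_vector_derivative_zero_constant by blast
  then show ?thesis using eq by metis
qed

text \<open>For \<open>w\<close> equal to the velocity, the two terms of
  \<open>momentum_derivative\<close> are opposite by the geodesic equation.\<close>

lemma energy_conserved:
  assumes geo: "geodesic_on M g J c"
  shows "\<exists>E. \<forall>s\<in>J. \<forall>i\<in>idx M. c s \<in> chart_dom M i \<longrightarrow> g i (c s) (vel i c s) (vel i c s) = E"
proof (rule constant_along_geodesic[OF geo])
  fix s i assume s: "s \<in> J" and i: "i \<in> idx M" "c s \<in> chart_dom M i"
  show "g i (c s) (vel i c s) (vel i c s) = g j (c s) (vel j c s) (vel j c s)" if "j \<in> idx M" "c s \<in> chart_dom M j" for j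
    unfolding geodesic_vel_transition[OF geo s i that] by (rule metric_transition[OF i(1) that(1) i(2) that(2)])
  let ?v = "vel i c s"
  have zi: "chart_map M i (c s) \<in> chart_image i" using i by simp
  have "g i (c s) ?v (- christoffel M g i (c s) ?v ?v) = - loc_deriv i (chart_map M i (c s)) ?v ?v ?v / 2"
    using christoffel_quadratic[OF i(1) zi, of ?v ?v]
    by (simp add: chart_inv_chart[OF i] bilinear_rneg[OF metric_bilinear[OF i]] metric_sym[OF i, of ?v])
  then show "((\<lambda>r. g i (c r) (vel i c r) (vel i c r)) has_vector_derivative 0) (at s)"
    using momentum_derivative[OF geo s i geodesic_vel(2)[OF geo s i]] by simp
qed

text \<open>Noether's theorem for a field with the same constant components \<open>w\<close> in
  every chart: the first condition says that transition maps preserve it, the second that the metric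
  does not change along it.\<close>

lemma killing_momentum_conserved:
  assumes geo: "geodesic_on M g J c"
    and w: "\<And>i j p. \<lbrakk>i \<in> idx M; j \<in> idx M; p \<in> chart_dom M i; p \<in> chart_dom M j\<rbrakk> \<Longrightarrow> Dtrans i j (chart_map M i p) w = w"
    and K: "\<And>i p u. \<lbrakk>i \<in> idx M; p \<in> chart_dom M i\<rbrakk> \<Longrightarrow> metric_deriv M g i p w u u = 0"
  shows "\<exists>P. \<forall>s\<in>J. \<forall>i\<in>idx M. c s \<in> chart_dom M i \<longrightarrow> g i (c s) (vel i c s) w = P"
proof (rule constant_along_geodesic[OF geo])
  fix s i assume s: "s \<in> J" and i: "i \<in> idx M" "c s \<in> chart_dom M i"
  show "g i (c s) (vel i c s) w = g j (c s) (vel j c s) w" if "j \<in> idx M" "c s \<in> chart_dom M j" for j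
    using metric_transition[OF i(1) that(1) i(2) that(2), of "vel i c s" w] w[OF i(1) that(1) i(2) that(2)]
    by (simp add: geodesic_vel_transition[OF geo s i that])
  have "((\<lambda>r. w) has_vector_derivative 0) (at s)" by simp
  from momentum_derivative[OF geo s i this] show "((\<lambda>r. g i (c r) (vel i c r) w) has_vector_derivative 0) (at s)"
    using K[OF i] by (simp add: metric_deriv_eq bilinear_rzero[OF metric_bilinear[OF i]])
qed

text \<open>A velocity bound in a chart around the limit point bounds the acceleration, so the
  velocity converges as well and the curve in phase space can be continued by
  \<open>ode_extension\<close>. The continued curve solves the equation in the chart
  \<open>i\<close>; the other charts follow by \<open>geodesic_at_transition\<close>, and times in
  \<open>J\<close> keep what held there.\<close>

lemma geodesic_extension:
  assumes geo: "geodesic_on M g J c" and ab: "a < b" "{a<..<b} \<subseteq> J" "J \<subseteq> {..<b}"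
    and i: "i \<in> idx M" "P \<in> chart_dom M i" and lim: "(c \<longlongrightarrow> P) (at_left b)"
    and dom: "\<And>s. s \<in> {a<..<b} \<Longrightarrow> c s \<in> chart_dom M i"
    and K: "\<And>s. s \<in> {a<..<b} \<Longrightarrow> norm (vel i c s) \<le> K"
  shows "\<exists>J' c'. J \<subset> J' \<and> geodesic_on M g J' c' \<and> (\<forall>s\<in>J. c' s = c s)"
proof -
  note J = geo[unfolded geodesic_on_iff]
  let ?z = "chart_map M i \<circ> c"
  let ?p = "chart_map M i P"
  define \<Gamma> where "\<Gamma> x = christoffel M g i (chart_inv M i (fst x)) (snd x) (snd x)" for x :: "'e \<times> 'e"
  have c\<Gamma>: "continuous_on (chart_image i \<times> UNIV) \<Gamma>"
    using continuous_on_christoffel[OF i(1)] by (simp add: \<Gamma>_def[abs_def] case_prod_unfold)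
  have zlim: "(?z \<longlongrightarrow> ?p) (at_left b)"
    unfolding o_def by (rule isCont_tendsto_compose[OF isCont_chart[OF i] lim])
  have pi: "?p \<in> chart_image i" using i by simp
  obtain r where r: "r > 0" "cball ?p r \<subseteq> chart_image i"
    using open_contains_cball open_chart_image[OF i(1)] pi by blast
  have "eventually (\<lambda>s. ?z s \<in> cball ?p r) (at_left b)"
    using tendstoD[OF zlim r(1)] by eventually_elim (simp add: dist_commute less_imp_le)
  then obtain a1 where a1: "a1 < b" "\<And>s. a1 < s \<Longrightarrow> s < b \<Longrightarrow> ?z s \<in> cball ?p r"
    unfolding eventually_at_left_field by blast
  define a2 where "a2 = max a a1"
  have a2: "a2 < b" "a \<le> a2" "a1 \<le> a2" using a1 ab by (auto simp: a2_def)
  \<comment> \<open>Positions near the limit together with velocities bounded by \<open>K\<close>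
    form a compact set, on which the continuous Christoffel term is bounded.\<close>
  have "compact (\<Gamma> ` (cball ?p r \<times> cball 0 K))"
    by (rule compact_continuous_image[OF continuous_on_subset[OF c\<Gamma>]]) (use r in \<open>auto intro!: compact_Times\<close>)
  then obtain K2 where K2: "\<And>x. x \<in> cball ?p r \<times> cball 0 K \<Longrightarrow> norm (\<Gamma> x) \<le> K2"
    using compact_imp_bounded bounded_iff by (metis imageI)
  have s: "s \<in> J" "c s \<in> chart_dom M i" "norm (vel i c s) \<le> K" "?z s \<in> cball ?p r" if "s \<in> {a2<..<b}" for s
    using that a2 ab(2) dom K a1(2) by auto
  have \<Gamma>s: "\<Gamma> (?z s, vel i c s) = christoffel M g i (c s) (vel i c s) (vel i c s)" if "s \<in> {a2<..<b}" for s
    by (simp add: \<Gamma>_def chart_inv_chart[OF i(1) s(2)[OF that]])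
  have acc: "(vel i c has_vector_derivative - \<Gamma> (?z s, vel i c s)) (at s)" if "s \<in> {a2<..<b}" for s
    using geodesic_vel(2)[OF geo s(1)[OF that] i(1) s(2)[OF that]] \<Gamma>s[OF that] by simp
  have "norm (- \<Gamma> (?z t, vel i c t)) \<le> K2" if "t \<in> {a2<..<b}" for t
    using K2[of "(?z t, vel i c t)"] s(3,4)[OF that] by simp
  from bounded_derivative_imp_limit_at_left[OF a2(1) acc this]
  obtain vb where vb: "(vel i c \<longlongrightarrow> vb) (at_left b)" by blast
  define F where "F x = (snd x, - \<Gamma> x)" for x :: "'e \<times> 'e"
  define D where "D = chart_image i \<times> (UNIV :: 'e set)"
  have D: "open D" unfolding D_def using open_chart_image[OF i(1)] by (intro open_Times) auto
  have cF: "continuous_on D F"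
    unfolding F_def D_def by (intro continuous_intros c\<Gamma>)
  define Z where "Z s = (?z s, vel i c s)" for s
  have ZD: "Z s \<in> D" if "s \<in> {a2<..<b}" for s using s(2)[OF that] by (simp add: Z_def D_def)
  have Zd: "(Z has_vector_derivative F (Z s)) (at s)" if "s \<in> {a2<..<b}" for s
    unfolding Z_def F_def snd_conv
    by (rule has_vector_derivative_Pair[OF geodesic_vel(1)[OF geo s(1)[OF that] i(1) s(2)[OF that]] acc[OF that]])
  have Zl: "(Z \<longlongrightarrow> (?p, vb)) (at_left b)" unfolding Z_def by (intro tendsto_Pair zlim vb)
  have pD: "(?p, vb) \<in> D" using pi by (simp add: D_def)
  obtain e Y where e: "e > 0" and YZ: "\<And>s. s \<in> {a2<..<b} \<Longrightarrow> Y s = Z s"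
    and YD: "\<And>s. s \<in> {a2<..<b+e} \<Longrightarrow> Y s \<in> D"
    and Yd: "\<And>s. s \<in> {a2<..<b+e} \<Longrightarrow> (Y has_vector_derivative F (Y s)) (at s)"
    using ode_extension[OF D cF a2(1) ZD Zd Zl pD] by blast
  \<comment> \<open>On \<open>{a2<..<b}\<close> both branches agree because \<open>Y\<close>
    continues the chart expression of \<open>c\<close>. Hence \<open>c'\<close> coincides with the
    pullback of \<open>Y\<close> on an open interval around \<open>b\<close>.\<close>
  define c' where "c' s = (if s < b then c s else chart_inv M i (fst (Y s)))" for s
  define J' where "J' = J \<union> {a2<..<b+e}"
  have Yi: "fst (Y s) \<in> chart_image i" if "s \<in> {a2<..<b+e}" for s
    using YD[OF that] by (auto simp: D_def)
  have c'Y: "c' s = chart_inv M i (fst (Y s))" if "s \<in> {a2<..<b+e}" for s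
    using that YZ[of s] s(2)[of s] by (auto simp: c'_def Z_def chart_inv_chart[OF i(1)])
  have c'i: "c' s \<in> chart_dom M i" "chart_map M i (c' s) = fst (Y s)" if "s \<in> {a2<..<b+e}" for s
    using c'Y[OF that] chart_chart_inv[OF i(1) Yi[OF that]] by simp_all
  have c'c: "c' s = c s" if "s \<in> J" for s using that ab(3) by (auto simp: c'_def)
  have cont1: "isCont c' s" if t: "s \<in> {a2<..<b+e}" for s
  proof -
    have "isCont (\<lambda>s. chart_inv M i (fst (Y s))) s"
      by (rule isCont_o2[where f = "\<lambda>s. fst (Y s)" and g = "chart_inv M i"])
        (intro isCont_fst has_vector_derivative_continuous[OF Yd[OF t]] isCont_chart_inv[OF i(1) Yi[OF t]])+
    moreover have "eventually (\<lambda>s. c' s = chart_inv M i (fst (Y s))) (nhds s)"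
      using t c'Y eventually_nhds_in_open[of "{a2<..<b+e}" s] by (auto elim: eventually_mono)
    ultimately show ?thesis using isCont_cong by fast
  qed
  have cont2: "isCont c' s" if t: "s \<in> J" for s
  proof -
    have "eventually (\<lambda>s. c' s = c s) (nhds s)"
      using eventually_mono[OF eventually_nhds_in_open[of J s] c'c] J t by simp
    then show ?thesis using isCont_geodesic[OF geo t] isCont_cong by fast
  qed
  have oJ': "open J'" using J by (auto simp: J'_def)
  have cont: "isCont c' s" if "s \<in> J'" for s using that cont1 cont2 by (auto simp: J'_def)
  have gi: "geodesic_at i c' t" if t: "t \<in> {a2<..<b+e}" for t
  proof (rule geodesic_atI[where T = "{a2<..<b+e}" and v = "\<lambda>s. snd (Y s)"])
    have dY: "((\<lambda>s. fst (Y s)) has_vector_derivative snd (Y s)) (at s)"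
      "((\<lambda>s. snd (Y s)) has_vector_derivative - \<Gamma> (Y s)) (at s)" if "s \<in> {a2<..<b+e}" for s
      using bounded_linear.has_vector_derivative[OF bounded_linear_fst Yd[OF that]]
        bounded_linear.has_vector_derivative[OF bounded_linear_snd Yd[OF that]] by (simp_all add: F_def)
    show "((chart_map M i \<circ> c') has_vector_derivative snd (Y s)) (at s)" if "s \<in> {a2<..<b+e}" for s
      by (rule has_vector_derivative_transform_within_open[OF dY(1)[OF that] _ that]) (auto simp: c'i)
    show "((\<lambda>s. snd (Y s)) has_vector_derivative - christoffel M g i (c' t) (snd (Y t)) (snd (Y t))) (at t)"
      using dY(2)[OF t] by (simp add: \<Gamma>_def c'Y[OF t])
  qed (use t in auto)
  have "geodesic_on M g J' c'"
    unfolding geodesic_on_iff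
  proof (intro conjI ballI impI oJ')
    show "is_interval J'"
      unfolding is_interval_1
    proof (intro ballI allI impI)
      fix x y t assume xy: "x \<in> J'" "y \<in> J'" "x \<le> t \<and> t \<le> y"
      show "t \<in> J'"
      proof (cases "t < b")
        case True
        show ?thesis
        proof (cases "a2 < t")
          case False
          with xy have "x \<in> J" by (auto simp: J'_def)
          \<comment> \<open>A point \<open>t\<close> not beyond \<open>a2\<close> lies between
            \<open>x\<close> and this midpoint, both of which belong to the interval
            \<open>J\<close>.\<close>
          moreover have "(a2 + b) / 2 \<in> J" using a2 ab(2) by auto
          moreover have "t \<le> (a2 + b) / 2" using False a2 by simp
          ultimately have "t \<in> J" using J xy(3) unfolding is_interval_1 by blast
          then show ?thesis by (simp add: J'_def)
        qed (use True e in \<open>auto simp: J'_def\<close>)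
      next
        case False
        with xy ab(3) have "y \<in> {a2<..<b+e}" by (auto simp: J'_def)
        with False xy a2 show ?thesis by (auto simp: J'_def)
      qed
    qed
    show "J' \<noteq> {}" using J by (auto simp: J'_def)
    show "continuous_on J' c'" using cont by (intro continuous_at_imp_continuous_on) auto
    show "c' ` J' \<subseteq> points M"
    proof
      fix q assume "q \<in> c' ` J'"
      then obtain s where s: "s \<in> J'" "q = c' s" by auto
      show "q \<in> points M"
      proof (cases "s \<in> J")
        case True
        then show ?thesis using s c'c J by auto
      next
        case False
        then show ?thesis using s c'i(1)[of s] i(1) by (auto simp: J'_def points_def)
      qed
    qed
    fix j s assume j: "j \<in> idx M" and s: "s \<in> J'" "c' s \<in> chart_dom M j"
    show "geodesic_at j c' s"
    proof (cases "s \<in> J")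
      case True
      have "geodesic_at j c s" using J j s(2) c'c[OF True] True by simp
      then show ?thesis by (rule geodesic_at_cong[rotated 3]) (use J True c'c in auto)
    next
      case False
      then have t: "s \<in> {a2<..<b+e}" using s by (simp add: J'_def)
      have "eventually (\<lambda>r. isCont c' r) (nhds s)"
        using eventually_nhds_in_open[OF oJ' s(1)] cont by (auto elim: eventually_mono)
      then show ?thesis
        by (rule geodesic_at_transition[OF i(1) j cont[OF s(1)] c'i(1)[OF t] s(2) _ gi[OF t]])
    qed
  qed
  \<comment> \<open>The time \<open>b\<close> itself witnesses that the extension is proper.\<close>
  moreover have "b \<in> J'" "b \<notin> J" using a2 e ab(3) by (auto simp: J'_def)
  ultimately show ?thesis using c'c by (intro exI[of _ J'] exI[of _ c']) (auto simp: J'_def)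
qed

end


section \<open>The Riemannian distance\<close>

lemma continuous_on_bilinear_family:
  fixes G :: "'p::topological_space \<Rightarrow> 'e::euclidean_space \<Rightarrow> 'e \<Rightarrow> real"
  assumes bil: "\<And>x. x \<in> S \<Longrightarrow> bilinear (G x)"
    and G: "\<And>u v. continuous_on S (\<lambda>x. G x u v)"
    and f: "continuous_on S f" and k: "continuous_on S k"
  shows "continuous_on S (\<lambda>x. G x (f x) (k x))"
proof -
  have "continuous_on S (\<lambda>x. \<Sum>c\<in>Basis. (f x \<bullet> c) * (\<Sum>d\<in>Basis. (k x \<bullet> d) * G x c d))"
    by (intro continuous_intros f k G)
  then show ?thesis
  proof (rule continuous_on_eq)
    fix x assume "x \<in> S"
    then have b: "linear (\<lambda>u. G x u v)" "linear (G x u)" for u v using bil by (auto simp: bilinear_def)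
    show "(\<Sum>c\<in>Basis. (f x \<bullet> c) * (\<Sum>d\<in>Basis. (k x \<bullet> d) * G x c d)) = G x (f x) (k x)"
      by (simp only: linear_basis_expansion[OF b(1), where x = "f x"]) (simp only: linear_basis_expansion[OF b(2), where x = "k x"])
  qed
qed

section \<open>Affine reparametrisation of curves\<close>

text \<open>Serves reversal, concatenation and rescaling of curves. The factor
  \<open>\<alpha>\<close> may be negative, and agreement is required on the closed interval only, so
  that each piece of a joined path qualifies.\<close>

lemma C1_arc_affine:
  assumes C: "C1_arc M a b \<gamma>" and \<alpha>: "\<alpha> \<noteq> 0"
    and sub: "\<And>s. s \<in> {a'..b'} \<Longrightarrow> \<alpha> * s + \<beta> \<in> {a..b}"
    and eq: "\<And>s. s \<in> {a'..b'} \<Longrightarrow> \<eta> s = \<gamma> (\<alpha> * s + \<beta>)"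
  shows "C1_arc M a' b' \<eta>"
  unfolding C1_arc_def
proof
  fix i assume "i \<in> idx M"
  then obtain v where v: "continuous_on {s \<in> {a..b}. \<gamma> s \<in> chart_dom M i} v"
    "\<And>s. s \<in> {a..b} \<Longrightarrow> \<gamma> s \<in> chart_dom M i \<Longrightarrow>
        ((chart_map M i \<circ> \<gamma>) has_vector_derivative v s) (at s within {a..b})"
    using C unfolding C1_arc_def by meson
  let ?\<theta> = "\<lambda>s. \<alpha> * s + \<beta>"
  show "\<exists>v. continuous_on {s \<in> {a'..b'}. \<eta> s \<in> chart_dom M i} v \<and>
     (\<forall>s\<in>{a'..b'}. \<eta> s \<in> chart_dom M i \<longrightarrow>
        ((chart_map M i \<circ> \<eta>) has_vector_derivative v s) (at s within {a'..b'}))"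
  proof (intro exI[of _ "\<lambda>s. \<alpha> *\<^sub>R v (?\<theta> s)"] conjI ballI impI)
    show "continuous_on {s \<in> {a'..b'}. \<eta> s \<in> chart_dom M i} (\<lambda>s. \<alpha> *\<^sub>R v (?\<theta> s))"
      by (intro continuous_intros continuous_on_compose2[OF v(1)]) (use sub eq in auto)
    fix s assume s: "s \<in> {a'..b'}" "\<eta> s \<in> chart_dom M i"
    have "((chart_map M i \<circ> \<gamma>) has_vector_derivative v (?\<theta> s)) (at (?\<theta> s) within ?\<theta> ` {a'..b'})"
      by (rule has_vector_derivative_within_subset[OF v(2)]) (use s sub eq in auto)
    moreover have "(?\<theta> has_vector_derivative \<alpha>) (at s within {a'..b'})"
      by (auto intro!: derivative_eq_intros)
    ultimately have "(((chart_map M i \<circ> \<gamma>) \<circ> ?\<theta>) has_vector_derivative \<alpha> *\<^sub>R v (?\<theta> s)) (at s within {a'..b'})"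
      by (intro vector_diff_chain_within)
    then show "((chart_map M i \<circ> \<eta>) has_vector_derivative \<alpha> *\<^sub>R v (?\<theta> s)) (at s within {a'..b'})"
      by (rule has_vector_derivative_transform[rotated 2]) (use s eq in auto)
  qed
qed

lemma C1_arc_derivative:
  assumes C: "C1_arc M a b \<gamma>" and s: "s \<in> {a<..<b}" and i: "i \<in> idx M" "\<gamma> s \<in> chart_dom M i"
  shows "\<exists>v. ((chart_map M i \<circ> \<gamma>) has_vector_derivative v) (at s)"
proof -
  obtain v where "((chart_map M i \<circ> \<gamma>) has_vector_derivative v s) (at s within {a..b})"
    using C i s unfolding C1_arc_def by (metis greaterThanLessThan_iff atLeastAtMost_iff less_imp_le)
  then have "((chart_map M i \<circ> \<gamma>) has_vector_derivative v s) (at s within {a<..<b})"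
    by (rule has_vector_derivative_within_subset) auto
  then have "((chart_map M i \<circ> \<gamma>) has_vector_derivative v s) (at s)"
    using s by (subst (asm) at_within_open) auto
  then show ?thesis ..
qed

text \<open>Both curves are at the same point at the compared times, so the arbitrary choice of a
  chart in \<open>speed\<close> falls on the same chart and the chain rule can be applied in
  it.\<close>

lemma speed_affine:
  assumes T: "open T" "s \<in> T" and eq: "\<And>r. r \<in> T \<Longrightarrow> \<eta> r = \<gamma> (\<alpha> * r + \<beta>)"
    and pt: "\<gamma> (\<alpha> * s + \<beta>) \<in> points M"
    and d: "\<And>i. i \<in> idx M \<Longrightarrow> \<gamma> (\<alpha> * s + \<beta>) \<in> chart_dom M i \<Longrightarrow>
      \<exists>v. ((chart_map M i \<circ> \<gamma>) has_vector_derivative v) (at (\<alpha> * s + \<beta>))"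
    and bil: "\<And>i p. i \<in> idx M \<Longrightarrow> p \<in> chart_dom M i \<Longrightarrow> bilinear (g i p)"
  shows "speed M g \<eta> s = \<bar>\<alpha>\<bar> * speed M g \<gamma> (\<alpha> * s + \<beta>)"
proof -
  let ?\<theta> = "\<lambda>s. \<alpha> * s + \<beta>"
  define i where "i = (SOME i. i \<in> idx M \<and> \<gamma> (?\<theta> s) \<in> chart_dom M i)"
  have i: "i \<in> idx M \<and> \<gamma> (?\<theta> s) \<in> chart_dom M i"
    unfolding i_def by (rule someI_ex) (use pt in \<open>auto simp: points_def\<close>)
  obtain v where v: "((chart_map M i \<circ> \<gamma>) has_vector_derivative v) (at (?\<theta> s))" using d i by blast
  have "(?\<theta> has_vector_derivative \<alpha>) (at s)" by (auto intro!: derivative_eq_intros)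
  from vector_diff_chain_at[OF this v]
  have "((chart_map M i \<circ> \<eta>) has_vector_derivative \<alpha> *\<^sub>R v) (at s)"
    by (rule has_vector_derivative_transform_within_open[OF _ T]) (simp add: eq)
  then have v\<eta>: "vector_derivative (chart_map M i \<circ> \<eta>) (at s) = \<alpha> *\<^sub>R v" by (rule vector_derivative_at)
  have v\<gamma>: "vector_derivative (chart_map M i \<circ> \<gamma>) (at (?\<theta> s)) = v" by (rule vector_derivative_at[OF v])
  have b: "bilinear (g i (\<gamma> (?\<theta> s)))" using bil i by blast
  have "speed M g \<eta> s = sqrt (\<alpha>\<^sup>2 * g i (\<gamma> (?\<theta> s)) v v)"
    unfolding speed_def eq[OF T(2)] i_def[symmetric] Let_def v\<eta>
    by (simp add: bilinear_lmul[OF b] bilinear_rmul[OF b] power2_eq_square)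
  also have "\<dots> = \<bar>\<alpha>\<bar> * speed M g \<gamma> (?\<theta> s)"
    unfolding speed_def i_def[symmetric] Let_def v\<gamma> by (simp add: real_sqrt_mult)
  finally show ?thesis .
qed

section \<open>Lengths of curves in charts\<close>

locale riemannian_atlas = semi_riemannian_atlas M g
  for M :: "('i, 'a::t2_space, 'e::euclidean_space) atlas" and g :: "('i, 'a, 'e) tensor2" +
  assumes metric_pos: "i \<in> idx M \<Longrightarrow> p \<in> chart_dom M i \<Longrightarrow> u \<noteq> 0 \<Longrightarrow> g i p u u > 0"
    and connected_points: "connected (points M)"
begin

lemma metric_nonneg: "i \<in> idx M \<Longrightarrow> p \<in> chart_dom M i \<Longrightarrow> g i p u u \<ge> 0"
  using metric_pos[of i p u] bilinear_rzero[OF metric_bilinear, of i p] by (cases "u = 0") auto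

text \<open>The metric is continuous and positive on the compact product of a closed chart ball and
  the unit sphere; \<open>m\<close> is the square root of its minimum, and homogeneity extends the
  bound to all vectors.\<close>

lemma metric_lower_bound:
  assumes i: "i \<in> idx M" "p \<in> chart_dom M i"
  obtains r m where "r > 0" "m > 0" "cball (chart_map M i p) r \<subseteq> chart_image i"
    "\<And>z u. z \<in> cball (chart_map M i p) r \<Longrightarrow> m * norm u \<le> sqrt (loc_metric i z u u)"
proof -
  let ?p = "chart_map M i p"
  have pi: "?p \<in> chart_image i" using i by simp
  obtain r where r: "r > 0" "cball ?p r \<subseteq> chart_image i"
    using open_contains_cball open_chart_image[OF i(1)] pi by blast
  let ?K = "cball ?p r \<times> sphere (0::'e) 1"
  have K: "compact ?K" by (intro compact_Times) auto
  have "?K \<noteq> {}" using r by (simp add: Times_empty)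
  have cont: "continuous_on ?K (\<lambda>x. loc_metric i (fst x) (snd x) (snd x))"
  proof (rule continuous_on_bilinear_family[where G = "\<lambda>x. loc_metric i (fst x)"])
    show "bilinear (loc_metric i (fst x))" if "x \<in> ?K" for x
      using that r by (intro loc_metric_bilinear i) auto
    show "continuous_on ?K (\<lambda>x. loc_metric i (fst x) u v)" for u v
      by (rule continuous_on_compose2[OF continuous_on_loc_metric[OF i(1)] continuous_on_fst[OF continuous_on_id]])
        (use r in auto)
  qed (intro continuous_intros)+
  obtain x0 where x0: "x0 \<in> ?K" "\<And>x. x \<in> ?K \<Longrightarrow> loc_metric i (fst x0) (snd x0) (snd x0) \<le> loc_metric i (fst x) (snd x) (snd x)"
    using continuous_attains_inf[OF K \<open>?K \<noteq> {}\<close> cont] by blast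
  define m where "m = sqrt (loc_metric i (fst x0) (snd x0) (snd x0))"
  have "fst x0 \<in> chart_image i" "snd x0 \<noteq> 0" using x0(1) r by (auto simp: dist_norm)
  then have m: "m > 0" unfolding m_def by (simp add: metric_pos i chart_chart_inv)
  have "m * norm u \<le> sqrt (loc_metric i z u u)" if z: "z \<in> cball ?p r" for z u
  proof (cases "u = 0")
    case False
    have b: "bilinear (loc_metric i z)" using z r by (intro loc_metric_bilinear i) auto
    have "(z, u /\<^sub>R norm u) \<in> ?K" using z False by simp
    from x0(2)[OF this] have "m \<le> sqrt (loc_metric i z (u /\<^sub>R norm u) (u /\<^sub>R norm u))"
      unfolding m_def by (simp del: real_sqrt_le_iff) (simp add: real_sqrt_le_mono)
    also have "loc_metric i z (u /\<^sub>R norm u) (u /\<^sub>R norm u) = loc_metric i z u u / (norm u)\<^sup>2"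
      by (simp add: bilinear_lmul[OF b] bilinear_rmul[OF b] power2_eq_square divide_inverse)
    also have "sqrt \<dots> = sqrt (loc_metric i z u u) / norm u" by (simp add: real_sqrt_divide)
    finally show ?thesis using False by (simp add: pos_le_divide_eq)
  next
    case True
    have "bilinear (loc_metric i z)" using z r by (intro loc_metric_bilinear i) auto
    then show ?thesis using True by (simp add: bilinear_rzero)
  qed
  with r m that show ?thesis by blast
qed

lemma speed_nonneg: "\<gamma> s \<in> points M \<Longrightarrow> speed M g \<gamma> s \<ge> 0"
proof -
  assume pt: "\<gamma> s \<in> points M"
  define i where "i = (SOME i. i \<in> idx M \<and> \<gamma> s \<in> chart_dom M i)"
  have "i \<in> idx M \<and> \<gamma> s \<in> chart_dom M i"
    unfolding i_def by (rule someI_ex) (use pt in \<open>auto simp: points_def\<close>)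
  then show ?thesis unfolding speed_def i_def[symmetric] Let_def by (simp add: metric_nonneg)
qed

text \<open>Frees \<open>speed\<close> from its arbitrary choice of a chart.\<close>

lemma speed_eq:
  assumes i: "i \<in> idx M" "\<gamma> s \<in> chart_dom M i" and c: "isCont \<gamma> s"
    and v: "((chart_map M i \<circ> \<gamma>) has_vector_derivative v) (at s)"
  shows "speed M g \<gamma> s = sqrt (g i (\<gamma> s) v v)"
proof -
  define j where "j = (SOME i. i \<in> idx M \<and> \<gamma> s \<in> chart_dom M i)"
  have j: "j \<in> idx M \<and> \<gamma> s \<in> chart_dom M j"
    unfolding j_def by (rule someI_ex) (use i in \<open>auto simp: points_def\<close>)
  have "vector_derivative (chart_map M j \<circ> \<gamma>) (at s) = Dtrans i j (chart_map M i (\<gamma> s)) v"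
    using vel_transition[OF i(1) _ c i(2) _ v] j by (intro vector_derivative_at) auto
  then show ?thesis unfolding speed_def j_def[symmetric] Let_def
    using metric_transition[OF i(1) _ i(2), of j v v] j by simp
qed

text \<open>Within one chart the speed agrees with a continuous function except perhaps at the two
  ends: \<open>speed\<close> takes a two-sided derivative, while \<open>C1_arc\<close> controls only
  one-sided derivatives there.\<close>

lemma speed_integrable_arc:
  assumes C: "C1_arc M a b \<gamma>" and i: "i \<in> idx M" "\<gamma> ` {a..b} \<subseteq> chart_dom M i"
    and c: "continuous_on {a..b} \<gamma>"
  shows "speed M g \<gamma> integrable_on {a..b}"
proof -
  obtain v where v: "continuous_on {s \<in> {a..b}. \<gamma> s \<in> chart_dom M i} v"
    "\<And>s. s \<in> {a..b} \<Longrightarrow> \<gamma> s \<in> chart_dom M i \<Longrightarrow>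
        ((chart_map M i \<circ> \<gamma>) has_vector_derivative v s) (at s within {a..b})"
    using C i unfolding C1_arc_def by meson
  have dom: "\<gamma> s \<in> chart_dom M i" if "s \<in> {a..b}" for s using i that by blast
  then have "{s \<in> {a..b}. \<gamma> s \<in> chart_dom M i} = {a..b}" by blast
  with v(1) have vc: "continuous_on {a..b} v" by simp
  have "continuous_on {a..b} (\<lambda>s. loc_metric i (chart_map M i (\<gamma> s)) (v s) (v s))"
  proof (rule continuous_on_bilinear_family[where G = "\<lambda>s. loc_metric i (chart_map M i (\<gamma> s))", OF _ _ vc vc])
    show "bilinear (loc_metric i (chart_map M i (\<gamma> s)))" if "s \<in> {a..b}" for s
      using dom[OF that] by (intro loc_metric_bilinear i) auto
    have "continuous_on {a..b} (\<lambda>s. chart_map M i (\<gamma> s))"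
      by (rule continuous_on_compose2[OF homeomorphism_cont1[OF homeomorphism_chart[OF i(1)]] c i(2)])
    then show "continuous_on {a..b} (\<lambda>s. loc_metric i (chart_map M i (\<gamma> s)) u w)" for u w
      by (rule continuous_on_compose2[OF continuous_on_loc_metric[OF i(1)]]) (use dom in auto)
  qed
  then have "continuous_on {a..b} (\<lambda>s. sqrt (loc_metric i (chart_map M i (\<gamma> s)) (v s) (v s)))"
    by (intro continuous_intros)
  then have "(\<lambda>s. sqrt (loc_metric i (chart_map M i (\<gamma> s)) (v s) (v s))) integrable_on {a..b}"
    by (rule integrable_continuous_real)
  then show ?thesis
  proof (rule integrable_spike_finite[of "{a, b}", rotated 2])
    fix s assume "s \<in> {a..b} - {a, b}"
    then have s: "s \<in> {a<..<b}" "s \<in> {a..b}" by auto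
    have "((chart_map M i \<circ> \<gamma>) has_vector_derivative v s) (at s within {a<..<b})"
      by (rule has_vector_derivative_within_subset[OF v(2)[OF s(2) dom[OF s(2)]]]) auto
    then have vs: "((chart_map M i \<circ> \<gamma>) has_vector_derivative v s) (at s)"
      using s by (subst (asm) at_within_open) auto
    have "continuous_on {a<..<b} \<gamma>" by (rule continuous_on_subset[OF c]) auto
    then have "isCont \<gamma> s" using s by (simp add: continuous_on_eq_continuous_at)
    from speed_eq[where i = i, OF i(1) dom[OF s(2)] this vs]
    show "speed M g \<gamma> s = sqrt (loc_metric i (chart_map M i (\<gamma> s)) (v s) (v s))"
      by (simp add: chart_inv_chart[OF i(1) dom[OF s(2)]])
  qed auto
qed

lemma piecewise_C1_curveE:
  assumes "piecewise_C1_curve M \<gamma>"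
  obtains S where "finite S" "continuous_on {0..1} \<gamma>" "\<gamma> ` {0..1} \<subseteq> points M"
    "\<And>a b. \<lbrakk>0 \<le> a; a < b; b \<le> 1; {a<..<b} \<inter> S = {}\<rbrakk> \<Longrightarrow> C1_arc M a b \<gamma>"
    "\<And>s i. \<lbrakk>s \<in> {0<..<1} - S; i \<in> idx M; \<gamma> s \<in> chart_dom M i\<rbrakk> \<Longrightarrow>
      isCont \<gamma> s \<and> (\<exists>v. ((chart_map M i \<circ> \<gamma>) has_vector_derivative v) (at s))"
proof -
  obtain S where S: "finite S" "continuous_on {0..1} \<gamma>" "\<gamma> ` {0..1} \<subseteq> points M"
    "\<And>a b. \<lbrakk>0 \<le> a; a < b; b \<le> 1; {a<..<b} \<inter> S = {}\<rbrakk> \<Longrightarrow> C1_arc M a b \<gamma>"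
    using assms unfolding piecewise_C1_curve_def by blast
  have "isCont \<gamma> s \<and> (\<exists>v. ((chart_map M i \<circ> \<gamma>) has_vector_derivative v) (at s))"
    if s: "s \<in> {0<..<1} - S" and i: "i \<in> idx M" "\<gamma> s \<in> chart_dom M i" for s i
  proof
    have "continuous_on {0<..<1} \<gamma>" by (rule continuous_on_subset[OF S(2)]) auto
    then show "isCont \<gamma> s" using s by (simp add: continuous_on_eq_continuous_at)
    have "open ({0<..<1} - S)" using S(1) by (intro open_Diff finite_imp_closed) auto
    then obtain e where e: "e > 0" "cball s e \<subseteq> {0<..<1} - S" using s open_contains_cball by blast
    then have sub: "{s - e..s + e} \<subseteq> {0<..<1} - S" by (simp add: cball_eq_atLeastAtMost)
    have "s - e \<in> {0<..<1}" "s + e \<in> {0<..<1}" using sub e(1) by (auto simp: subset_iff)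
    moreover have "{s - e<..<s + e} \<subseteq> {s - e..s + e}" by auto
    with sub have "{s - e<..<s + e} \<inter> S = {}" by blast
    ultimately have "C1_arc M (s - e) (s + e) \<gamma>" using e by (intro S(4)) auto
    then show "\<exists>v. ((chart_map M i \<circ> \<gamma>) has_vector_derivative v) (at s)"
      using e i by (intro C1_arc_derivative) auto
  qed
  with S that show ?thesis by blast
qed

text \<open>Integrability on a compact interval follows from integrability on all sufficiently small
  subintervals around each point. Such a subinterval stays in one chart and contains no break point
  except possibly its centre \<open>x\<close>, so it is split at \<open>x\<close> into two
  arcs.\<close>

lemma speed_integrable:
  assumes "piecewise_C1_curve M \<gamma>"
  shows "speed M g \<gamma> integrable_on {0..1}"
proof -
  obtain S where S: "finite S" "continuous_on {0..1} \<gamma>" "\<gamma> ` {0..1} \<subseteq> points M"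
    "\<And>a b. \<lbrakk>0 \<le> a; a < b; b \<le> 1; {a<..<b} \<inter> S = {}\<rbrakk> \<Longrightarrow> C1_arc M a b \<gamma>"
    using assms by (rule piecewise_C1_curveE) blast
  have "speed M g \<gamma> integrable_on cbox 0 1"
  proof (rule integrable_on_little_subintervals, intro ballI)
    fix x :: real assume "x \<in> cbox 0 1"
    then have x: "x \<in> {0..1}" by simp
    then have "\<gamma> x \<in> points M" using S(3) by blast
    then obtain i where i: "i \<in> idx M" "\<gamma> x \<in> chart_dom M i" by (auto simp: points_def)
    obtain A where A: "open A" "A \<inter> {0..1} = \<gamma> -` chart_dom M i \<inter> {0..1}"
      using S(2) open_chart_dom[OF i(1)] unfolding continuous_on_open_invariant by metis
    have "open (A - (S - {x}))" using S(1) A by (intro open_Diff finite_imp_closed) auto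
    moreover have "x \<in> A - (S - {x})" using A(2) x i(2) by blast
    ultimately obtain d where d: "d > 0" "ball x d \<subseteq> A - (S - {x})" using open_contains_ball by blast
    have "speed M g \<gamma> integrable_on {u..v}"
      if uv: "u \<le> x" "x \<le> v" "{u..v} \<subseteq> ball x d" "{u..v} \<subseteq> {0..1}" for u v
    proof -
      have one: "speed M g \<gamma> integrable_on {p..q}" if pq: "{p..q} \<subseteq> {u..v}" "p \<le> q" "x \<notin> {p<..<q}" for p q
      proof (cases "p = q")
        case False
        have pq': "p \<in> {u..v}" "q \<in> {u..v}" using pq by auto
        have sub: "{p..q} \<subseteq> ball x d" using pq uv by blast
        moreover have "{p<..<q} \<subseteq> {p..q}" by auto
        ultimately have "{p<..<q} \<inter> S = {}" using d(2) pq(3) by blast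
        then have "C1_arc M p q \<gamma>" using False pq pq' uv(4) by (intro S(4)) auto
        moreover have "\<gamma> ` {p..q} \<subseteq> chart_dom M i"
        proof
          fix y assume "y \<in> \<gamma> ` {p..q}"
          then obtain t where t: "t \<in> {p..q}" "y = \<gamma> t" by blast
          have "t \<in> A \<inter> {0..1}" using t(1) sub d(2) pq(1) uv(4) by blast
          then show "y \<in> chart_dom M i" unfolding A(2) t(2) by simp
        qed
        moreover have "continuous_on {p..q} \<gamma>" using S(2) by (rule continuous_on_subset) (rule order_trans[OF pq(1) uv(4)])
        ultimately show ?thesis using speed_integrable_arc[OF _ i(1)] by simp
      qed (use integrable_on_refl[of "speed M g \<gamma>" q] in simp)
      have "speed M g \<gamma> integrable_on {u..x}" "speed M g \<gamma> integrable_on {x..v}"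
        using uv(1,2) by (simp_all add: one)
      then show ?thesis by (rule Henstock_Kurzweil_Integration.integrable_combine[OF uv(1,2)])
    qed
    with d(1) show "\<exists>d>0. \<forall>u v. x \<in> cbox u v \<and> cbox u v \<subseteq> ball x d \<and> cbox u v \<subseteq> cbox 0 1 \<longrightarrow>
        speed M g \<gamma> integrable_on cbox u v"
      by (intro exI[of _ d]) auto
  qed
  then show ?thesis by simp
qed

lemma curve_length_nonneg:
  assumes "piecewise_C1_curve M \<gamma>"
  shows "curve_length M g \<gamma> \<ge> 0"
  unfolding curve_length_def using speed_integrable[OF assms] assms
  by (intro integral_nonneg speed_nonneg) (auto simp: piecewise_C1_curve_def)

text \<open>A curve that ends outside the chart ball meets its boundary, and up to the first such time its
  speed dominates \<open>m\<close> times the Euclidean speed in the chart.\<close>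

lemma curve_length_lower_bound:
  assumes \<gamma>: "piecewise_C1_curve M \<gamma>" "\<gamma> 0 = p" and i: "i \<in> idx M" "p \<in> chart_dom M i"
    and r: "r > 0" "m > 0" "cball (chart_map M i p) r \<subseteq> chart_image i"
    and m: "\<And>z u. z \<in> cball (chart_map M i p) r \<Longrightarrow> m * norm u \<le> sqrt (loc_metric i z u u)"
    and out: "\<gamma> 1 \<notin> chart_inv M i ` ball (chart_map M i p) r"
  shows "m * r \<le> curve_length M g \<gamma>"
proof -
  obtain S where S: "finite S" "continuous_on {0..1} \<gamma>" "\<gamma> ` {0..1} \<subseteq> points M"
    and der: "\<And>s i. \<lbrakk>s \<in> {0<..<1} - S; i \<in> idx M; \<gamma> s \<in> chart_dom M i\<rbrakk> \<Longrightarrow>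
      isCont \<gamma> s \<and> (\<exists>v. ((chart_map M i \<circ> \<gamma>) has_vector_derivative v) (at s))"
    using \<gamma>(1) by (rule piecewise_C1_curveE) blast
  let ?p = "chart_map M i p"
  define W where "W = chart_inv M i ` ball ?p r"
  define K where "K = chart_inv M i ` cball ?p r"
  have ballsub: "ball ?p r \<subseteq> chart_image i" using r(3) ball_subset_cball by blast
  have W: "W = chart_dom M i \<inter> chart_map M i -` ball ?p r"
  proof
    show "W \<subseteq> chart_dom M i \<inter> chart_map M i -` ball ?p r"
      using ballsub by (auto simp: W_def chart_chart_inv[OF i(1)] subset_iff)
    show "chart_dom M i \<inter> chart_map M i -` ball ?p r \<subseteq> W"
      unfolding W_def using chart_inv_chart[OF i(1)] by (auto intro: rev_image_eqI)
  qed
  have "open W" unfolding W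
    by (rule continuous_open_preimage[OF homeomorphism_cont1[OF homeomorphism_chart[OF i(1)]] open_chart_dom[OF i(1)]]) simp
  \<comment> \<open>Hausdorffness makes the compact set \<open>K\<close> closed in the whole
    manifold, so a curve that has stayed in the chart ball up to some time is still within the chart
    domain at that time.\<close>
  have "compact K" unfolding K_def
    by (rule compact_continuous_image[OF continuous_on_subset[OF homeomorphism_cont2[OF homeomorphism_chart[OF i(1)]] r(3)]]) simp
  then have "closed K" by (rule compact_imp_closed)
  have WK: "W \<subseteq> K" by (auto simp: W_def K_def)
  define T where "T = {0..1} \<inter> \<gamma> -` (- W)"
  have "closed T" unfolding T_def using S(2) \<open>open W\<close> by (intro continuous_closed_preimage) auto
  then have T: "compact T" by (metis T_def bounded_Int bounded_closed_interval compact_eq_bounded_closed cbox_interval bounded_cbox)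
  have "1 \<in> T" using out by (simp add: T_def W_def)
  then obtain s1 where s1: "s1 \<in> T" "\<And>s. s \<in> T \<Longrightarrow> s1 \<le> s"
    using compact_attains_inf[OF T] by blast
  have s1': "s1 \<in> {0..1}" "\<gamma> s1 \<notin> W" using s1(1) by (auto simp: T_def)
  have inW: "\<gamma> s \<in> W" if "0 \<le> s" "s < s1" for s
    using s1(2)[of s] that s1' by (force simp: T_def)
  have "\<gamma> 0 \<in> W" using \<gamma>(2) i r by (simp add: W)
  then have s1pos: "s1 > 0" using s1' by (cases "s1 = 0") auto
  have c1: "continuous_on {0..s1} \<gamma>" using S(2) by (rule continuous_on_subset) (use s1' in auto)
  have "\<gamma> ` closure {0..<s1} \<subseteq> K"
    using s1pos c1 inW WK by (intro image_closure_subset \<open>closed K\<close>) auto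
  then have inK: "\<gamma> s \<in> K" if "s \<in> {0..s1}" for s using that s1pos by auto
  have Kd: "K \<subseteq> chart_dom M i" using r(3) by (auto simp: K_def chart_chart_inv[OF i(1)] subset_iff)
  have Kb: "chart_map M i q \<in> cball ?p r" if "q \<in> K" for q
    using that r(3) by (auto simp: K_def chart_chart_inv[OF i(1)] subset_iff)
  let ?z = "chart_map M i \<circ> \<gamma>"
  have "\<not> dist ?p (?z s1) < r" using s1' Kd inK[of s1] s1pos by (auto simp: W)
  then have rz: "r \<le> norm (?z s1 - ?z 0)" using \<gamma>(2) by (simp add: dist_norm norm_minus_commute)
  have zc: "continuous_on {0..s1} ?z"
    unfolding o_def
    by (rule continuous_on_compose2[OF homeomorphism_cont1[OF homeomorphism_chart[OF i(1)]] c1]) (use inK Kd in auto)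
  define v where "v s = vector_derivative ?z (at s)" for s
  have vd: "(?z has_vector_derivative v s) (at s)" "speed M g \<gamma> s = sqrt (g i (\<gamma> s) (v s) (v s))" if "s \<in> {0<..<s1} - S" for s
  proof -
    have d: "\<gamma> s \<in> chart_dom M i" using inK[of s] Kd that by auto
    have *: "isCont \<gamma> s" "\<exists>v. (?z has_vector_derivative v) (at s)" using der[of s i] that s1' i(1) d by auto
    then show vs: "(?z has_vector_derivative v s) (at s)" unfolding v_def by (metis vector_derivative_at)
    show "speed M g \<gamma> s = sqrt (g i (\<gamma> s) (v s) (v s))" by (rule speed_eq[OF i(1) d *(1) vs])
  qed
  have int: "(v has_integral (?z s1 - ?z 0)) {0..s1}"
    by (rule fundamental_theorem_of_calculus_interior_strong[OF S(1) _ vd(1) zc]) (use s1pos in auto)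
  \<comment> \<open>At the exceptional times \<open>v\<close> carries no information; setting it to
    0 there makes the pointwise comparison with the speed valid everywhere.\<close>
  define v' where "v' s = (if s \<in> {0<..<s1} - S then v s else 0)" for s
  have int': "(v' has_integral (?z s1 - ?z 0)) {0..s1}"
    by (rule has_integral_spike_finite[OF _ _ int, of "S \<union> {0, s1}"]) (use S(1) in \<open>auto simp: v'_def\<close>)
  have sint: "speed M g \<gamma> integrable_on {0..s1}"
    by (rule integrable_on_subinterval[OF speed_integrable[OF \<gamma>(1)]]) (use s1' in auto)
  have spos: "speed M g \<gamma> s \<ge> 0" if "s \<in> {0..1}" for s using that S(3) by (intro speed_nonneg) auto
  have "norm (integral {0..s1} v') \<le> integral {0..s1} (\<lambda>s. speed M g \<gamma> s / m)"
  proof (rule integral_norm_bound_integral)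
    show "v' integrable_on {0..s1}" using int' by blast
    show "(\<lambda>s. speed M g \<gamma> s / m) integrable_on {0..s1}" using sint by (rule integrable_on_divide)
    fix s assume s: "s \<in> {0..s1}"
    show "norm (v' s) \<le> speed M g \<gamma> s / m"
    proof (cases "s \<in> {0<..<s1} - S")
      case True
      have "m * norm (v s) \<le> sqrt (loc_metric i (chart_map M i (\<gamma> s)) (v s) (v s))"
        by (rule m[OF Kb[OF inK[OF s]]])
      also have "\<dots> = speed M g \<gamma> s"
        using vd(2)[OF True] chart_inv_chart[OF i(1), of "\<gamma> s"] Kd inK[OF s] by auto
      finally show ?thesis using True r(2) by (simp add: v'_def pos_le_divide_eq mult.commute)
    next
      case False
      then show ?thesis unfolding v'_def using spos[of s] s s1' r(2) by auto
    qed
  qed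
  then have "r \<le> integral {0..s1} (speed M g \<gamma>) / m" using rz integral_unique[OF int'] by simp
  then have "m * r \<le> integral {0..s1} (speed M g \<gamma>)" using r(2) by (simp add: pos_le_divide_eq mult.commute)
  also have "\<dots> \<le> curve_length M g \<gamma>"
    unfolding curve_length_def
    by (rule integral_subset_le[OF _ sint speed_integrable[OF \<gamma>(1)]]) (use s1' spos in auto)
  finally show ?thesis .
qed

end


section \<open>Operations on curves and the metric space axioms\<close>

context riemannian_atlas
begin

text \<open>Change of variables for the length. The form of \<open>img\<close> is that of the
  interval produced by \<open>has_integral_affinity\<close>, and agreement on the open interval
  suffices, as single times do not affect an integral.\<close>

lemma curve_length_affine:
  assumes \<gamma>: "piecewise_C1_curve M \<gamma>" and \<alpha>: "\<alpha> \<noteq> 0"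
    and img: "(\<lambda>s. (1 / \<alpha>) *\<^sub>R s + - ((1 / \<alpha>) *\<^sub>R \<beta>)) ` {0..1} = {a..b}"
    and eq: "\<And>s. s \<in> {a<..<b} \<Longrightarrow> \<eta> s = \<gamma> (\<alpha> * s + \<beta>)"
  shows "(speed M g \<eta> has_integral curve_length M g \<gamma>) {a..b}"
proof -
  obtain S where S: "finite S" "continuous_on {0..1} \<gamma>" "\<gamma> ` {0..1} \<subseteq> points M"
    and der: "\<And>s i. \<lbrakk>s \<in> {0<..<1} - S; i \<in> idx M; \<gamma> s \<in> chart_dom M i\<rbrakk> \<Longrightarrow>
      isCont \<gamma> s \<and> (\<exists>v. ((chart_map M i \<circ> \<gamma>) has_vector_derivative v) (at s))"
    using \<gamma> by (rule piecewise_C1_curveE) blast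
  have "(speed M g \<gamma> has_integral curve_length M g \<gamma>) (cbox 0 1)"
    using speed_integrable[OF \<gamma>] by (simp add: curve_length_def integrable_integral)
  from has_integral_affinity[OF this \<alpha>, of \<beta>]
  have "((\<lambda>s. speed M g \<gamma> (\<alpha> * s + \<beta>)) has_integral (1 / \<bar>\<alpha>\<bar>) * curve_length M g \<gamma>) {a..b}"
    using img by simp
  from has_integral_mult_right[OF this, of "\<bar>\<alpha>\<bar>"]
  have "((\<lambda>s. \<bar>\<alpha>\<bar> * speed M g \<gamma> (\<alpha> * s + \<beta>)) has_integral curve_length M g \<gamma>) {a..b}"
    using \<alpha> by simp
  then show ?thesis
  proof (rule has_integral_spike_finite[rotated 2])
    \<comment> \<open>The ends and the preimages of 0, 1 and the break points, where
      \<open>speed_affine\<close> would lack a two-sided derivative of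
      \<open>\<gamma>\<close>.\<close>
    let ?E = "{a, b, (0 - \<beta>) / \<alpha>, (1 - \<beta>) / \<alpha>} \<union> (\<lambda>s. (s - \<beta>) / \<alpha>) ` S"
    show "finite ?E" using S(1) by simp
    fix s assume s: "s \<in> {a..b} - ?E"
    then have sab: "s \<in> {a<..<b}" by auto
    obtain t where t: "t \<in> {0..1}" "s = (1 / \<alpha>) *\<^sub>R t + - ((1 / \<alpha>) *\<^sub>R \<beta>)"
      using s img by (metis (no_types, lifting) DiffD1 imageE)
    have ts: "\<alpha> * s + \<beta> = t" "s = (t - \<beta>) / \<alpha>" using t(2) \<alpha> by (simp_all add: field_simps)
    have "t \<noteq> 0" "t \<noteq> 1" "t \<notin> S" using s ts(2) by auto
    then have t': "t \<in> {0<..<1} - S" using t(1) by auto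
    show "speed M g \<eta> s = \<bar>\<alpha>\<bar> * speed M g \<gamma> (\<alpha> * s + \<beta>)"
    proof (rule speed_affine[where T = "{a<..<b}", OF _ sab])
      show "\<gamma> (\<alpha> * s + \<beta>) \<in> points M" using S(3) t(1) ts(1) by auto
      show "\<exists>v. ((chart_map M i \<circ> \<gamma>) has_vector_derivative v) (at (\<alpha> * s + \<beta>))"
        if "i \<in> idx M" "\<gamma> (\<alpha> * s + \<beta>) \<in> chart_dom M i" for i
        using der[OF t' that(1)] that(2) ts(1) by simp
    qed (use metric_bilinear eq in auto)
  qed
qed

lemma piecewise_C1_curve_const:
  assumes "p \<in> points M"
  shows "piecewise_C1_curve M (\<lambda>_. p)" "curve_length M g (\<lambda>_. p) = 0"
proof -
  have "C1_arc M a b (\<lambda>_. p)" for a b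
    unfolding C1_arc_def o_def by (intro ballI exI[of _ "\<lambda>_. 0"]) simp
  then show "piecewise_C1_curve M (\<lambda>_. p)"
    unfolding piecewise_C1_curve_def using assms by (intro conjI exI[of _ "{}"]) auto
  have "speed M g (\<lambda>_. p) s = 0" for s
  proof -
    obtain i where i: "i \<in> idx M" "p \<in> chart_dom M i" using assms by (auto simp: points_def)
    have "((chart_map M i \<circ> (\<lambda>_. p)) has_vector_derivative 0) (at s)" by (simp add: o_def)
    from speed_eq[OF i(1) _ _ this] i show ?thesis
      by (simp add: bilinear_rzero[OF metric_bilinear])
  qed
  then have "speed M g (\<lambda>_. p) = (\<lambda>_. 0)" by (rule ext)
  then show "curve_length M g (\<lambda>_. p) = 0" by (simp add: curve_length_def)
qed

lemma piecewise_C1_curve_reverse: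
  assumes \<gamma>: "piecewise_C1_curve M \<gamma>"
  shows "piecewise_C1_curve M (\<lambda>s. \<gamma> (1 - s))" "curve_length M g (\<lambda>s. \<gamma> (1 - s)) = curve_length M g \<gamma>"
proof -
  obtain S where S: "finite S" "continuous_on {0..1} \<gamma>" "\<gamma> ` {0..1} \<subseteq> points M"
    "\<And>a b. \<lbrakk>0 \<le> a; a < b; b \<le> 1; {a<..<b} \<inter> S = {}\<rbrakk> \<Longrightarrow> C1_arc M a b \<gamma>"
    using \<gamma> by (rule piecewise_C1_curveE) blast
  show "piecewise_C1_curve M (\<lambda>s. \<gamma> (1 - s))"
    unfolding piecewise_C1_curve_def
  proof (intro conjI exI[of _ "(\<lambda>s. 1 - s) ` S"] allI impI)
    show "continuous_on {0..1} (\<lambda>s. \<gamma> (1 - s))"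
      by (rule continuous_on_compose2[OF S(2)]) (auto intro!: continuous_intros)
    show "(\<lambda>s. \<gamma> (1 - s)) ` {0..1} \<subseteq> points M" using S(3) by auto
    show "finite ((\<lambda>s. 1 - s) ` S)" using S(1) by simp
    fix a b :: real assume ab: "0 \<le> a \<and> a < b \<and> b \<le> 1 \<and> {a<..<b} \<inter> (\<lambda>s. 1 - s) ` S = {}"
    have "{1 - b<..<1 - a} \<inter> S = {}"
    proof -
      have "False" if "x \<in> {1 - b<..<1 - a}" "x \<in> S" for x
      proof -
        have "1 - x \<in> {a<..<b}" using that by auto
        then show False using ab that(2) by blast
      qed
      then show ?thesis by blast
    qed
    then have "C1_arc M (1 - b) (1 - a) \<gamma>" using ab by (intro S(4)) auto
    then show "C1_arc M a b (\<lambda>s. \<gamma> (1 - s))"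
      by (rule C1_arc_affine[where \<alpha> = "-1" and \<beta> = 1]) auto
  qed
  have "(speed M g (\<lambda>s. \<gamma> (1 - s)) has_integral curve_length M g \<gamma>) {0..1}"
  proof (rule curve_length_affine[OF \<gamma>, where \<alpha> = "-1" and \<beta> = 1])
    show "(\<lambda>s. (1 / - 1) *\<^sub>R s + - ((1 / - 1) *\<^sub>R 1)) ` {0..1} = {0..1::real}"
      by (auto simp: image_iff intro!: bexI[of _ "1 - _"])
  qed auto
  then show "curve_length M g (\<lambda>s. \<gamma> (1 - s)) = curve_length M g \<gamma>"
    unfolding curve_length_def by (rule integral_unique)
qed

lemma piecewise_C1_curve_join:
  assumes \<gamma>: "piecewise_C1_curve M \<gamma>" and \<delta>: "piecewise_C1_curve M \<delta>" and e: "\<gamma> 1 = \<delta> 0"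
  shows "piecewise_C1_curve M (\<gamma> +++ \<delta>)"
    "curve_length M g (\<gamma> +++ \<delta>) = curve_length M g \<gamma> + curve_length M g \<delta>"
proof -
  obtain S where S: "finite S" "continuous_on {0..1} \<gamma>" "\<gamma> ` {0..1} \<subseteq> points M"
    "\<And>a b. \<lbrakk>0 \<le> a; a < b; b \<le> 1; {a<..<b} \<inter> S = {}\<rbrakk> \<Longrightarrow> C1_arc M a b \<gamma>"
    using \<gamma> by (rule piecewise_C1_curveE) blast
  obtain R where R: "finite R" "continuous_on {0..1} \<delta>" "\<delta> ` {0..1} \<subseteq> points M"
    "\<And>a b. \<lbrakk>0 \<le> a; a < b; b \<le> 1; {a<..<b} \<inter> R = {}\<rbrakk> \<Longrightarrow> C1_arc M a b \<delta>"
    using \<delta> by (rule piecewise_C1_curveE) blast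
  have J1: "(\<gamma> +++ \<delta>) s = \<gamma> (2 * s)" if "s \<le> 1/2" for s using that by (simp add: joinpaths_def)
  have J2: "(\<gamma> +++ \<delta>) s = \<delta> (2 * s - 1)" if "s \<ge> 1/2" for s
  proof (cases "s = 1/2")
    case True
    show ?thesis unfolding True using e by (simp add: joinpaths_def)
  qed (use that in \<open>simp add: joinpaths_def\<close>)
  show "piecewise_C1_curve M (\<gamma> +++ \<delta>)"
    unfolding piecewise_C1_curve_def
  proof (intro conjI exI[of _ "insert (1/2) ((\<lambda>s. s / 2) ` S \<union> (\<lambda>s. (s + 1) / 2) ` R)"] allI impI)
    show "continuous_on {0..1} (\<gamma> +++ \<delta>)"
      using path_join_imp[of \<gamma> \<delta>] S(2) R(2) e by (simp add: path_def pathstart_def pathfinish_def)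
    show "(\<gamma> +++ \<delta>) ` {0..1} \<subseteq> points M"
      using path_image_join_subset[of \<gamma> \<delta>] S(3) R(3) by (auto simp: path_image_def)
    show "finite (insert (1/2) ((\<lambda>s. s / 2) ` S \<union> (\<lambda>s. (s + 1) / 2) ` R))" using S(1) R(1) by simp
    fix a b :: real
    assume ab: "0 \<le> a \<and> a < b \<and> b \<le> 1 \<and>
      {a<..<b} \<inter> insert (1/2) ((\<lambda>s. s / 2) ` S \<union> (\<lambda>s. (s + 1) / 2) ` R) = {}"
    then have ab': "0 \<le> a" "a < b" "b \<le> 1" and "1/2 \<notin> {a<..<b}"
      and dS: "{a<..<b} \<inter> (\<lambda>s. s / 2) ` S = {}" and dR: "{a<..<b} \<inter> (\<lambda>s. (s + 1) / 2) ` R = {}" by blast+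
    then consider "b \<le> 1/2" | "1/2 \<le> a" unfolding greaterThanLessThan_iff by linarith
    then show "C1_arc M a b (\<gamma> +++ \<delta>)"
    proof cases
      case 1
      have "False" if "x \<in> {2 * a<..<2 * b}" "x \<in> S" for x
      proof -
        have "x / 2 \<in> {a<..<b}" using that by auto
        then show False using dS that(2) by blast
      qed
      then have "{2 * a<..<2 * b} \<inter> S = {}" by blast
      then have "C1_arc M (2 * a) (2 * b) \<gamma>" using ab' 1 by (intro S(4)) auto
      then show ?thesis
        by (rule C1_arc_affine[where \<alpha> = 2 and \<beta> = 0]) (use J1 1 in auto)
    next
      case 2
      have "False" if "x \<in> {2 * a - 1<..<2 * b - 1}" "x \<in> R" for x
      proof -
        have "(x + 1) / 2 \<in> {a<..<b}" using that by auto
        then show False using dR that(2) by blast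
      qed
      then have "{2 * a - 1<..<2 * b - 1} \<inter> R = {}" by blast
      then have "C1_arc M (2 * a - 1) (2 * b - 1) \<delta>" using ab' 2 by (intro R(4)) auto
      then show ?thesis
        by (rule C1_arc_affine[where \<alpha> = 2 and \<beta> = "-1"]) (use J2 2 in auto)
    qed
  qed
  have "(speed M g (\<gamma> +++ \<delta>) has_integral curve_length M g \<gamma>) {0..1/2}"
  proof (rule curve_length_affine[OF \<gamma>, where \<alpha> = 2 and \<beta> = 0])
    show "(\<lambda>s. (1 / 2) *\<^sub>R s + - ((1 / 2) *\<^sub>R 0)) ` {0..1} = {0..1/2::real}"
      by (auto simp: image_iff intro!: bexI[of _ "2 * _"])
  qed (use J1 in auto)
  moreover have "(speed M g (\<gamma> +++ \<delta>) has_integral curve_length M g \<delta>) {1/2..1}"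
  proof (rule curve_length_affine[OF \<delta>, where \<alpha> = 2 and \<beta> = "-1"])
    show "(\<lambda>s. (1 / 2) *\<^sub>R s + - ((1 / 2) *\<^sub>R - 1)) ` {0..1} = {1/2..1::real}"
      by (auto simp: image_iff field_simps intro!: bexI[of _ "2 * _ - 1"])
  qed (use J2 in auto)
  ultimately have "(speed M g (\<gamma> +++ \<delta>) has_integral curve_length M g \<gamma> + curve_length M g \<delta>) {0..1}"
    by (rule has_integral_combine[rotated 2]) auto
  then show "curve_length M g (\<gamma> +++ \<delta>) = curve_length M g \<gamma> + curve_length M g \<delta>"
    unfolding curve_length_def[of M g "\<gamma> +++ \<delta>"] by (rule integral_unique)
qed

text \<open>A straight segment in one chart has constant velocity \<open>w\<close> there. In another
  chart its velocity is \<open>Dtrans i j (l s) w\<close>, which is continuous in \<open>s\<close>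
  because the transition map has a second derivative.\<close>

lemma piecewise_C1_curve_segment:
  assumes i: "i \<in> idx M" "p \<in> chart_dom M i" and r: "ball (chart_map M i p) r \<subseteq> chart_image i"
    and z: "z \<in> ball (chart_map M i p) r"
  shows "piecewise_C1_curve M (\<lambda>s. chart_inv M i (chart_map M i p + s *\<^sub>R (z - chart_map M i p)))"
proof -
  let ?p = "chart_map M i p"
  define w where "w = z - ?p"
  define l where "l s = ?p + s *\<^sub>R w" for s
  define \<gamma> where "\<gamma> s = chart_inv M i (l s)" for s
  have lb: "l s \<in> ball ?p r" if "s \<in> {0..1}" for s
  proof -
    have "norm (s *\<^sub>R w) \<le> norm w" using that by (simp add: mult_left_le_one_le)
    also have "\<dots> < r" using z by (simp add: w_def dist_norm norm_minus_commute)
    finally show ?thesis by (simp add: l_def dist_norm)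
  qed
  then have lU: "l s \<in> chart_image i" if "s \<in> {0..1}" for s using r that by blast
  have lc: "isCont l s" for s unfolding l_def by (intro continuous_intros)
  have ld: "(l has_vector_derivative w) (at s)" for s
    unfolding l_def by (auto intro!: derivative_eq_intros)
  have \<gamma>c: "isCont \<gamma> s" if "s \<in> {0..1}" for s
    unfolding \<gamma>_def by (rule isCont_o2[OF lc isCont_chart_inv[OF i(1) lU[OF that]]])
  have \<gamma>d: "\<gamma> s \<in> chart_dom M i" "chart_map M i (\<gamma> s) = l s" if "s \<in> {0..1}" for s
    using chart_chart_inv[OF i(1) lU[OF that]] by (simp_all add: \<gamma>_def)
  have der: "((chart_map M i \<circ> \<gamma>) has_vector_derivative w) (at s)" if s: "s \<in> {0..1}" for s
  proof -
    obtain T where T: "open T" "s \<in> T" "\<And>t. t \<in> T \<Longrightarrow> l t \<in> chart_image i"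
      by (rule isCont_open_nbhd[OF lc open_chart_image[OF i(1)] lU[OF s]]) blast
    show ?thesis
      by (rule has_vector_derivative_transform_within_open[OF ld T(1,2)])
        (use chart_chart_inv[OF i(1) T(3)] in \<open>simp add: \<gamma>_def\<close>)
  qed
  have arc: "C1_arc M a b \<gamma>" if ab: "0 \<le> a" "b \<le> 1" for a b
    unfolding C1_arc_def
  proof (intro ballI exI conjI impI)
    fix j assume j: "j \<in> idx M"
    let ?V = "\<lambda>s. Dtrans i j (l s) w"
    show "continuous_on {s \<in> {a..b}. \<gamma> s \<in> chart_dom M j} ?V"
    proof (intro continuous_at_imp_continuous_on ballI)
      fix s assume "s \<in> {s \<in> {a..b}. \<gamma> s \<in> chart_dom M j}"
      then have s: "s \<in> {0..1}" "\<gamma> s \<in> chart_dom M j" using ab by auto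
      have "l s \<in> chart_map M i ` (chart_dom M i \<inter> chart_dom M j)"
        using \<gamma>d[OF s(1)] s(2) by (metis IntI imageI)
      from transition_second_derivative[OF i(1) j this]
      obtain Q where "\<And>u. ((\<lambda>y. Dtrans i j y u) has_derivative (\<lambda>h. Q h u)) (at (l s))" by blast
      then have "isCont (\<lambda>y. Dtrans i j y w) (l s)" by (rule has_derivative_continuous)
      from isCont_o2[OF lc this] show "isCont ?V s" .
    qed
    fix s assume "s \<in> {a..b}" and s: "\<gamma> s \<in> chart_dom M j"
    then have s1: "s \<in> {0..1}" using ab by auto
    have "((chart_map M j \<circ> \<gamma>) has_vector_derivative ?V s) (at s)"
      using vel_transition[OF i(1) j \<gamma>c[OF s1] \<gamma>d(1)[OF s1] s der[OF s1]] \<gamma>d(2)[OF s1] by simp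
    then show "((chart_map M j \<circ> \<gamma>) has_vector_derivative ?V s) (at s within {a..b})"
      by (rule has_vector_derivative_at_within)
  qed
  have "piecewise_C1_curve M \<gamma>"
    unfolding piecewise_C1_curve_def
  proof (intro conjI exI[of _ "{}"] allI impI)
    show "continuous_on {0..1} \<gamma>" using \<gamma>c by (intro continuous_at_imp_continuous_on) auto
    show "\<gamma> ` {0..1} \<subseteq> points M" using \<gamma>d(1) i(1) by (auto simp: points_def)
  qed (use arc in auto)
  then show ?thesis by (simp add: \<gamma>_def[abs_def] l_def w_def)
qed

text \<open>Being joined by such a curve is an equivalence relation whose classes are open, as chart
  balls are filled by segments; a connected manifold has one class. The infimum defining the
  distance thus ranges over a nonempty set.\<close>

lemma piecewise_C1_connected:
  assumes "p \<in> points M" "q \<in> points M"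
  shows "\<exists>\<gamma>. piecewise_C1_curve M \<gamma> \<and> \<gamma> 0 = p \<and> \<gamma> 1 = q"
proof (rule connected_equivalence_relation[OF connected_points assms])
  fix x y assume "\<exists>\<gamma>. piecewise_C1_curve M \<gamma> \<and> \<gamma> 0 = x \<and> \<gamma> 1 = y"
  then obtain \<gamma> where "piecewise_C1_curve M \<gamma>" "\<gamma> 0 = x" "\<gamma> 1 = y" by blast
  then show "\<exists>\<gamma>. piecewise_C1_curve M \<gamma> \<and> \<gamma> 0 = y \<and> \<gamma> 1 = x"
    using piecewise_C1_curve_reverse(1) by (intro exI[of _ "\<lambda>s. \<gamma> (1 - s)"]) simp
next
  fix x y z assume "\<exists>\<gamma>. piecewise_C1_curve M \<gamma> \<and> \<gamma> 0 = x \<and> \<gamma> 1 = y" "\<exists>\<gamma>. piecewise_C1_curve M \<gamma> \<and> \<gamma> 0 = y \<and> \<gamma> 1 = z"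
  then obtain \<gamma> \<delta> where "piecewise_C1_curve M \<gamma>" "\<gamma> 0 = x" "\<gamma> 1 = y" "piecewise_C1_curve M \<delta>" "\<delta> 0 = y" "\<delta> 1 = z" by blast
  then show "\<exists>\<gamma>. piecewise_C1_curve M \<gamma> \<and> \<gamma> 0 = x \<and> \<gamma> 1 = z"
    using piecewise_C1_curve_join(1)[of \<gamma> \<delta>] by (intro exI[of _ "\<gamma> +++ \<delta>"]) (simp add: joinpaths_def)
next
  fix x assume "x \<in> points M"
  then obtain i where i: "i \<in> idx M" "x \<in> chart_dom M i" by (auto simp: points_def)
  have xi: "chart_map M i x \<in> chart_image i" using i by simp
  obtain r where r: "r > 0" "ball (chart_map M i x) r \<subseteq> chart_image i"
    using open_contains_ball open_chart_image[OF i(1)] xi by blast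
  let ?T = "chart_dom M i \<inter> chart_map M i -` ball (chart_map M i x) r"
  have "open ?T"
    by (rule continuous_open_preimage[OF homeomorphism_cont1[OF homeomorphism_chart[OF i(1)]] open_chart_dom[OF i(1)]]) simp
  moreover have "?T \<subseteq> points M" using i(1) by (auto simp: points_def)
  ultimately have "openin (top_of_set (points M)) ?T" by (intro open_subset)
  moreover have "\<exists>\<gamma>. piecewise_C1_curve M \<gamma> \<and> \<gamma> 0 = x \<and> \<gamma> 1 = y" if y: "y \<in> ?T" for y
    using piecewise_C1_curve_segment[OF i r(2), of "chart_map M i y"] y
    by (intro exI) (auto simp: chart_inv_chart i)
  ultimately show "\<exists>T. openin (top_of_set (points M)) T \<and> x \<in> T \<and>
      (\<forall>y\<in>T. \<exists>\<gamma>. piecewise_C1_curve M \<gamma> \<and> \<gamma> 0 = x \<and> \<gamma> 1 = y)"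
    using i r(1) by (intro exI[of _ ?T]) auto
qed

abbreviation "rdist \<equiv> riemannian_dist M g"

lemma riemannian_dist_le:
  assumes "piecewise_C1_curve M \<gamma>"
  shows "rdist (\<gamma> 0) (\<gamma> 1) \<le> curve_length M g \<gamma>"
proof -
  have "\<gamma> 0 \<in> points M" "\<gamma> 1 \<in> points M" using assms by (auto simp: piecewise_C1_curve_def)
  moreover have "Inf {curve_length M g \<eta> |\<eta>. piecewise_C1_curve M \<eta> \<and> \<eta> 0 = \<gamma> 0 \<and> \<eta> 1 = \<gamma> 1} \<le> curve_length M g \<gamma>"
    by (rule cInf_lower) (use assms curve_length_nonneg in \<open>auto intro!: bdd_belowI[of _ 0]\<close>)
  ultimately show ?thesis by (simp add: riemannian_dist_def)
qed

lemma riemannian_dist_geI: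
  assumes "p \<in> points M" "q \<in> points M"
    and "\<And>\<gamma>. \<lbrakk>piecewise_C1_curve M \<gamma>; \<gamma> 0 = p; \<gamma> 1 = q\<rbrakk> \<Longrightarrow> x \<le> curve_length M g \<gamma>"
  shows "x \<le> rdist p q"
proof -
  have "x \<le> Inf {curve_length M g \<gamma> |\<gamma>. piecewise_C1_curve M \<gamma> \<and> \<gamma> 0 = p \<and> \<gamma> 1 = q}"
    by (rule cInf_greatest) (use piecewise_C1_connected[OF assms(1,2)] assms(3) in auto)
  then show ?thesis using assms by (simp add: riemannian_dist_def)
qed

text \<open>A curve from \<open>p\<close> to a point outside \<open>W\<close> must leave a chart
  ball inside \<open>W\<close> and so has length at least \<open>m * s\<close>. This separates
  distinct points in the distance and turns convergence in the distance into convergence in the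
  ambient topology.\<close>

lemma riemannian_dist_nbhd:
  assumes p: "p \<in> points M" and W: "open W" "p \<in> W"
  shows "\<exists>d>0. \<forall>q\<in>points M. rdist p q < d \<longrightarrow> q \<in> W"
proof -
  obtain i where i: "i \<in> idx M" "p \<in> chart_dom M i" using p by (auto simp: points_def)
  let ?p = "chart_map M i p"
  obtain r m where r: "r > 0" "m > 0" "cball ?p r \<subseteq> chart_image i"
    "\<And>z u. z \<in> cball ?p r \<Longrightarrow> m * norm u \<le> sqrt (loc_metric i z u u)"
    by (rule metric_lower_bound[OF i]) blast
  have pi: "?p \<in> chart_image i" using i by simp
  have "chart_inv M i ?p \<in> W" using W chart_inv_chart[OF i] by simp
  then obtain T where T: "open T" "?p \<in> T" "\<And>z. z \<in> T \<Longrightarrow> chart_inv M i z \<in> W"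
    by (rule isCont_open_nbhd[OF isCont_chart_inv[OF i(1) pi] W(1)]) blast
  then obtain r' where r': "r' > 0" "ball ?p r' \<subseteq> T" using open_contains_ball by blast
  define s where "s = min r r'"
  have s: "s > 0" "cball ?p s \<subseteq> cball ?p r" "ball ?p s \<subseteq> T" using r r' by (auto simp: s_def)
  have "m * s \<le> rdist p q" if q: "q \<in> points M" "q \<notin> W" for q
  proof (rule riemannian_dist_geI[OF p q(1)])
    fix \<gamma> assume \<gamma>: "piecewise_C1_curve M \<gamma>" "\<gamma> 0 = p" "\<gamma> 1 = q"
    show "m * s \<le> curve_length M g \<gamma>"
    proof (rule curve_length_lower_bound[OF \<gamma>(1,2) i s(1) r(2)])
      show "cball ?p s \<subseteq> chart_image i" using s(2) r(3) by (rule order_trans)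
      show "m * norm u \<le> sqrt (loc_metric i z u u)" if "z \<in> cball ?p s" for z u
        using that s(2) by (intro r(4)) blast
      show "\<gamma> 1 \<notin> chart_inv M i ` ball ?p s" using q(2) T(3) s(3) \<gamma>(3) by auto
    qed
  qed
  then have "q \<in> W" if "q \<in> points M" "rdist p q < m * s" for q using that by force
  moreover have "m * s > 0" using r(2) s(1) by simp
  ultimately show ?thesis by blast
qed

lemma riemannian_dist_commute: "rdist p q = rdist q p"
proof (cases "p \<in> points M \<and> q \<in> points M")
  case True
  have "rdist x y \<le> rdist y x" if "x \<in> points M" "y \<in> points M" for x y
  proof (rule riemannian_dist_geI[OF that(2,1)])
    fix \<gamma> assume \<gamma>: "piecewise_C1_curve M \<gamma>" "\<gamma> 0 = y" "\<gamma> 1 = x"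
    show "rdist x y \<le> curve_length M g \<gamma>"
      using riemannian_dist_le[OF piecewise_C1_curve_reverse(1)[OF \<gamma>(1)]] piecewise_C1_curve_reverse(2)[OF \<gamma>(1)] \<gamma> by simp
  qed
  with True show ?thesis by (simp add: order_antisym)
qed (auto simp: riemannian_dist_def)

lemma riemannian_dist_nonneg: "0 \<le> rdist p q"
proof (cases "p \<in> points M \<and> q \<in> points M")
  case True
  then show ?thesis by (intro riemannian_dist_geI) (auto intro: curve_length_nonneg)
qed (auto simp: riemannian_dist_def)

text \<open>Lengths add under concatenation. The infimum is taken over the second curve with the
  first one fixed, and then over the first.\<close>

lemma riemannian_dist_triangle:
  assumes "p \<in> points M" "q \<in> points M" "s \<in> points M"
  shows "rdist p s \<le> rdist p q + rdist q s"
proof -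
  have "rdist p s - curve_length M g \<gamma> \<le> rdist q s" if \<gamma>: "piecewise_C1_curve M \<gamma>" "\<gamma> 0 = p" "\<gamma> 1 = q" for \<gamma>
  proof (rule riemannian_dist_geI[OF assms(2,3)])
    fix \<delta> assume \<delta>: "piecewise_C1_curve M \<delta>" "\<delta> 0 = q" "\<delta> 1 = s"
    have e: "\<gamma> 1 = \<delta> 0" using \<gamma> \<delta> by simp
    have "rdist p s \<le> curve_length M g \<gamma> + curve_length M g \<delta>"
      using riemannian_dist_le[OF piecewise_C1_curve_join(1)[OF \<gamma>(1) \<delta>(1) e]] piecewise_C1_curve_join(2)[OF \<gamma>(1) \<delta>(1) e] \<gamma> \<delta>
      by (simp add: joinpaths_def)
    then show "rdist p s - curve_length M g \<gamma> \<le> curve_length M g \<delta>" by simp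
  qed
  then have "rdist p s - rdist q s \<le> rdist p q"
    by (intro riemannian_dist_geI assms) (simp add: algebra_simps)
  then show ?thesis by simp
qed

lemma Metric_space_riemannian_dist: "Metric_space (points M) rdist"
proof
  fix p q assume pq: "p \<in> points M" "q \<in> points M"
  show "(rdist p q = 0) = (p = q)"
  proof
    assume "p = q"
    then have "rdist p q \<le> 0"
      using riemannian_dist_le[OF piecewise_C1_curve_const(1)[OF pq(1)]] piecewise_C1_curve_const(2)[OF pq(1)] by simp
    then show "rdist p q = 0" using riemannian_dist_nonneg[of p q] by simp
  next
    assume 0: "rdist p q = 0"
    show "p = q"
    proof (rule ccontr)
      assume "p \<noteq> q"
      then obtain W where W: "open W" "p \<in> W" "q \<notin> W" using t1_space by blast
      from riemannian_dist_nbhd[OF pq(1) W(1,2)] 0 pq(2) W(3) show False by auto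
    qed
  qed
qed (use riemannian_dist_nonneg riemannian_dist_commute riemannian_dist_triangle in auto)

text \<open>The distance is defined by curves on the unit interval, so the arc is rescaled to it;
  the bound on its speed then bounds the length integral.\<close>

lemma riemannian_dist_le_speed:
  assumes C: "C1_arc M a b x" and ab: "a < b" and c: "continuous_on {a..b} x" "x ` {a..b} \<subseteq> points M"
    and L: "L \<ge> 0" "\<And>t. t \<in> {a<..<b} \<Longrightarrow> speed M g x t \<le> L"
  shows "rdist (x a) (x b) \<le> L * (b - a)"
proof -
  define \<gamma> where "\<gamma> r = x ((b - a) * r + a)" for r
  have \<theta>: "(b - a) * r + a \<in> {a..b}" if "r \<in> {0..1}" for r
  proof -
    have "(b - a) * r \<le> (b - a) * 1" "0 \<le> (b - a) * r" using that ab by (auto intro!: mult_left_mono)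
    then show ?thesis by (auto simp: algebra_simps)
  qed
  have arc: "C1_arc M p q \<gamma>" if "0 \<le> p" "q \<le> 1" for p q
  proof (rule C1_arc_affine[OF C, where \<alpha> = "b - a" and \<beta> = a])
    show "(b - a) * s + a \<in> {a..b}" if "s \<in> {p..q}" for s
      by (rule \<theta>) (use that \<open>0 \<le> p\<close> \<open>q \<le> 1\<close> in auto)
  qed (use ab in \<open>simp_all add: \<gamma>_def\<close>)
  have pc: "piecewise_C1_curve M \<gamma>"
    unfolding piecewise_C1_curve_def
  proof (intro conjI exI[of _ "{}"] allI impI)
    show "continuous_on {0..1} \<gamma>" unfolding \<gamma>_def
      by (rule continuous_on_compose2[OF c(1)]) (intro continuous_intros, use \<theta> in blast)
    show "\<gamma> ` {0..1} \<subseteq> points M" unfolding \<gamma>_def using \<theta> c(2) by blast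
  qed (use arc in auto)
  have sp: "speed M g \<gamma> r \<le> L * (b - a)" if r: "r \<in> {0<..<1}" for r
  proof -
    have "(b - a) * r < (b - a) * 1" "0 < (b - a) * r" using r ab by auto
    then have t: "(b - a) * r + a \<in> {a<..<b}" by (auto simp: algebra_simps)
    have "speed M g \<gamma> r = \<bar>b - a\<bar> * speed M g x ((b - a) * r + a)"
    proof (rule speed_affine[of UNIV])
      show "x ((b - a) * r + a) \<in> points M" using t c(2) by auto
      show "\<exists>v. ((chart_map M i \<circ> x) has_vector_derivative v) (at ((b - a) * r + a))"
        if "i \<in> idx M" "x ((b - a) * r + a) \<in> chart_dom M i" for i
        by (rule C1_arc_derivative[OF C t that])
    qed (use metric_bilinear in \<open>auto simp: \<gamma>_def\<close>)
    also have "\<dots> \<le> L * (b - a)" using L(2)[OF t] ab by (simp add: mult.commute[of L] mult_left_mono)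
    finally show ?thesis .
  qed
  \<comment> \<open>The speed bound is available at interior times only; the ends are set to 0,
    which leaves the integral unchanged.\<close>
  define f where "f r = (if r \<in> {0<..<1} then speed M g \<gamma> r else 0)" for r
  have "(speed M g \<gamma> has_integral curve_length M g \<gamma>) {0..1}"
    using speed_integrable[OF pc] by (simp add: curve_length_def integrable_integral)
  then have "(f has_integral curve_length M g \<gamma>) {0..1}"
    by (rule has_integral_spike_finite[of "{0, 1}", rotated 2]) (auto simp: f_def)
  moreover have "((\<lambda>r. L * (b - a)) has_integral L * (b - a)) {0..1::real}"
    using has_integral_const_real[of "L * (b - a)" 0 1] by simp
  ultimately have "curve_length M g \<gamma> \<le> L * (b - a)"
    by (rule has_integral_le) (use sp L ab in \<open>auto simp: f_def\<close>)
  then show ?thesis using riemannian_dist_le[OF pc] by (simp add: \<gamma>_def)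
qed

end


section \<open>Smooth Riemannian manifolds as instances\<close>

lemma smooth_onD:
  assumes "smooth_on f S" "z \<in> S"
  shows "f differentiable (at z)" "(\<lambda>y. frechet_derivative f (at y) u) differentiable (at z)"
    "continuous_on S (\<lambda>y. frechet_derivative f (at y) u)"
    "continuous_on S (\<lambda>y. frechet_derivative (\<lambda>y. frechet_derivative f (at y) u) (at y) w)"
proof -
  have "Ck_on (Suc (Suc 0)) f S" "Ck_on (Suc 0) f S" using assms(1) unfolding smooth_on_def by blast+
  then show "f differentiable (at z)" "(\<lambda>y. frechet_derivative f (at y) u) differentiable (at z)"
    "continuous_on S (\<lambda>y. frechet_derivative f (at y) u)"
    "continuous_on S (\<lambda>y. frechet_derivative (\<lambda>y. frechet_derivative f (at y) u) (at y) w)"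
    using assms(2) by auto
qed

text \<open>Smooth transition maps have continuous second derivatives, which are therefore
  symmetric. Nondegeneracy is positive definiteness tested on the vector itself.\<close>

lemma riemannian_manifold_imp_atlas:
  fixes M :: "('i, 'a::{t2_space, second_countable_topology}, 'e::euclidean_space) atlas"
  assumes RM: "riemannian_manifold M g" and conn: "connected (points M)"
  shows "riemannian_atlas M g"
proof -
  have sm: "smooth_manifold M" and rm: "riemannian_metric M g" using RM unfolding riemannian_manifold_def by auto
  have ch: "open (chart_dom M i)" "open (chart_map M i ` chart_dom M i)"
    "homeomorphism (chart_dom M i) (chart_map M i ` chart_dom M i) (chart_map M i) (chart_inv M i)"
    if "i \<in> idx M" for i using sm that unfolding smooth_manifold_def by simp_all
  have st: "smooth_on (transition M i j) (chart_map M i ` (chart_dom M i \<inter> chart_dom M j))"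
    if "i \<in> idx M" "j \<in> idx M" for i j using sm that unfolding smooth_manifold_def by simp
  have gm: "bilinear (g i p)" "g i p u v = g i p v u" "u \<noteq> 0 \<longrightarrow> g i p u u > 0"
    if "i \<in> idx M" "p \<in> chart_dom M i" for i p u v using rm that unfolding riemannian_metric_def by simp_all
  have gs: "smooth_on (\<lambda>z. g i (chart_inv M i z) u v) (chart_map M i ` chart_dom M i)" if "i \<in> idx M" for i u v
    using rm that unfolding riemannian_metric_def by simp
  show ?thesis
  proof
    fix i j z assume ij: "i \<in> idx M" "j \<in> idx M" and z: "z \<in> chart_map M i ` (chart_dom M i \<inter> chart_dom M j)"
    let ?S = "chart_map M i ` (chart_dom M i \<inter> chart_dom M j)"
    let ?f = "transition M i j"
    note sd = smooth_onD[OF st[OF ij]]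
    show "?f differentiable (at z)" by (rule sd(1)[OF z])
    let ?Q = "\<lambda>y u h. frechet_derivative (\<lambda>y. frechet_derivative ?f (at y) u) (at y) h"
    have Q: "((\<lambda>y. frechet_derivative ?f (at y) u) has_derivative ?Q y u) (at y)" if "y \<in> ?S" for y u
      using sd(2)[OF that] frechet_derivative_works by blast
    have sym: "?Q z u h = ?Q z h u" for u h
    proof (rule second_derivative_symmetric[where S = ?S and f = ?f and D = "\<lambda>y. frechet_derivative ?f (at y)" and ?D2.0 = ?Q])
      show "open ?S" using open_homeomorphism_image_Int[OF ch(3)[OF ij(1)] ch(2)[OF ij(1)] ch(1)[OF ij(2)]] .
      show "(?f has_derivative frechet_derivative ?f (at y)) (at y)" if "y \<in> ?S" for y
        using sd(1)[OF that] frechet_derivative_works by blast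
    qed (rule z Q sd(4)[OF z]; assumption?)+
    show "\<exists>Q. (\<forall>u. ((\<lambda>y. frechet_derivative ?f (at y) u) has_derivative (\<lambda>h. Q h u)) (at z)) \<and> (\<forall>u h. Q u h = Q h u)"
      by (intro exI[of _ "\<lambda>h u. ?Q z u h"] conjI allI Q[OF z] sym)
  next
    fix i p u assume "i \<in> idx M" "p \<in> chart_dom M i" "\<And>v. g i p u v = 0"
    then show "u = 0" using gm(3)[of i p u] by fastforce
  next
    fix i z u v assume i: "i \<in> idx M" and z: "z \<in> chart_map M i ` chart_dom M i"
    show "(\<lambda>z. g i (chart_inv M i z) u v) differentiable (at z)" by (rule smooth_onD(1)[OF gs[OF i] z])
  next
    fix i u v h assume i: "i \<in> idx M"
    have "Ck_on (Suc 0) (\<lambda>z. g i (chart_inv M i z) u v) (chart_map M i ` chart_dom M i)"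
      using gs[OF i] unfolding smooth_on_def by blast
    then show "continuous_on (chart_map M i ` chart_dom M i)
      (\<lambda>z. frechet_derivative (\<lambda>z. g i (chart_inv M i z) u v) (at z) h)" by simp
  next
    fix i j p u v assume "i \<in> idx M" "j \<in> idx M" "p \<in> chart_dom M i" "p \<in> chart_dom M j"
    then show "g i p u v = g j p (frechet_derivative (transition M i j) (at (chart_map M i p)) u)
                        (frechet_derivative (transition M i j) (at (chart_map M i p)) v)"
      using rm unfolding riemannian_metric_def Let_def by (meson IntI)
  qed (use ch gm conn in auto)
qed

section \<open>Goedel type spacetimes\<close>

locale goedel_spacetime = riemannian_atlas M g
  for M :: "('i, 'a::t2_space, 'e::euclidean_space) atlas" and g :: "('i, 'a, 'e) tensor2" +
  fixes A B C :: "'a \<Rightarrow> real"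
  assumes C1_A: "Ck_function 1 M A" and C1_B: "Ck_function 1 M B" and C1_C: "Ck_function 1 M C"
    and H_pos: "\<And>x. x \<in> points M \<Longrightarrow> (B x)\<^sup>2 + A x * C x > 0"
begin

abbreviation "MM \<equiv> times_R2 M"
abbreviation "gg \<equiv> goedel_metric g A B C"

lemma times_R2_simps [simp]:
  "idx MM = idx M" "chart_dom MM i = chart_dom M i \<times> UNIV" "chart_map MM i x = (chart_map M i (fst x), snd x)"
  by (simp_all add: times_R2_def case_prod_unfold)

lemma goedel_metric_eq:
  "gg i p u v = g i (fst p) (fst u) (fst v) + A (fst p) * (fst (snd u) * fst (snd v))
     + B (fst p) * (fst (snd u) * snd (snd v) + snd (snd u) * fst (snd v)) - C (fst p) * (snd (snd u) * snd (snd v))"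
  by (simp add: goedel_metric_def case_prod_unfold mult.assoc)

lemma chart_image_times: "chart_map MM i ` (S \<times> UNIV) = chart_map M i ` S \<times> UNIV"
  by (auto simp: image_iff)

section \<open>The product atlas and its metric\<close>

text \<open>As \<open>chart_inv\<close> is defined by \<open>inv_into\<close>, its product form has
  to be derived from injectivity of the product chart.\<close>

lemma chart_inv_times:
  assumes i: "i \<in> idx M" and z: "fst z \<in> chart_image i"
  shows "chart_inv MM i z = (chart_inv M i (fst z), snd z)"
proof -
  have "inj_on (chart_map MM i) (chart_dom MM i)"
    by (rule inj_onI) (auto dest: arg_cong[where f = "chart_inv M i"] simp: chart_inv_chart[OF i])
  from inv_into_f_f[OF this, of "(chart_inv M i (fst z), snd z)"] show ?thesis
    using chart_chart_inv[OF i z] by (simp add: chart_inv_def[of MM])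
qed

lemma homeomorphism_times:
  assumes i: "i \<in> idx M"
  shows "homeomorphism (chart_dom MM i) (chart_map MM i ` chart_dom MM i) (chart_map MM i) (chart_inv MM i)"
proof (rule homeomorphismI)
  note h = homeomorphism_chart[OF i]
  show "continuous_on (chart_dom MM i) (chart_map MM i)"
    unfolding times_R2_simps
    by (intro continuous_intros continuous_on_compose2[OF homeomorphism_cont1[OF h]]) auto
  have "continuous_on (chart_image i \<times> (UNIV::(real\<times>real) set)) (\<lambda>z. (chart_inv M i (fst z), snd z))"
    by (intro continuous_intros continuous_on_compose2[OF homeomorphism_cont2[OF h]]) auto
  then have "continuous_on (chart_image i \<times> UNIV) (chart_inv MM i)"
    by (rule continuous_on_eq) (auto simp: chart_inv_times[OF i])
  then show "continuous_on (chart_map MM i ` chart_dom MM i) (chart_inv MM i)"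
    unfolding times_R2_simps(2) chart_image_times .
  show "chart_inv MM i ` chart_map MM i ` chart_dom MM i \<subseteq> chart_dom MM i"
    by (auto simp: chart_inv_times[OF i] chart_inv_chart[OF i])
qed (auto simp: chart_inv_times[OF i] chart_inv_chart[OF i])

lemma transition_times:
  assumes i: "i \<in> idx M" and z: "fst z \<in> chart_image i"
  shows "transition MM i j z = (transition M i j (fst z), snd z)"
  by (simp add: transition_def chart_inv_times[OF i z])

lemma overlap_times: "chart_map MM i ` (chart_dom MM i \<inter> chart_dom MM j) = chart_map M i ` (chart_dom M i \<inter> chart_dom M j) \<times> UNIV"
  by (simp only: times_R2_simps(2) Times_Int_Times Int_absorb chart_image_times)

lemma open_overlap_times:
  assumes "i \<in> idx M" "j \<in> idx M"
  shows "open (chart_map MM i ` (chart_dom MM i \<inter> chart_dom MM j))"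
  unfolding overlap_times using assms open_overlap open_chart_dom by (intro open_Times) auto

lemma has_derivative_transition_times:
  assumes ij: "i \<in> idx M" "j \<in> idx M" and z: "z \<in> chart_map MM i ` (chart_dom MM i \<inter> chart_dom MM j)"
  shows "(transition MM i j has_derivative (\<lambda>u. (Dtrans i j (fst z) (fst u), snd u))) (at z)"
proof -
  have z1: "fst z \<in> chart_map M i ` (chart_dom M i \<inter> chart_dom M j)" using z unfolding overlap_times by auto
  have "((\<lambda>z. (transition M i j (fst z), snd z)) has_derivative (\<lambda>u. (Dtrans i j (fst z) (fst u), snd u))) (at z)"
    by (intro has_derivative_Pair has_derivative_snd has_derivative_ident
        has_derivative_compose[OF has_derivative_fst[OF has_derivative_ident] has_derivative_transition[OF ij z1]])
  then show ?thesis
    by (rule has_derivative_transform_within_open[OF _ open_overlap_times[OF ij] z])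
      (auto simp: overlap_times transition_times[OF ij(1)] simp del: times_R2_simps)
qed

lemma Dtrans_times:
  assumes ij: "i \<in> idx M" "j \<in> idx M" and z: "z \<in> chart_map MM i ` (chart_dom MM i \<inter> chart_dom MM j)"
  shows "frechet_derivative (transition MM i j) (at z) = (\<lambda>u. (Dtrans i j (fst z) (fst u), snd u))"
  using frechet_derivative_at[OF has_derivative_transition_times[OF assms]] by simp

lemma has_derivative_coeff:
  assumes F: "Ck_function 1 M F" and i: "i \<in> idx M" and z: "z \<in> chart_image i"
  shows "((\<lambda>z. F (chart_inv M i z)) has_derivative frechet_derivative (\<lambda>z. F (chart_inv M i z)) (at z)) (at z)"
    "continuous_on (chart_image i) (\<lambda>z. frechet_derivative (\<lambda>z. F (chart_inv M i z)) (at z) h)"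
proof -
  have "Ck_on (Suc 0) (F \<circ> chart_inv M i) (chart_image i)" using F i unfolding Ck_function_def by simp
  then have dc: "(\<forall>z\<in>chart_image i. (\<lambda>z. F (chart_inv M i z)) differentiable (at z)) \<and>
      (\<forall>h. continuous_on (chart_image i) (\<lambda>z. frechet_derivative (\<lambda>z. F (chart_inv M i z)) (at z) h))"
    unfolding Ck_on.simps o_def .
  show "((\<lambda>z. F (chart_inv M i z)) has_derivative frechet_derivative (\<lambda>z. F (chart_inv M i z)) (at z)) (at z)"
    using bspec[OF conjunct1[OF dc] z] unfolding frechet_derivative_works .
  show "continuous_on (chart_image i) (\<lambda>z. frechet_derivative (\<lambda>z. F (chart_inv M i z)) (at z) h)"
    by (rule spec[OF conjunct2[OF dc]])
qed

text \<open>Regularity of the coefficients is defined through charts; near \<open>p\<close> the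
  function factors through one of them.\<close>

lemma isCont_coeff:
  assumes F: "Ck_function 1 M F" and p: "p \<in> points M"
  shows "isCont F p"
proof -
  obtain i where i: "i \<in> idx M" "p \<in> chart_dom M i" using p by (auto simp: points_def)
  have "isCont (\<lambda>z. F (chart_inv M i z)) (chart_map M i p)"
    by (rule has_derivative_continuous[OF has_derivative_coeff(1)[OF F i(1)]]) (use i in simp)
  from isCont_o2[OF isCont_chart[OF i] this]
  have c: "isCont (\<lambda>q. F (chart_inv M i (chart_map M i q))) p" .
  have "eventually (\<lambda>q. F (chart_inv M i (chart_map M i q)) = F q) (nhds p)"
    by (rule eventually_mono[OF eventually_nhds_in_open[OF open_chart_dom[OF i(1)] i(2)]]) (simp add: chart_inv_chart[OF i(1)])
  from isCont_cong[OF this] c show ?thesis by (rule iffD1)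
qed

abbreviation "coeff_deriv F i z \<equiv> frechet_derivative (\<lambda>z. F (chart_inv M i z)) (at z)"

text \<open>The coefficients depend on the base point only, so the derivative sees just
  \<open>fst h\<close>. It vanishes in the fibre directions, which is the Killing property of the
  two coordinate fields.\<close>

lemma has_derivative_goedel:
  assumes i: "i \<in> idx M" and z: "z \<in> chart_map MM i ` chart_dom MM i"
  shows "((\<lambda>z. gg i (chart_inv MM i z) u v) has_derivative
    (\<lambda>h. loc_deriv i (fst z) (fst h) (fst u) (fst v)
      + coeff_deriv A i (fst z) (fst h) * (fst (snd u) * fst (snd v))
      + coeff_deriv B i (fst z) (fst h) * (fst (snd u) * snd (snd v) + snd (snd u) * fst (snd v))
      - coeff_deriv C i (fst z) (fst h) * (snd (snd u) * snd (snd v)))) (at z)"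
proof -
  have z1: "fst z \<in> chart_image i" using z by auto
  have comp: "((\<lambda>z. F (fst z)) has_derivative (\<lambda>h. F' (fst h))) (at z)"
    if "(F has_derivative F') (at (fst z))" for F F' :: "'e \<Rightarrow> real"
    by (rule has_derivative_compose[OF has_derivative_fst[OF has_derivative_ident] that])
  note ds = comp[OF has_derivative_metric[OF i z1]] comp[OF has_derivative_coeff(1)[OF C1_A i z1]]
    comp[OF has_derivative_coeff(1)[OF C1_B i z1]] comp[OF has_derivative_coeff(1)[OF C1_C i z1]]
  have "((\<lambda>z. loc_metric i (fst z) (fst u) (fst v)
      + A (chart_inv M i (fst z)) * (fst (snd u) * fst (snd v))
      + B (chart_inv M i (fst z)) * (fst (snd u) * snd (snd v) + snd (snd u) * fst (snd v))
      - C (chart_inv M i (fst z)) * (snd (snd u) * snd (snd v))) has_derivative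
    (\<lambda>h. loc_deriv i (fst z) (fst h) (fst u) (fst v)
      + coeff_deriv A i (fst z) (fst h) * (fst (snd u) * fst (snd v))
      + coeff_deriv B i (fst z) (fst h) * (fst (snd u) * snd (snd v) + snd (snd u) * fst (snd v))
      - coeff_deriv C i (fst z) (fst h) * (snd (snd u) * snd (snd v)))) (at z)"
    by (rule has_derivative_diff[OF has_derivative_add[OF has_derivative_add[OF ds(1) has_derivative_mult_left[OF ds(2)]]
        has_derivative_mult_left[OF ds(3)]] has_derivative_mult_left[OF ds(4)]])
  moreover have "open (chart_map MM i ` chart_dom MM i)"
    unfolding times_R2_simps(2) chart_image_times by (intro open_Times open_chart_image i) simp
  ultimately show ?thesis
  proof (rule has_derivative_transform_within_open[OF _ _ z])
    fix w assume "w \<in> chart_map MM i ` chart_dom MM i"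
    then have "fst w \<in> chart_image i" by auto
    note w = chart_inv_times[OF i this]
    show "loc_metric i (fst w) (fst u) (fst v)
      + A (chart_inv M i (fst w)) * (fst (snd u) * fst (snd v))
      + B (chart_inv M i (fst w)) * (fst (snd u) * snd (snd v) + snd (snd u) * fst (snd v))
      - C (chart_inv M i (fst w)) * (snd (snd u) * snd (snd v)) = gg i (chart_inv MM i w) u v"
      by (simp only: goedel_metric_eq w fst_conv)
  qed
qed

lemma semi_riemannian_atlas_times: "semi_riemannian_atlas MM gg"
proof
  fix i assume "i \<in> idx MM"
  then have i: "i \<in> idx M" by simp
  show "open (chart_dom MM i)" using open_chart_dom[OF i] by (simp add: open_Times)
  show "open (chart_map MM i ` chart_dom MM i)"
    unfolding times_R2_simps(2) chart_image_times by (intro open_Times open_chart_image i) simp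
  show "homeomorphism (chart_dom MM i) (chart_map MM i ` chart_dom MM i) (chart_map MM i) (chart_inv MM i)"
    by (rule homeomorphism_times[OF i])
  show "(\<lambda>z. gg i (chart_inv MM i z) u v) differentiable (at z)" if "z \<in> chart_map MM i ` chart_dom MM i" for z u v
    using has_derivative_goedel[OF i that] differentiable_def by blast
  show "continuous_on (chart_map MM i ` chart_dom MM i)
      (\<lambda>z. frechet_derivative (\<lambda>z. gg i (chart_inv MM i z) u v) (at z) h)" for u v h
  proof -
    have cf: "continuous_on (chart_map MM i ` chart_dom MM i) (\<lambda>z. F (fst z))"
      if "continuous_on (chart_image i) F" for F :: "'e \<Rightarrow> real"
      by (rule continuous_on_compose2[OF that]) (auto intro!: continuous_intros)
    have "continuous_on (chart_map MM i ` chart_dom MM i) (\<lambda>z. loc_deriv i (fst z) (fst h) (fst u) (fst v)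
      + coeff_deriv A i (fst z) (fst h) * (fst (snd u) * fst (snd v))
      + coeff_deriv B i (fst z) (fst h) * (fst (snd u) * snd (snd v) + snd (snd u) * fst (snd v))
      - coeff_deriv C i (fst z) (fst h) * (snd (snd u) * snd (snd v)))"
    \<comment> \<open>\<open>has_derivative_coeff\<close> speaks about a point of the chart image,
      so an empty image is treated separately.\<close>
    proof (cases "chart_image i = {}")
      case False
      then obtain z0 where z0: "z0 \<in> chart_image i" by blast
      note cs = cf[OF metric_C1[OF i]] cf[OF has_derivative_coeff(2)[OF C1_A i z0]]
        cf[OF has_derivative_coeff(2)[OF C1_B i z0]] cf[OF has_derivative_coeff(2)[OF C1_C i z0]]
      show ?thesis
        by (rule continuous_on_diff[OF continuous_on_add[OF continuous_on_add[OF cs(1)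
            continuous_on_mult[OF cs(2) continuous_on_const]] continuous_on_mult[OF cs(3) continuous_on_const]]
            continuous_on_mult[OF cs(4) continuous_on_const]])
    qed simp
    then show ?thesis
      by (rule continuous_on_eq) (simp add: frechet_derivative_at[OF has_derivative_goedel[OF i], symmetric])
  qed
  fix p assume "p \<in> chart_dom MM i"
  then have p: "fst p \<in> chart_dom M i" by auto
  note b = metric_bilinear[OF i p]
  show "bilinear (gg i p)"
    unfolding bilinear_def
    by (intro conjI allI linearI)
      (simp_all add: goedel_metric_eq bilinear_ladd[OF b] bilinear_radd[OF b] bilinear_lmul[OF b] bilinear_rmul[OF b] algebra_simps)
  show "gg i p u v = gg i p v u" for u v
    by (simp add: goedel_metric_eq metric_sym[OF i p, of "fst u"] algebra_simps)
  fix u assume u: "\<And>v. gg i p u v = 0"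
  have "g i (fst p) (fst u) v = 0" for v using u[of "(v, 0, 0)"] by (simp add: goedel_metric_eq)
  then have u1: "fst u = 0" by (rule metric_nondegenerate[OF i p])
  let ?A = "A (fst p)" and ?B = "B (fst p)" and ?C = "C (fst p)"
  let ?y = "fst (snd u)" and ?t = "snd (snd u)"
  have e1: "?A * ?y + ?B * ?t = 0" and e2: "?B * ?y - ?C * ?t = 0"
    using u[of "(0, 1, 0)"] u[of "(0, 0, 1)"] by (simp_all add: goedel_metric_eq bilinear_rzero[OF b])
  have "fst p \<in> points M" unfolding points_def using i p by blast
  from H_pos[OF this] have H: "?B\<^sup>2 + ?A * ?C \<noteq> 0" by simp
  \<comment> \<open>Cramer's rule for the fibre metric, whose determinant is the negative of
    \<open>?B\<^sup>2 + ?A * ?C\<close>.\<close>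
  have "(?B\<^sup>2 + ?A * ?C) * ?y = ?C * (?A * ?y + ?B * ?t) + ?B * (?B * ?y - ?C * ?t)"
    "(?B\<^sup>2 + ?A * ?C) * ?t = ?B * (?A * ?y + ?B * ?t) - ?A * (?B * ?y - ?C * ?t)"
    by algebra+
  then have "?y = 0" "?t = 0" unfolding e1 e2 using H by simp_all
  with u1 show "u = 0" by (simp add: prod_eq_iff)
next
  fix i j z assume "i \<in> idx MM" "j \<in> idx MM" and z: "z \<in> chart_map MM i ` (chart_dom MM i \<inter> chart_dom MM j)"
  then have ij: "i \<in> idx M" "j \<in> idx M" by simp_all
  show "transition MM i j differentiable (at z)"
    using has_derivative_transition_times[OF ij z] differentiable_def by blast
  have z1: "fst z \<in> chart_map M i ` (chart_dom M i \<inter> chart_dom M j)" using z unfolding overlap_times by auto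
  obtain Q where Q: "\<And>u. ((\<lambda>y. Dtrans i j y u) has_derivative (\<lambda>h. Q h u)) (at (fst z))" and sym: "\<And>u h. Q u h = Q h u"
    using transition_second_derivative[OF ij z1] by blast
  \<comment> \<open>The transition maps act as the identity on the fibre coordinates, so the second
    derivative has fibre component 0.\<close>
  have "((\<lambda>y. frechet_derivative (transition MM i j) (at y) u) has_derivative (\<lambda>h. (Q (fst h) (fst u), 0))) (at z)" for u
  proof -
    have "((\<lambda>y. (Dtrans i j (fst y) (fst u), snd u)) has_derivative (\<lambda>h. (Q (fst h) (fst u), 0))) (at z)"
      by (intro has_derivative_Pair has_derivative_const has_derivative_compose[OF has_derivative_fst[OF has_derivative_ident] Q])
    then show ?thesis
      by (rule has_derivative_transform_within_open[OF _ open_overlap_times[OF ij] z])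
        (simp only: Dtrans_times[OF ij])
  qed
  then show "\<exists>Q. (\<forall>u. ((\<lambda>y. frechet_derivative (transition MM i j) (at y) u) has_derivative (\<lambda>h. Q h u)) (at z)) \<and>
      (\<forall>u h. Q u h = Q h u)"
    using arg_cong[OF sym, of "\<lambda>q. (q, 0)"]
    by (intro exI[of _ "\<lambda>h u. (Q (fst h) (fst u), 0)"] conjI allI)
next
  fix i j p u v assume "i \<in> idx MM" "j \<in> idx MM" and p: "p \<in> chart_dom MM i" "p \<in> chart_dom MM j"
  then have ij: "i \<in> idx M" "j \<in> idx M" by simp_all
  have p1: "fst p \<in> chart_dom M i" "fst p \<in> chart_dom M j" using p by auto
  have z: "chart_map MM i p \<in> chart_map MM i ` (chart_dom MM i \<inter> chart_dom MM j)" using p by blast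
  show "gg i p u v = gg j p (frechet_derivative (transition MM i j) (at (chart_map MM i p)) u)
      (frechet_derivative (transition MM i j) (at (chart_map MM i p)) v)"
    unfolding Dtrans_times[OF ij z] by (simp only: goedel_metric_eq times_R2_simps fst_conv snd_conv
        metric_transition[OF ij p1, of "fst u" "fst v"])
qed

sublocale st: semi_riemannian_atlas MM gg
  by (rule semi_riemannian_atlas_times)

end

text \<open>The eigenvalues of the inverse of the fibre metric \<open>A dy\<^sup>2 + 2 B dy dt - C dt\<^sup>2\<close> are
  \<open>\<mu> / (2 H)\<close> and \<open>- 2 / \<mu>\<close>.\<close>

lemma inverse_fibre_metric_lower_bound:
  fixes a b c p q :: real
  assumes H: "b\<^sup>2 + a * c > 0"
  defines "m \<equiv> c - a + sqrt ((a + c)\<^sup>2 + 4 * b\<^sup>2)"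
  shows "m > 0" "- (c * p\<^sup>2 + 2 * b * p * q - a * q\<^sup>2) / (b\<^sup>2 + a * c) \<le> 2 * (p\<^sup>2 + q\<^sup>2) / m"
proof -
  define h where "h = b\<^sup>2 + a * c"
  define R where "R = sqrt ((a + c)\<^sup>2 + 4 * b\<^sup>2)"
  have h: "h > 0" using H by (simp add: h_def)
  have R2: "R\<^sup>2 = (a + c)\<^sup>2 + 4 * b\<^sup>2" by (simp add: R_def)
  have R0: "R \<ge> 0" by (simp add: R_def)
  have R2h: "R\<^sup>2 = (c - a)\<^sup>2 + 4 * h" unfolding R2 h_def by algebra
  then have "\<bar>c - a\<bar>\<^sup>2 < R\<^sup>2" using h by simp
  then have "\<bar>c - a\<bar> < R" using R0 by (rule power2_less_imp_less)
  then have m: "m > 0" unfolding m_def R_def[symmetric] by linarith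
  then show "m > 0" .
  have mn: "m * (R - (c - a)) = 4 * h"
    using R2h unfolding m_def R_def[symmetric] by algebra
  \<comment> \<open>The symmetric matrix with rows \<open>(c, b)\<close> and \<open>(b, - a)\<close>
    has eigenvalues \<open>m / 2\<close> and \<open>- n\<close>, with product \<open>- h\<close>.
    Adding \<open>n\<close> times the identity leaves a singular matrix with diagonal entries
    \<open>x\<close> and \<open>y\<close>, hence \<open>x * y = b\<^sup>2\<close>.\<close>
  define n where "n = (R - (c - a)) / 2"
  define x where "x = n + c"
  define y where "y = n - a"
  have n2: "2 * n = R - (c - a)" by (simp add: n_def)
  then have x2: "2 * x = R + (a + c)" and y2: "2 * y = R - (a + c)" unfolding x_def y_def by simp_all
  have "\<bar>a + c\<bar>\<^sup>2 \<le> R\<^sup>2" unfolding R2 by simp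
  then have "\<bar>a + c\<bar> \<le> R" using R0 by (rule power2_le_imp_le)
  then have "2 * x \<ge> 0" and "2 * y \<ge> 0" unfolding x2 y2 by simp_all
  then have x: "x \<ge> 0" and y: "y \<ge> 0" by simp_all
  have xy: "x * y = b\<^sup>2"
  proof -
    have "4 * (x * y) = 4 * b\<^sup>2" using R2 x2 y2 by algebra
    then show ?thesis by simp
  qed
  \<comment> \<open>Positive semidefiniteness of the shifted matrix, by completing the
    square.\<close>
  have form: "x * p\<^sup>2 + 2 * b * p * q + y * q\<^sup>2 \<ge> 0"
  proof (cases "x = 0")
    case True
    then have "b = 0" using xy by simp
    then show ?thesis using True y by simp
  next
    case False
    have "x * (x * p\<^sup>2 + 2 * b * p * q + y * q\<^sup>2) = (x * p + b * q)\<^sup>2" using xy by algebra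
    then have "x * (x * p\<^sup>2 + 2 * b * p * q + y * q\<^sup>2) \<ge> 0" by simp
    then show ?thesis using False x by (simp add: zero_le_mult_iff)
  qed
  have "n * (p\<^sup>2 + q\<^sup>2) + (c * p\<^sup>2 + 2 * b * p * q - a * q\<^sup>2) = x * p\<^sup>2 + 2 * b * p * q + y * q\<^sup>2"
    unfolding x_def y_def by algebra
  with form have "- (c * p\<^sup>2 + 2 * b * p * q - a * q\<^sup>2) \<le> n * (p\<^sup>2 + q\<^sup>2)" by linarith
  then have "- (c * p\<^sup>2 + 2 * b * p * q - a * q\<^sup>2) / h \<le> n * (p\<^sup>2 + q\<^sup>2) / h"
    by (rule divide_right_mono) (use h in simp)
  also have "n = 2 * h / m"
  proof -
    have "n * m = 2 * h" using mn n2 by algebra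
    then show ?thesis using m by (simp add: eq_divide_eq)
  qed
  also have "2 * h / m * (p\<^sup>2 + q\<^sup>2) / h = 2 * (p\<^sup>2 + q\<^sup>2) / m" using h by simp
  finally show "- (c * p\<^sup>2 + 2 * b * p * q - a * q\<^sup>2) / (b\<^sup>2 + a * c) \<le> 2 * (p\<^sup>2 + q\<^sup>2) / m"
    unfolding h_def .
qed

section \<open>First integrals of geodesics of the spacetime\<close>

context goedel_spacetime
begin

lemma inverse_fibre_metric:
  assumes x: "x \<in> points M" and P: "A x * \<eta> + B x * \<tau> = P" and Q: "B x * \<eta> - C x * \<tau> = Q"
  shows "\<eta> = (C x * P + B x * Q) / ((B x)\<^sup>2 + A x * C x)" "\<tau> = (B x * P - A x * Q) / ((B x)\<^sup>2 + A x * C x)"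
proof -
  have H: "(B x)\<^sup>2 + A x * C x \<noteq> 0" using H_pos[OF x] by simp
  have "((B x)\<^sup>2 + A x * C x) * \<eta> = C x * P + B x * Q" "((B x)\<^sup>2 + A x * C x) * \<tau> = B x * P - A x * Q"
    unfolding P[symmetric] Q[symmetric] by algebra+
  then show "\<eta> = (C x * P + B x * Q) / ((B x)\<^sup>2 + A x * C x)" "\<tau> = (B x * P - A x * Q) / ((B x)\<^sup>2 + A x * C x)"
    using H by (simp_all add: eq_divide_eq mult.commute)
qed

text \<open>The fibre velocity is recovered from the two momenta by inverting the fibre metric, and
  the energy then determines the squared speed of the base curve. The last equation keeps the form
  \<open>E + - (...) / ...\<close> so that it matches
  \<open>inverse_fibre_metric_lower_bound\<close>.\<close>

lemma geodesic_first_integrals: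
  assumes geo: "geodesic_on MM gg J c"
  obtains E P Q where
    "\<And>s i. \<lbrakk>s \<in> J; i \<in> idx M; fst (c s) \<in> chart_dom M i\<rbrakk> \<Longrightarrow>
       fst (snd (st.vel i c s)) = (C (fst (c s)) * P + B (fst (c s)) * Q) / ((B (fst (c s)))\<^sup>2 + A (fst (c s)) * C (fst (c s)))"
    "\<And>s i. \<lbrakk>s \<in> J; i \<in> idx M; fst (c s) \<in> chart_dom M i\<rbrakk> \<Longrightarrow>
       snd (snd (st.vel i c s)) = (B (fst (c s)) * P - A (fst (c s)) * Q) / ((B (fst (c s)))\<^sup>2 + A (fst (c s)) * C (fst (c s)))"
    "\<And>s i. \<lbrakk>s \<in> J; i \<in> idx M; fst (c s) \<in> chart_dom M i\<rbrakk> \<Longrightarrow>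
       g i (fst (c s)) (fst (st.vel i c s)) (fst (st.vel i c s)) =
         E + - (C (fst (c s)) * P\<^sup>2 + 2 * B (fst (c s)) * P * Q - A (fst (c s)) * Q\<^sup>2) / ((B (fst (c s)))\<^sup>2 + A (fst (c s)) * C (fst (c s)))"
proof -
  \<comment> \<open>Stated for every fibre vector \<open>w\<close>, so that \<open>D\<close> and
    \<open>K\<close> serve both coordinate fields.\<close>
  have D: "frechet_derivative (transition MM i j) (at (chart_map MM i p)) (0, w) = (0, w)"
    if "i \<in> idx MM" "j \<in> idx MM" "p \<in> chart_dom MM i" "p \<in> chart_dom MM j" for i j p w
  proof -
    have ij: "i \<in> idx M" "j \<in> idx M" using that by simp_all
    have z: "chart_map MM i p \<in> chart_map MM i ` (chart_dom MM i \<inter> chart_dom MM j)" using that by blast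
    have z1: "fst (chart_map MM i p) \<in> chart_map M i ` (chart_dom M i \<inter> chart_dom M j)" using z unfolding overlap_times by auto
    show ?thesis unfolding Dtrans_times[OF ij z] using linear_0[OF linear_Dtrans[OF ij z1]] by simp
  qed
  have K: "metric_deriv MM gg i p (0, w) u u = 0" if "i \<in> idx MM" "p \<in> chart_dom MM i" for i p w u
  proof -
    have i: "i \<in> idx M" using that by simp
    have z: "chart_map MM i p \<in> chart_map MM i ` chart_dom MM i" using that by blast
    then have z1: "fst (chart_map MM i p) \<in> chart_image i" by auto
    have "linear (coeff_deriv F i (fst (chart_map MM i p)))" if "Ck_function 1 M F" for F
      using has_derivative_linear[OF has_derivative_coeff(1)[OF that i z1]] .
    note l = linear_0[OF this]
    show ?thesis
      unfolding metric_deriv_def frechet_derivative_at[OF has_derivative_goedel[OF i z], symmetric]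
      using l[OF C1_A] l[OF C1_B] l[OF C1_C] linear_0[OF loc_deriv_linear1[OF i z1]] by simp
  qed
  obtain E where E: "\<forall>s\<in>J. \<forall>i\<in>idx MM. c s \<in> chart_dom MM i \<longrightarrow> gg i (c s) (st.vel i c s) (st.vel i c s) = E"
    using st.energy_conserved[OF geo] ..
  obtain P where P: "\<forall>s\<in>J. \<forall>i\<in>idx MM. c s \<in> chart_dom MM i \<longrightarrow> gg i (c s) (st.vel i c s) (0, 1, 0) = P"
    using st.killing_momentum_conserved[OF geo D K] ..
  obtain Q where Q: "\<forall>s\<in>J. \<forall>i\<in>idx MM. c s \<in> chart_dom MM i \<longrightarrow> gg i (c s) (st.vel i c s) (0, 0, 1) = Q"
    using st.killing_momentum_conserved[OF geo D K] ..
  show ?thesis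
  proof (rule that[of P Q E])
    fix s i assume s: "s \<in> J" and i: "i \<in> idx M" "fst (c s) \<in> chart_dom M i"
    let ?x = "fst (c s)" and ?V = "st.vel i c s"
    have i': "i \<in> idx MM" "c s \<in> chart_dom MM i" using i by (simp_all add: mem_Times_iff)
    have x: "?x \<in> points M" unfolding points_def using i by blast
    note b = metric_bilinear[OF i]
    have p1: "A ?x * fst (snd ?V) + B ?x * snd (snd ?V) = P"
      using P[rule_format, OF s i'] by (simp add: goedel_metric_eq bilinear_rzero[OF b])
    have p2: "B ?x * fst (snd ?V) - C ?x * snd (snd ?V) = Q"
      using Q[rule_format, OF s i'] by (simp add: goedel_metric_eq bilinear_rzero[OF b])
    note yt = inverse_fibre_metric[OF x p1 p2]
    show "fst (snd ?V) = (C ?x * P + B ?x * Q) / ((B ?x)\<^sup>2 + A ?x * C ?x)" by (rule yt)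
    show "snd (snd ?V) = (B ?x * P - A ?x * Q) / ((B ?x)\<^sup>2 + A ?x * C ?x)" by (rule yt)
    have "g i ?x (fst ?V) (fst ?V) = E - (fst (snd ?V) * (A ?x * fst (snd ?V) + B ?x * snd (snd ?V))
       + snd (snd ?V) * (B ?x * fst (snd ?V) - C ?x * snd (snd ?V)))"
      using E[rule_format, OF s i'] by (simp add: goedel_metric_eq algebra_simps)
    also have "\<dots> = E - (fst (snd ?V) * P + snd (snd ?V) * Q)" unfolding p1 p2 ..
    also have "fst (snd ?V) * P + snd (snd ?V) * Q = (C ?x * P\<^sup>2 + 2 * B ?x * P * Q - A ?x * Q\<^sup>2) / ((B ?x)\<^sup>2 + A ?x * C ?x)"
    proof -
      have "(C ?x * P + B ?x * Q) * P + (B ?x * P - A ?x * Q) * Q = C ?x * P\<^sup>2 + 2 * B ?x * P * Q - A ?x * Q\<^sup>2" by algebra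
      then show ?thesis unfolding yt times_divide_eq_left add_divide_distrib[symmetric] by simp
    qed
    also have "E - (C ?x * P\<^sup>2 + 2 * B ?x * P * Q - A ?x * Q\<^sup>2) / ((B ?x)\<^sup>2 + A ?x * C ?x) =
        E + - (C ?x * P\<^sup>2 + 2 * B ?x * P * Q - A ?x * Q\<^sup>2) / ((B ?x)\<^sup>2 + A ?x * C ?x)" by (simp only: minus_divide_left diff_conv_add_uminus)
    finally show "g i ?x (fst ?V) (fst ?V) = E + - (C ?x * P\<^sup>2 + 2 * B ?x * P * Q - A ?x * Q\<^sup>2) / ((B ?x)\<^sup>2 + A ?x * C ?x)" .
  qed
qed

end


section \<open>Extension of bounded geodesics and completeness\<close>

lemma le_double_add_one: "x \<le> 2 * a + 1" if "x \<le> a + (1 / 2) * (1 + x)" for a x :: real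
  using that by (simp add: field_simps)

context goedel_spacetime
begin

text \<open>One extension at \<open>b = Sup J\<close> is enough. \<open>geodesic_extension\<close>
  asks for a limit in the manifold, a chart around it and a velocity bound in that chart; all
  estimates are made on a final stretch of \<open>J\<close>.\<close>

lemma bounded_geodesic_extends:
  assumes complete: "complete_riemannian M g" and x0: "x0 \<in> points M" and l: "l \<ge> 0"
    and mu: "\<And>x. x \<in> points M \<Longrightarrow> 1 / goedel_mu A B C x \<le> l * (rdist x x0)\<^sup>2 + k"
    and geo: "geodesic_on MM gg J c" and bdd: "bdd_above J"
  shows "\<exists>J' c'. J \<subset> J' \<and> geodesic_on MM gg J' c' \<and> (\<forall>s\<in>J. c' s = c s)"
proof -
  interpret d: Metric_space "points M" rdist by (rule Metric_space_riemannian_dist)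
  have J: "open J" "is_interval J" "J \<noteq> {}" "continuous_on J c" "c ` J \<subseteq> points MM"
    using geo unfolding st.geodesic_on_iff by simp_all
  define b where "b = Sup J"
  \<comment> \<open>\<open>J\<close> is open, so its supremum is not attained.\<close>
  have Jb: "s < b" if s: "s \<in> J" for s
  proof -
    obtain e where e: "e > 0" "cball s e \<subseteq> J" using J(1) s open_contains_cball by blast
    have "s + e \<in> cball s e" using e(1) by (simp add: dist_real_def)
    then have "s + e \<in> J" using e(2) by blast
    then have "s + e \<le> b" unfolding b_def by (rule cSup_upper[OF _ bdd])
    then show ?thesis using e(1) by simp
  qed
  have toJ: "t \<in> J" if st: "s \<in> J" "s \<le> t" "t < b" for s t
  proof -
    obtain r where r: "r \<in> J" "t < r" using less_cSupD[OF J(3), of t] st(3) unfolding b_def by blast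
    show ?thesis using J(2)[unfolded is_interval_1, rule_format, OF st(1) r(1)] st(2) r(2) by simp
  qed
  define x where "x s = fst (c s)" for s
  have xpt: "x s \<in> points M" if "s \<in> J" for s
  proof -
    have "c s \<in> points MM" using J(5) that by blast
    then show ?thesis by (auto simp: points_def x_def)
  qed
  have xc: "isCont x s" if "s \<in> J" for s
    unfolding x_def by (rule isCont_fst[OF st.isCont_geodesic[OF geo that]])
  define H where "H p = (B p)\<^sup>2 + A p * C p" for p
  obtain E P Q where
    y: "\<And>s i. \<lbrakk>s \<in> J; i \<in> idx M; fst (c s) \<in> chart_dom M i\<rbrakk> \<Longrightarrow>
       fst (snd (st.vel i c s)) = (C (fst (c s)) * P + B (fst (c s)) * Q) / ((B (fst (c s)))\<^sup>2 + A (fst (c s)) * C (fst (c s)))"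
    and t: "\<And>s i. \<lbrakk>s \<in> J; i \<in> idx M; fst (c s) \<in> chart_dom M i\<rbrakk> \<Longrightarrow>
       snd (snd (st.vel i c s)) = (B (fst (c s)) * P - A (fst (c s)) * Q) / ((B (fst (c s)))\<^sup>2 + A (fst (c s)) * C (fst (c s)))"
    and en: "\<And>s i. \<lbrakk>s \<in> J; i \<in> idx M; fst (c s) \<in> chart_dom M i\<rbrakk> \<Longrightarrow>
       g i (fst (c s)) (fst (st.vel i c s)) (fst (st.vel i c s)) =
         E + - (C (fst (c s)) * P\<^sup>2 + 2 * B (fst (c s)) * P * Q - A (fst (c s)) * Q\<^sup>2) / ((B (fst (c s)))\<^sup>2 + A (fst (c s)) * C (fst (c s)))"
    by (rule geodesic_first_integrals[OF geo]) blast
  note y = y[folded x_def H_def] and t = t[folded x_def H_def] and en = en[folded x_def H_def]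
  \<comment> \<open>With the constants of motion fixed, \<open>w\<close> is the squared speed of the
    base curve and \<open>Y\<close> the fibre velocity, both as functions on the base. Their
    continuity transfers to the geodesic.\<close>
  define w where "w p = E + - (C p * P\<^sup>2 + 2 * B p * P * Q - A p * Q\<^sup>2) / H p" for p
  define Y where "Y p = ((C p * P + B p * Q) / H p, (B p * P - A p * Q) / H p)" for p
  have Hnz: "H p \<noteq> 0" if "p \<in> points M" for p using H_pos[OF that] by (simp add: H_def)
  note cABC = isCont_coeff[OF C1_A] isCont_coeff[OF C1_B] isCont_coeff[OF C1_C]
  have wc: "isCont w p" if "p \<in> points M" for p
    unfolding w_def using Hnz[OF that] unfolding H_def by (intro continuous_intros cABC that)
  have Yc: "isCont Y p" if "p \<in> points M" for p
    unfolding Y_def using Hnz[OF that] unfolding H_def by (intro continuous_intros cABC that)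
  have vel: "((chart_map M i \<circ> x) has_vector_derivative fst (st.vel i c s)) (at s)"
      "((\<lambda>s. snd (c s)) has_vector_derivative Y (x s)) (at s)"
      "g i (x s) (fst (st.vel i c s)) (fst (st.vel i c s)) = w (x s)"
      "snd (st.vel i c s) = Y (x s)"
    if s: "s \<in> J" and i: "i \<in> idx M" "x s \<in> chart_dom M i" for s i
  proof -
    have i': "i \<in> idx MM" "c s \<in> chart_dom MM i" using i by (simp_all add: x_def mem_Times_iff)
    note v = st.geodesic_vel(1)[OF geo s i']
    show Ys: "snd (st.vel i c s) = Y (x s)" using y[OF s i] t[OF s i] by (simp add: Y_def prod_eq_iff)
    show "g i (x s) (fst (st.vel i c s)) (fst (st.vel i c s)) = w (x s)" using en[OF s i] by (simp add: w_def)
    show "((chart_map M i \<circ> x) has_vector_derivative fst (st.vel i c s)) (at s)"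
      using bounded_linear.has_vector_derivative[OF bounded_linear_fst v] by (simp add: x_def o_def)
    show "((\<lambda>s. snd (c s)) has_vector_derivative Y (x s)) (at s)"
      using bounded_linear.has_vector_derivative[OF bounded_linear_snd v] Ys by (simp add: o_def)
  qed
  have arc: "C1_arc M a a' x" if sub: "{a..a'} \<subseteq> J" for a a'
    unfolding C1_arc_def
  proof (intro ballI exI conjI impI)
    fix i assume i: "i \<in> idx M"
    show "continuous_on {s \<in> {a..a'}. x s \<in> chart_dom M i} (\<lambda>s. fst (st.vel i c s))"
    proof (intro continuous_at_imp_continuous_on ballI)
      fix s assume "s \<in> {s \<in> {a..a'}. x s \<in> chart_dom M i}"
      then have s: "s \<in> J" "x s \<in> chart_dom M i" using sub by auto
      have i': "i \<in> idx MM" "c s \<in> chart_dom MM i" using i s by (simp_all add: x_def mem_Times_iff)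
      show "isCont (\<lambda>s. fst (st.vel i c s)) s"
        by (rule isCont_fst[OF has_vector_derivative_continuous[OF st.geodesic_vel(2)[OF geo s(1) i']]])
    qed
    fix s assume "s \<in> {a..a'}" and s: "x s \<in> chart_dom M i"
    then have "s \<in> J" using sub by blast
    from vel(1)[OF this i s] show "((chart_map M i \<circ> x) has_vector_derivative fst (st.vel i c s)) (at s within {a..a'})"
      by (rule has_vector_derivative_at_within)
  qed
  have sp: "speed M g x s = sqrt (w (x s))" if s: "s \<in> J" for s
  proof -
    obtain i where i: "i \<in> idx M" "x s \<in> chart_dom M i" using xpt[OF s] by (auto simp: points_def)
    show ?thesis using speed_eq[where \<gamma> = x, OF i xc[OF s] vel(1)[OF s i]] vel(3)[OF s i] by simp
  qed
  have lip: "rdist (x a) (x a') \<le> L * (a' - a)"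
    if "a \<le> a'" "{a..a'} \<subseteq> J" "L \<ge> 0" "\<And>s. s \<in> {a..a'} \<Longrightarrow> speed M g x s \<le> L" for a a' L
  proof (cases "a = a'")
    case True
    then have "a \<in> J" using that by auto
    then show ?thesis using True d.mdist_zero[OF xpt[OF \<open>a \<in> J\<close>]] by simp
  next
    case False
    show ?thesis
    proof (rule riemannian_dist_le_speed[OF arc[OF that(2)] _ _ _ that(3)])
      show "continuous_on {a..a'} x" using xc that(2) by (intro continuous_at_imp_continuous_on) blast
      show "x ` {a..a'} \<subseteq> points M" using xpt that(2) by blast
    qed (use that False in auto)
  qed
  define f where "f s = rdist (x s) x0" for s
  have f0: "f s \<ge> 0" for s unfolding f_def by (rule riemannian_dist_nonneg)
  \<comment> \<open>Obtained by estimating 1 and the square of \<open>f\<close> by the square of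
    \<open>1 + f\<close> in the bound for \<open>w\<close>; as \<open>k\<close> may be negative, its
    absolute value is taken.\<close>
  define K where "K = sqrt (\<bar>E\<bar> + 2 * (P\<^sup>2 + Q\<^sup>2) * (l + \<bar>k\<bar>))"
  have Krad: "\<bar>E\<bar> + 2 * (P\<^sup>2 + Q\<^sup>2) * (l + \<bar>k\<bar>) \<ge> 0" using l by simp
  have K0: "K \<ge> 0" using Krad by (simp add: K_def)
  have spK: "speed M g x s \<le> K * (1 + f s)" if s: "s \<in> J" for s
  proof -
    note H = H_pos[OF xpt[OF s]]
    let ?m = "goedel_mu A B C (x s)"
    have "w (x s) \<le> E + 2 * (P\<^sup>2 + Q\<^sup>2) * (1 / ?m)"
      using inverse_fibre_metric_lower_bound(2)[OF H, of P Q] by (simp add: w_def H_def goedel_mu_def)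
    also have "\<dots> \<le> \<bar>E\<bar> + 2 * (P\<^sup>2 + Q\<^sup>2) * (l * (f s)\<^sup>2 + k)"
      using mu[OF xpt[OF s]] by (intro add_mono mult_left_mono) (auto simp: f_def)
    also have "\<dots> \<le> \<bar>E\<bar> * (1 + f s)\<^sup>2 + 2 * (P\<^sup>2 + Q\<^sup>2) * ((l + \<bar>k\<bar>) * (1 + f s)\<^sup>2)"
    proof (intro add_mono mult_left_mono)
      have one: "1 \<le> (1 + f s)\<^sup>2" using f0[of s] by simp
      then show "\<bar>E\<bar> \<le> \<bar>E\<bar> * (1 + f s)\<^sup>2" using mult_left_mono[OF one, of "\<bar>E\<bar>"] by simp
      have "l * (f s)\<^sup>2 \<le> l * (1 + f s)\<^sup>2" using f0[of s] l by (intro mult_left_mono power_mono) auto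
      moreover have "k \<le> \<bar>k\<bar> * (1 + f s)\<^sup>2" using mult_left_mono[OF one, of "\<bar>k\<bar>"] by simp
      ultimately show "l * (f s)\<^sup>2 + k \<le> (l + \<bar>k\<bar>) * (1 + f s)\<^sup>2" by (simp add: distrib_right)
    qed simp
    also have "\<dots> = K\<^sup>2 * (1 + f s)\<^sup>2" unfolding K_def real_sqrt_pow2[OF Krad] by (simp add: distrib_right mult.assoc)
    finally have "w (x s) \<le> (K * (1 + f s))\<^sup>2" by (simp add: power_mult_distrib)
    then have "sqrt (w (x s)) \<le> K * (1 + f s)" using K0 f0[of s] by (intro real_le_lsqrt) simp_all
    then show ?thesis using sp[OF s] by simp
  qed
  obtain s1 where s1: "s1 \<in> J" using J(3) by blast
  \<comment> \<open>On an interval of length \<open>h\<close> the bound on the speed by \<open>K (1 + f)\<close> gives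
    \<open>sup f \<le> f s0 + (1 + sup f) / 2\<close>; this single step replaces Gronwall's inequality.\<close>
  define h where "h = 1 / (2 * (K + 1))"
  have h: "h > 0" using K0 by (simp add: h_def)
  have Kh: "K * u \<le> 1 / 2" if "0 \<le> u" "u \<le> h" for u
  proof -
    have "K * u \<le> (K + 1) * h" using that K0 by (intro mult_mono) auto
    also have "\<dots> = 1 / 2" using K0 by (simp add: h_def)
    finally show ?thesis .
  qed
  define s0 where "s0 = max s1 (b - h)"
  have s0: "s0 \<in> J" using toJ[OF s1] Jb[OF s1] h by (simp add: s0_def)
  have s0b: "s0 < b" "b - s0 \<le> h" using Jb[OF s0] by (auto simp: s0_def)
  have tJ: "t \<in> J" if "s0 \<le> t" "t < b" for t using toJ[OF s0] that by blast
  have fb: "f s \<le> 2 * f s0 + 1" if s: "s0 \<le> s" "s < b" for s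
  proof -
    have sub: "{s0..s} \<subseteq> J" using s tJ by auto
    \<comment> \<open>Absorbing half of the supremum \<open>S\<close> of \<open>f\<close> into the
      left side requires \<open>S\<close> to be finite beforehand. On the compact interval
      \<open>{s0..s}\<close> a crude speed bound \<open>L0\<close>, which may depend on
      \<open>s\<close>, provides this; the resulting bound on \<open>f\<close> does not depend on
      \<open>s\<close>.\<close>
    have "continuous_on {s0..s} (\<lambda>r. speed M g x r)"
    proof (rule continuous_on_eq)
      show "continuous_on {s0..s} (\<lambda>r. sqrt (w (x r)))"
      proof (intro continuous_at_imp_continuous_on ballI)
        fix r assume "r \<in> {s0..s}"
        then have rJ: "r \<in> J" using sub by blast
        show "isCont (\<lambda>r. sqrt (w (x r))) r"
          by (rule isCont_o2[OF isCont_o2[OF xc[OF rJ] wc[OF xpt[OF rJ]]] isCont_real_sqrt])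
      qed
    qed (use sub sp in auto)
    then have "compact ((\<lambda>r. speed M g x r) ` {s0..s})" by (intro compact_continuous_image) auto
    then have "bounded ((\<lambda>r. speed M g x r) ` {s0..s})" by (rule compact_imp_bounded)
    then obtain L0 where "\<forall>y\<in>(\<lambda>r. speed M g x r) ` {s0..s}. norm y \<le> L0" unfolding bounded_iff ..
    then have L0: "\<bar>speed M g x r\<bar> \<le> L0" if "r \<in> {s0..s}" for r using that by simp
    have tri: "f r \<le> f s0 + rdist (x s0) (x r)" if "r \<in> {s0..s}" for r
    proof -
      have rJ: "r \<in> J" using that sub by blast
      show ?thesis
        using d.triangle[OF xpt[OF rJ] xpt[OF s0] x0] by (simp add: f_def d.commute[of "x s0"])
    qed
    have L00: "L0 \<ge> 0" using L0[of s0] s by simp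
    have "f r \<le> f s0 + L0 * (s - s0)" if r: "r \<in> {s0..s}" for r
    proof -
      have "rdist (x s0) (x r) \<le> L0 * (r - s0)"
      proof (rule lip[OF _ _ L00])
        show "{s0..r} \<subseteq> J" using sub r by auto
        show "speed M g x q \<le> L0" if "q \<in> {s0..r}" for q
          by (rule order_trans[OF abs_ge_self L0]) (use that r in auto)
      qed (use r in simp)
      also have "\<dots> \<le> L0 * (s - s0)" using r L00 by (intro mult_left_mono) auto
      finally have "rdist (x s0) (x r) \<le> L0 * (s - s0)" .
      with tri[OF r] show ?thesis by (rule order_trans[OF _ add_left_mono])
    qed
    then have bdf: "bdd_above (f ` {s0..s})" by (intro bdd_aboveI[of _ "f s0 + L0 * (s - s0)"]) auto
    define S where "S = Sup (f ` {s0..s})"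
    have fS: "f r \<le> S" if "r \<in> {s0..s}" for r unfolding S_def using that bdf by (intro cSup_upper) auto
    have S0: "S \<ge> 0" using fS[of s0] f0[of s0] s by simp
    have "f r \<le> f s0 + (1 / 2) * (1 + S)" if r: "r \<in> {s0..s}" for r
    proof -
      have "rdist (x s0) (x r) \<le> (K * (1 + S)) * (r - s0)"
      proof (rule lip)
        show "speed M g x q \<le> K * (1 + S)" if "q \<in> {s0..r}" for q
        proof -
          have q: "q \<in> {s0..s}" using that r by auto
          then have "speed M g x q \<le> K * (1 + f q)" using sub by (intro spK) auto
          also have "\<dots> \<le> K * (1 + S)" using K0 fS[OF q] by (intro mult_left_mono) auto
          finally show ?thesis .
        qed
        show "{s0..r} \<subseteq> J" using sub r by auto
      qed (use r K0 S0 in auto)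
      also have "\<dots> = (K * (r - s0)) * (1 + S)" by simp
      also have "\<dots> \<le> (1 / 2) * (1 + S)" using r s s0b S0 by (intro mult_right_mono Kh) auto
      finally have "rdist (x s0) (x r) \<le> (1 / 2) * (1 + S)" .
      with tri[OF r] show ?thesis by (rule order_trans[OF _ add_left_mono])
    qed
    then have "S \<le> f s0 + (1 / 2) * (1 + S)" unfolding S_def using s by (intro cSup_least) auto
    then have S: "S \<le> 2 * f s0 + 1" by (rule le_double_add_one)
    have "f s \<le> S" by (rule fS) (use s in simp)
    then show ?thesis using S by (rule order_trans)
  qed
  \<comment> \<open>From \<open>K * (1 + f s)\<close> and the bound
    \<open>f s \<le> 2 * f s0 + 1\<close>.\<close>
  define L where "L = K * (2 + 2 * f s0)"
  have L0: "L \<ge> 0" unfolding L_def using K0 f0[of s0] by simp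
  have spL: "speed M g x s \<le> L" if "s0 \<le> s" "s < b" for s
  proof -
    have "speed M g x s \<le> K * (1 + f s)" by (rule spK[OF tJ[OF that]])
    also have "\<dots> \<le> L" unfolding L_def using fb[OF that] K0 by (intro mult_left_mono) auto
    finally show ?thesis .
  qed
  have lipL: "rdist (x r) (x s) \<le> L * (s - r)" if "s0 \<le> r" "r \<le> s" "s < b" for r s
    by (rule lip) (use that tJ spL L0 in auto)
  \<comment> \<open>Completeness concerns sequences, so times tending to \<open>b\<close> from below
    are fixed.\<close>
  define \<tau> where "\<tau> n = b - (b - s0) * inverse (real (Suc n))" for n
  have \<tau>: "s0 \<le> \<tau> n" "\<tau> n < b" for n
  proof -
    have "inverse (real (Suc n)) \<le> 1" "inverse (real (Suc n)) > 0" by (simp_all add: inverse_le_1_iff)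
    then have "(b - s0) * inverse (real (Suc n)) \<le> (b - s0) * 1" "(b - s0) * inverse (real (Suc n)) > 0"
      using s0b(1) by (intro mult_left_mono, auto)
    then show "s0 \<le> \<tau> n" "\<tau> n < b" by (simp_all add: \<tau>_def)
  qed
  have \<tau>lim: "\<tau> \<longlonglongrightarrow> b"
  proof -
    have "\<tau> \<longlonglongrightarrow> b - (b - s0) * 0" unfolding \<tau>_def by (intro tendsto_intros LIMSEQ_inverse_real_of_nat)
    then show ?thesis by simp
  qed
  have near: "\<exists>N. \<forall>n\<ge>N. L * (b - \<tau> n) < e" if "e > 0" for e
  proof -
    have "(\<lambda>n. L * (b - \<tau> n)) \<longlonglongrightarrow> L * (b - b)" by (intro tendsto_intros \<tau>lim)
    then have "eventually (\<lambda>n. L * (b - \<tau> n) < e) sequentially" using that by (intro order_tendstoD(2)) auto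
    then show ?thesis unfolding eventually_sequentially .
  qed
  have lipb: "rdist (x r) (x s) \<le> L * (b - r)" if "s0 \<le> r" "r \<le> s" "s < b" for r s
  proof -
    have "L * (s - r) \<le> L * (b - r)" using that L0 by (intro mult_left_mono) auto
    then show ?thesis using lipL[OF that] by simp
  qed
  have "d.MCauchy (\<lambda>n. x (\<tau> n))"
    unfolding d.MCauchy_def
  proof (intro conjI allI impI)
    show "range (\<lambda>n. x (\<tau> n)) \<subseteq> points M" using xpt tJ \<tau> by blast
    fix e :: real assume "e > 0"
    then obtain N where N: "\<And>n. n \<ge> N \<Longrightarrow> L * (b - \<tau> n) < e" using near by blast
    have "rdist (x (\<tau> n)) (x (\<tau> n')) < e" if "N \<le> n" "N \<le> n'" for n n'
    proof (cases "\<tau> n \<le> \<tau> n'")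
      case True
      then show ?thesis using lipb[OF \<tau>(1) True \<tau>(2)] N[OF that(1)] by simp
    next
      case False
      then have "\<tau> n' \<le> \<tau> n" by simp
      from lipb[OF \<tau>(1) this \<tau>(2)] N[OF that(2)] show ?thesis by (simp add: d.commute[of "x (\<tau> n)"])
    qed
    then show "\<exists>N. \<forall>n n'. N \<le> n \<longrightarrow> N \<le> n' \<longrightarrow> rdist (x (\<tau> n)) (x (\<tau> n')) < e" by blast
  qed
  then obtain p where "limitin d.mtopology (\<lambda>n. x (\<tau> n)) p sequentially"
    using complete unfolding complete_riemannian_def d.mcomplete_def by blast
  then have p: "p \<in> points M" and plim: "\<And>e. e > 0 \<Longrightarrow> \<exists>N. \<forall>n\<ge>N. rdist (x (\<tau> n)) p < e"
    unfolding d.limit_metric_sequentially by blast+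
  \<comment> \<open>Passes from the sequence to the one-sided limit: the Lipschitz bound between
    \<open>x (\<tau> n)\<close> and \<open>x s\<close> persists for the limit point by the triangle
    inequality.\<close>
  have dp: "rdist p (x s) \<le> L * (b - s)" if s: "s0 \<le> s" "s < b" for s
  proof (rule field_le_epsilon)
    fix e :: real assume "e > 0"
    then obtain N where N: "\<And>n. n \<ge> N \<Longrightarrow> rdist (x (\<tau> n)) p < e" using plim by blast
    have "eventually (\<lambda>n. \<tau> n > s) sequentially" by (rule order_tendstoD(1)[OF \<tau>lim s(2)])
    then obtain N' where N': "\<And>n. n \<ge> N' \<Longrightarrow> \<tau> n > s" unfolding eventually_sequentially by blast
    define n where "n = max N N'"
    have "rdist p (x s) \<le> rdist p (x (\<tau> n)) + rdist (x (\<tau> n)) (x s)"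
      by (rule d.triangle[OF p xpt[OF tJ[OF \<tau>]] xpt[OF tJ[OF s]]])
    moreover have "rdist p (x (\<tau> n)) < e" using N[of n] by (simp add: n_def d.commute[of p])
    moreover have "rdist (x (\<tau> n)) (x s) \<le> L * (b - s)"
      using lipb[OF s(1) _ \<tau>(2), of n] N'[of n] by (simp add: n_def d.commute[of "x (\<tau> _)"])
    ultimately show "rdist p (x s) \<le> L * (b - s) + e" by linarith
  qed
  have Ioo: "eventually (\<lambda>s. s0 < s \<and> s < b) (at_left b)"
    using eventually_at_left_real[OF s0b(1)] by eventually_elim simp
  have xlim: "(x \<longlongrightarrow> p) (at_left b)"
  proof (rule topological_tendstoI)
    fix W assume W: "open W" "p \<in> W"
    obtain e where e: "e > 0" "\<forall>q\<in>points M. rdist p q < e \<longrightarrow> q \<in> W"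
      using riemannian_dist_nbhd[OF p W] by blast
    have "((\<lambda>s. L * (b - s)) \<longlongrightarrow> L * (b - b)) (at_left b)" by (intro tendsto_intros)
    then have "eventually (\<lambda>s. L * (b - s) < e) (at_left b)" using e(1) by (intro order_tendstoD(2)) auto
    with Ioo show "eventually (\<lambda>s. x s \<in> W) (at_left b)"
    proof eventually_elim
      case (elim s)
      then have "rdist p (x s) < e" using dp[of s] by simp
      moreover have "x s \<in> points M" using xpt tJ elim by simp
      ultimately show ?case using e(2) by blast
    qed
  qed
  obtain i where i: "i \<in> idx M" "p \<in> chart_dom M i" using p by (auto simp: points_def)
  obtain r m where r: "r > 0" "m > 0" "cball (chart_map M i p) r \<subseteq> chart_image i"
    and m: "\<And>z u. z \<in> cball (chart_map M i p) r \<Longrightarrow> m * norm u \<le> sqrt (loc_metric i z u u)"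
    by (rule metric_lower_bound[OF i]) blast
  \<comment> \<open>Near the limit point, continuity of \<open>w\<close> and \<open>Y\<close> at
    \<open>p\<close> bounds the squared base speed and the fibre velocity.\<close>
  have "eventually (\<lambda>s. x s \<in> chart_dom M i) (at_left b)"
    by (rule topological_tendstoD[OF xlim open_chart_dom[OF i(1)] i(2)])
  moreover have "eventually (\<lambda>s. dist (chart_map M i (x s)) (chart_map M i p) < r) (at_left b)"
    by (rule tendstoD[OF isCont_tendsto_compose[OF isCont_chart[OF i] xlim] r(1)])
  moreover have "eventually (\<lambda>s. w (x s) < w p + 1) (at_left b)"
    by (rule order_tendstoD(2)[OF isCont_tendsto_compose[OF wc[OF p] xlim]]) simp
  moreover have "eventually (\<lambda>s. norm (Y (x s)) < norm (Y p) + 1) (at_left b)"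
    by (rule order_tendstoD(2)[OF tendsto_norm[OF isCont_tendsto_compose[OF Yc[OF p] xlim]]]) simp
  ultimately have "eventually (\<lambda>s. s0 < s \<and> s < b \<and> x s \<in> chart_dom M i \<and>
      dist (chart_map M i (x s)) (chart_map M i p) < r \<and> w (x s) < w p + 1 \<and> norm (Y (x s)) < norm (Y p) + 1) (at_left b)"
    using Ioo by eventually_elim simp
  then obtain a where ab: "a < b" and a: "\<And>s. a < s \<Longrightarrow> s < b \<Longrightarrow> s0 < s \<and> s < b \<and> x s \<in> chart_dom M i \<and>
      dist (chart_map M i (x s)) (chart_map M i p) < r \<and> w (x s) < w p + 1 \<and> norm (Y (x s)) < norm (Y p) + 1"
    unfolding eventually_at_left_field by blast
  have as: "s \<in> J" "x s \<in> chart_dom M i" "norm (Y (x s)) \<le> norm (Y p) + 1" if "s \<in> {a<..<b}" for s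
    using a[of s] that tJ[of s] by auto
  \<comment> \<open>The constant \<open>m\<close> compares the Euclidean norm in the chart with the
    Riemannian norm, whose square along the geodesic is \<open>w (x s)\<close>.\<close>
  have ub: "norm (fst (st.vel i c s)) \<le> sqrt (w p + 1) / m" if s: "s \<in> {a<..<b}" for s
  proof -
    have "m * norm (fst (st.vel i c s)) \<le> sqrt (loc_metric i (chart_map M i (x s)) (fst (st.vel i c s)) (fst (st.vel i c s)))"
      using a[of s] s by (intro m) (auto simp: dist_commute)
    also have "\<dots> = sqrt (w (x s))"
      using vel(3)[OF as(1)[OF s] i(1) as(2)[OF s]] by (simp add: chart_inv_chart[OF i(1) as(2)[OF s]])
    also have "\<dots> \<le> sqrt (w p + 1)" using a[of s] s by (simp add: less_imp_le)
    finally show ?thesis using r(2) by (simp add: pos_le_divide_eq mult.commute)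
  qed
  have Vb: "norm (st.vel i c s) \<le> sqrt (w p + 1) / m + (norm (Y p) + 1)" if s: "s \<in> {a<..<b}" for s
  proof -
    have "norm (st.vel i c s) \<le> norm (fst (st.vel i c s)) + norm (snd (st.vel i c s))"
      using norm_Pair_le[of "fst (st.vel i c s)" "snd (st.vel i c s)"] by simp
    also have "snd (st.vel i c s) = Y (x s)" by (rule vel(4)[OF as(1)[OF s] i(1) as(2)[OF s]])
    finally show ?thesis using ub[OF s] as(3)[OF s] by linarith
  qed
  \<comment> \<open>The fibre coordinates converge because their derivative \<open>Y (x s)\<close>
    is bounded near \<open>b\<close>.\<close>
  obtain q where q: "((\<lambda>s. snd (c s)) \<longlongrightarrow> q) (at_left b)"
    using bounded_derivative_imp_limit_at_left[OF ab vel(2)[OF as(1) i(1) as(2)] as(3)] by blast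
  have clim: "(c \<longlongrightarrow> (p, q)) (at_left b)"
    using tendsto_Pair[OF xlim q] by (simp add: x_def)
  show ?thesis
  proof (rule st.geodesic_extension[OF geo ab _ _ _ _ clim _ Vb])
    show "{a<..<b} \<subseteq> J" using as(1) by blast
    show "J \<subseteq> {..<b}" using Jb by blast
    show "i \<in> idx MM" "(p, q) \<in> chart_dom MM i" using i by simp_all
    show "c s \<in> chart_dom MM i" if "s \<in> {a<..<b}" for s using as(2)[OF that] by (simp add: x_def mem_Times_iff)
  qed
qed

theorem geodesically_complete_times:
  assumes complete: "complete_riemannian M g" and x0: "x0 \<in> points M" and l: "l \<ge> 0"
    and mu: "\<And>x. x \<in> points M \<Longrightarrow> 1 / goedel_mu A B C x \<le> l * (rdist x x0)\<^sup>2 + k"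
  shows "geodesically_complete MM gg"
  unfolding geodesically_complete_def
proof (intro allI impI)
  fix J c assume inext: "inextendible_geodesic MM gg J c"
  then have geo: "geodesic_on MM gg J c" and
    no: "\<And>J' c'. \<lbrakk>J \<subset> J'; geodesic_on MM gg J' c'; \<forall>s\<in>J. c' s = c s\<rbrakk> \<Longrightarrow> False"
    unfolding inextendible_geodesic_def by blast+
  have ext: "\<exists>J' c'. J \<subset> J' \<and> geodesic_on MM gg J' c' \<and> (\<forall>s\<in>J. c' s = c s)"
    if "geodesic_on MM gg J c" "bdd_above J" for J c
    by (rule bounded_geodesic_extends[OF complete x0 l _ that]) (rule mu)
  have J: "is_interval J" "J \<noteq> {}" using geo unfolding st.geodesic_on_iff by simp_all
  have na: "\<not> bdd_above J"
  proof
    assume "bdd_above J"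
    from ext[OF geo this] no show False by blast
  qed
  have nb: "\<not> bdd_below J"
  proof
    assume "bdd_below J"
    then have "bdd_above (uminus ` J)" by simp
    \<comment> \<open>An extension of the reversed geodesic, reversed back, extends \<open>c\<close>
      beyond its lower end.\<close>
    from ext[OF st.geodesic_on_reverse[OF geo] this] obtain J' c' where
      J': "uminus ` J \<subset> J'" "geodesic_on MM gg J' c'" "\<forall>s\<in>uminus ` J. c' s = c (- s)" by blast
    have "J \<subseteq> uminus ` J'"
    proof
      fix s assume "s \<in> J"
      then have "- s \<in> J'" using J'(1) by blast
      then show "s \<in> uminus ` J'" by (intro rev_image_eqI[of "- s"]) auto
    qed
    moreover have "J \<noteq> uminus ` J'"
    proof
      assume "J = uminus ` J'"
      then have "uminus ` J = J'" by (simp add: image_image)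
      then show False using J'(1) by simp
    qed
    ultimately have "J \<subset> uminus ` J'" by blast
    then show False by (rule no[OF _ st.geodesic_on_reverse[OF J'(2)]]) (use J'(3) in auto)
  qed
  show "J = UNIV"
  proof (intro set_eqI iffI UNIV_I)
    fix s :: real
    obtain u v where "u \<in> J" "u < s" "v \<in> J" "s < v"
      using na nb unfolding bdd_above_def bdd_below_def by (meson not_le)
    then show "s \<in> J" using J(1)[unfolded is_interval_1, rule_format, of u v s] by simp
  qed
qed

end

theorem theorem4p1:
  fixes M0 :: "('i, 'a::{t2_space, second_countable_topology}, 'e::euclidean_space) atlas"
    and g :: "('i, 'a, 'e) tensor2"
    and A B C :: "'a \<Rightarrow> real"
    and l k :: real
    and x0 :: 'a
  assumes "goedel_data M0 g A B C"
    and "complete_riemannian M0 g"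
    and "l \<ge> 0"
    and "x0 \<in> points M0"
    and "\<And>x. x \<in> points M0 \<Longrightarrow>
           1 / goedel_mu A B C x \<le> l * (riemannian_dist M0 g x x0)\<^sup>2 + k"
  shows "geodesically_complete (times_R2 M0) (goedel_metric g A B C)"
proof -
  from assms(1) have data: "riemannian_manifold M0 g" "connected (points M0)"
    "Ck_function 1 M0 A" "Ck_function 1 M0 B" "Ck_function 1 M0 C"
    "\<forall>x\<in>points M0. (B x)\<^sup>2 + A x * C x > 0"
    unfolding goedel_data_def by simp_all
  interpret riemannian_atlas M0 g
    using data(1,2) by (rule riemannian_manifold_imp_atlas)
  interpret goedel_spacetime M0 g A B C
    by unfold_locales (use data in auto)
  show ?thesis
    using assms(2,4,3,5) by (rule geodesically_complete_times)
qed

end
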